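(* Let $X$ be a Banach space with a basis and let $\xi<\omega_1$. (1) If $I_{hs}(X)>\xi$, then $I_{hb}(X)>\omega^{\xi}$. (2) If $I_{hb}(X)>\omega^{\xi}$, then $I_{hs}(Y_0)>\xi$ for some block subspace $Y_0$ of $X$.
   Context: Blocks. Let $X$ have basis $(e_i)$. For $x=\sum x_ie_i$, $\operatorname{supp}x=\{i:x_i\ne0\}$; $x<y$ means $\max\operatorname{supp}x<\min\operatorname{supp}y$. A block sequence is a (finite or infinite) sequence with $x_1<x_2<\cdots$; a block subspace is the closed span of an infinite block sequence (and is regarded as a space with that block sequence as basis). Trees. A tree on a set $X$ is a set $\mathcal{T}\subset\bigcup_{n\ge 1}X^n$ such that $(x_1,\dots,x_k)\in\mathcal{T}$ whenever $(x_1,\dots,x_{k+1})\in\mathcal{T}$. Put $D(\mathcal{T})=\{(x_1,\dots,x_k): (x_1,\dots,x_k,x)\in\mathcal{T}\text{ for some }x\in X\}$, $D^0(\mathcal T)=\mathcal T$, $D^{\alpha+1}(\mathcal T)=D(D^\alpha(\mathcal T))$, $D^\alpha(\mathcal T)=\bigcap_{\beta<\alpha}D^\beta(\mathcal T)$ for limit $\alpha$. The order of a well-founded tree is $o(\mathcal T)=\inf\{\alpha: D^\alpha(\mathcal T)=\emptyset\}$; a tree that is not well-founded is given order $\omega_1$. An $\ell_1$-tree with constant $C\ge1$ is a tree each of whose elements $(x_1,\dots,x_k)$ is a normalized sequence $C$-equivalent to the unit vector basis of $\ell_1^k$. The block $\ell_1$-index is $I_b(X)=\sup\{o(\mathcal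 T)\}$ over all $\ell_1$-trees $\mathcal T$ on $X$ (with any constant $C\ge1$) consisting only of block sequences. The hereditary block $\ell_1$-index is $I_{hb}(X)=\min\{I_b(Y):Y\text{ a block subspace of }X\}$. Schreier families. $\mathcal S_0=\{\{n\}:n\in\mathbb N\}\cup\{\emptyset\}$; $\mathcal S_{\xi+1}=\{F_1\cup\dots\cup F_m: m\in\mathbb N,\ F_i\in\mathcal S_\xi,\ m\le F_1<\dots<F_m\}$; for limit $\xi<\omega_1$ one fixes $\xi_n\nearrow\xi$ and sets $\mathcal S_\xi=\{F: F\in\mathcal S_{\xi_n}\text{ and }n\le F\text{ for some }n\}$. A set $F\in\mathcal S_\xi$ is $\mathcal S_\xi$-maximal if it is not properly contained in another element of $\mathcal S_\xi$. A block sequence $(x_i)_{i=1}^k$ is maximal $\mathcal S_\xi$-admissible if $\{\min\operatorname{supp}x_i:i\le k\}$ is an $\mathcal S_\xi$-maximal set. Game. The $\mathcal S_\xi$-game with constant $C$ between players $S$ and $V$: in the $i$-th move $S$ chooses a block subspace $X_i$ of $X$ and $V$ picks a normalized block vector (finitely supported vector) $x_i\in X_i$. Player $V$ wins if the resulting finite sequence $(x_i)_{i=1}^k$ is $C$-equivalent to the unit vector basis of $\ell_1^k$ and maximal $\mathcal S_\xi$-admissible. $V$ has a winning strategy if $V$ can win against all possible choices of $S$. The hereditary strategic $\ell_1$-index is $$I_{hs}(X)=\sup\{\xi<\omega_1:\ \text{for every }\zeta<\xi\text{ there is }C\ge1\text{ such that }V\text{ has a winning strategy in the }\mathcal S_\zeta\text{-game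 with constant }C\}.$$ *)

theory Defs
  imports "HOL-Analysis.Analysis" "HOL-Library.Countable_Set_Type"
begin

section \<open>Ordinals up to the first uncountable one\<close>

text \<open>
  The relation \<open>cardSuc natLeq\<close> is a well-order of type \<open>\<omega>\<^sub>1\<close>.  An ordinal \<open>\<alpha> \<le> \<omega>\<^sub>1\<close> is
  represented by the initial segment of that order consisting of the ordinals below \<open>\<alpha>\<close>, so
  that the order is inclusion, \<open>bot\<close> is \<open>0\<close> and \<open>top\<close> is \<open>\<omega>\<^sub>1\<close>
  (see \<open>countable_below\<close> and \<open>uncountable_below_omega1\<close>).
\<close>

abbreviation omega1_rel :: "nat set rel" where
  "omega1_rel \<equiv> cardSuc natLeq"

lemma wo_omega1_rel: "wo_rel omega1_rel"
  using cardSuc_Card_order[OF natLeq_Card_order] card_order_on_well_order_on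
  by (auto simp: wo_rel_def)

typedef ordinal = "{A. wo_rel.ofilter omega1_rel A}"
  using wo_rel.Field_ofilter[OF wo_omega1_rel] by blast

setup_lifting type_definition_ordinal

lemma ofilter_linear:
  "wo_rel.ofilter omega1_rel A \<Longrightarrow> wo_rel.ofilter omega1_rel B \<Longrightarrow> A \<subseteq> B \<or> B \<subseteq> A"
  using wo_rel.ofilter_linord[OF wo_omega1_rel] by blast

instantiation ordinal :: complete_linorder
begin

lift_definition less_eq_ordinal :: "ordinal \<Rightarrow> ordinal \<Rightarrow> bool" is "(\<subseteq>)" .
lift_definition less_ordinal :: "ordinal \<Rightarrow> ordinal \<Rightarrow> bool" is "(\<subset>)" .
lift_definition sup_ordinal :: "ordinal \<Rightarrow> ordinal \<Rightarrow> ordinal" is "(\<union>)"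
  by (auto simp: wo_rel.ofilter_def[OF wo_omega1_rel])
lift_definition inf_ordinal :: "ordinal \<Rightarrow> ordinal \<Rightarrow> ordinal" is "(\<inter>)"
  by (auto simp: wo_rel.ofilter_def[OF wo_omega1_rel])
lift_definition bot_ordinal :: ordinal is "{}"
  by (auto simp: wo_rel.ofilter_def[OF wo_omega1_rel])
lift_definition top_ordinal :: ordinal is "Field omega1_rel"
  by (rule wo_rel.Field_ofilter[OF wo_omega1_rel])
lift_definition Sup_ordinal :: "ordinal set \<Rightarrow> ordinal" is "\<Union>"
  unfolding wo_rel.ofilter_def[OF wo_omega1_rel] by blast
lift_definition Inf_ordinal :: "ordinal set \<Rightarrow> ordinal" is "\<lambda>Q. Field omega1_rel \<inter> \<Inter>Q"
  by (auto simp: wo_rel.ofilter_def[OF wo_omega1_rel] Order_Relation.under_def Field_def)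

instance
proof
  fix x y z :: ordinal and Q :: "ordinal set"
  have field: "Rep_ordinal u \<subseteq> Field omega1_rel" for u
    using Rep_ordinal[of u] by (simp add: wo_rel.ofilter_def[OF wo_omega1_rel])
  show "x < y \<longleftrightarrow> x \<le> y \<and> \<not> y \<le> x" and "x \<le> x" and "x \<le> y \<Longrightarrow> y \<le> z \<Longrightarrow> x \<le> z"
    unfolding less_eq_ordinal.rep_eq less_ordinal.rep_eq by auto
  show "x = y" if "x \<le> y" "y \<le> x"
    using that unfolding less_eq_ordinal.rep_eq by (metis Rep_ordinal_inject subset_antisym)
  show "x \<le> y \<or> y \<le> x"
    using ofilter_linear Rep_ordinal unfolding less_eq_ordinal.rep_eq by blast
  show "inf x y \<le> x" "inf x y \<le> y" "x \<le> y \<Longrightarrow> x \<le> z \<Longrightarrow> x \<le> inf y z"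
    unfolding less_eq_ordinal.rep_eq inf_ordinal.rep_eq by auto
  show "x \<le> sup x y" "y \<le> sup x y" "y \<le> x \<Longrightarrow> z \<le> x \<Longrightarrow> sup y z \<le> x"
    unfolding less_eq_ordinal.rep_eq sup_ordinal.rep_eq by auto
  show "x \<in> Q \<Longrightarrow> Inf Q \<le> x"
    unfolding less_eq_ordinal.rep_eq Inf_ordinal.rep_eq by auto
  show "(\<And>u. u \<in> Q \<Longrightarrow> z \<le> u) \<Longrightarrow> z \<le> Inf Q"
    unfolding less_eq_ordinal.rep_eq Inf_ordinal.rep_eq using field[of z] by auto
  show "x \<in> Q \<Longrightarrow> x \<le> Sup Q"
    unfolding less_eq_ordinal.rep_eq Sup_ordinal.rep_eq by auto
  show "(\<And>u. u \<in> Q \<Longrightarrow> u \<le> z) \<Longrightarrow> Sup Q \<le> z"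
    unfolding less_eq_ordinal.rep_eq Sup_ordinal.rep_eq by auto
  show "Inf {} = (top :: ordinal)"
    by (simp add: Rep_ordinal_inject[symmetric] Inf_ordinal.rep_eq top_ordinal.rep_eq)
  show "Sup {} = (bot :: ordinal)"
    by (simp add: Rep_ordinal_inject[symmetric] Sup_ordinal.rep_eq bot_ordinal.rep_eq)
qed

end

lemma Inf_ordinal_mem:
  fixes Q :: "ordinal set"
  assumes "Q \<noteq> {}"
  shows "Inf Q \<in> Q"
proof (rule ccontr)
  interpret r: wo_rel omega1_rel by (rule wo_omega1_rel)
  assume nin: "Inf Q \<notin> Q"
  define I where "I = Rep_ordinal (Inf Q)"
  have I: "I = Field omega1_rel \<inter> \<Inter>(Rep_ordinal ` Q)"
    unfolding I_def by (rule Inf_ordinal.rep_eq)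
  have ofl: "r.ofilter (Rep_ordinal q)" for q
    using Rep_ordinal[of q] by simp
  have strict: "I \<subset> Rep_ordinal q" if "q \<in> Q" for q
    using that nin Inf_lower[OF that] unfolding I_def
    by (metis antisym_conv2 less_ordinal.rep_eq)
  define m where "m = r.minim (Field omega1_rel - I)"
  have ne: "Field omega1_rel - I \<noteq> {}"
    using assms strict ofl unfolding r.ofilter_def by blast
  have m: "m \<in> Field omega1_rel - I"
    unfolding m_def using r.minim_in[of "Field omega1_rel - I"] ne by blast
  have "m \<in> Rep_ordinal q" if q: "q \<in> Q" for q
  proof -
    obtain x where x: "x \<in> Rep_ordinal q" "x \<notin> I" using strict[OF q] by blast
    then have "x \<in> Field omega1_rel - I" using ofl[of q] unfolding r.ofilter_def by blast
    then have "(m, x) \<in> omega1_rel"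
      unfolding m_def using r.minim_least[of "Field omega1_rel - I"] by blast
    then show ?thesis
      using ofl[of q] x unfolding r.ofilter_def Order_Relation.under_def by blast
  qed
  then show False using m I by auto
qed

instance ordinal :: wellorder
proof
  fix P :: "ordinal \<Rightarrow> bool" and a :: ordinal
  assume step: "\<And>x. (\<And>y. y < x \<Longrightarrow> P y) \<Longrightarrow> P x"
  show "P a"
  proof (rule ccontr)
    assume "\<not> P a"
    then have "Inf {x. \<not> P x} \<in> {x. \<not> P x}" by (intro Inf_ordinal_mem) auto
    moreover have "P (Inf {x. \<not> P x})"
      by (rule step) (metis Inf_lower mem_Collect_eq not_le)
    ultimately show False by simp
  qed
qed

abbreviation omega1 :: ordinal where "omega1 \<equiv> top"

lemma countable_below:
  includes cardinal_syntax
  fixes \<alpha> :: ordinal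
  assumes "\<alpha> < omega1"
  shows "countable {..<\<alpha>}"
proof -
  interpret r: wo_rel omega1_rel by (rule wo_omega1_rel)
  have seg: "\<exists>a \<in> Field omega1_rel. Rep_ordinal \<beta> = Order_Relation.underS omega1_rel a"
    if "\<beta> < omega1" for \<beta> :: ordinal
    using r.ofilter_underS_Field[of "Rep_ordinal \<beta>"] Rep_ordinal[of \<beta>] that
    by (auto simp: less_ordinal.rep_eq top_ordinal.rep_eq)
  obtain a where a: "a \<in> Field omega1_rel" "Rep_ordinal \<alpha> = Order_Relation.underS omega1_rel a"
    using seg assms by blast
  have "|Order_Relation.underS omega1_rel a| <o omega1_rel"
    using card_of_underS[OF cardSuc_Card_order[OF natLeq_Card_order]] a by blast
  then have "|Order_Relation.underS omega1_rel a| \<le>o natLeq"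
    using cardSuc_ordLeq_ordLess[OF natLeq_Card_order card_of_Card_order] by blast
  then have cA: "countable (Rep_ordinal \<alpha>)"
    using a(2) countable_card_le_natLeq by metis
  have "Rep_ordinal ` {..<\<alpha>} \<subseteq> Order_Relation.underS omega1_rel ` Rep_ordinal \<alpha>"
  proof
    fix B assume "B \<in> Rep_ordinal ` {..<\<alpha>}"
    then obtain \<beta> where \<beta>: "\<beta> < \<alpha>" "B = Rep_ordinal \<beta>" by auto
    then obtain b where b: "b \<in> Field omega1_rel" "B = Order_Relation.underS omega1_rel b"
      using seg[of \<beta>] assms by (meson order.strict_trans)
    obtain x where x: "x \<in> Rep_ordinal \<alpha>" "x \<notin> B"
      using \<beta> by (auto simp: less_ordinal.rep_eq)
    have xF: "x \<in> Field omega1_rel"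
      using x a(2) by (auto simp: Order_Relation.underS_def Field_def)
    have "(b, x) \<in> omega1_rel"
      using x(2) b xF r.TOTALS r.REFL
      by (auto simp: Order_Relation.underS_def refl_on_def)
    then have "b \<in> Rep_ordinal \<alpha>"
      using Rep_ordinal[of \<alpha>] x(1)
      unfolding mem_Collect_eq r.ofilter_def Order_Relation.under_def by blast
    then show "B \<in> Order_Relation.underS omega1_rel ` Rep_ordinal \<alpha>" using b by auto
  qed
  then have "countable (Rep_ordinal ` {..<\<alpha>})"
    using countable_subset[OF _ countable_image[OF cA]] by blast
  moreover have "inj_on Rep_ordinal {..<\<alpha>}"
    by (simp add: Rep_ordinal_inject inj_on_def)
  ultimately show ?thesis using countable_image_inj_on by blast
qed

lemma uncountable_below_omega1:
  includes cardinal_syntax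
  shows "uncountable {..<omega1}"
proof
  interpret r: wo_rel omega1_rel by (rule wo_omega1_rel)
  assume c: "countable {..<omega1}"
  define f where "f a = Abs_ordinal (Order_Relation.underS omega1_rel a)" for a
  have Rf: "Rep_ordinal (f a) = Order_Relation.underS omega1_rel a" for a
    unfolding f_def by (rule Abs_ordinal_inverse) (simp add: r.underS_ofilter)
  have "f a < omega1" if a: "a \<in> Field omega1_rel" for a
  proof -
    have "Order_Relation.underS omega1_rel a \<subseteq> Field omega1_rel"
      using r.underS_ofilter[of a] unfolding r.ofilter_def by blast
    moreover have "a \<notin> Order_Relation.underS omega1_rel a"
      unfolding Order_Relation.underS_def by blast
    ultimately show ?thesis
      using a unfolding less_ordinal.rep_eq top_ordinal.rep_eq Rf by blast
  qed
  then have "f ` Field omega1_rel \<subseteq> {..<omega1}" by auto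
  moreover have "inj_on f (Field omega1_rel)"
  proof (rule inj_onI)
    fix a b assume ab: "a \<in> Field omega1_rel" "b \<in> Field omega1_rel" "f a = f b"
    then have "Order_Relation.underS omega1_rel a = Order_Relation.underS omega1_rel b"
      using Rf by metis
    moreover have "(a, b) \<in> omega1_rel \<or> (b, a) \<in> omega1_rel"
      using ab r.TOTALS by simp
    ultimately show "a = b"
      unfolding Order_Relation.underS_def set_eq_iff mem_Collect_eq by metis
  qed
  ultimately have "countable (Field omega1_rel)"
    using countable_image_inj_on[OF countable_subset[OF _ c]] by blast
  then have "|Field omega1_rel| \<le>o natLeq" by (simp add: countable_card_le_natLeq)
  then have "omega1_rel \<le>o natLeq"
    by (rule ordIso_ordLeq_trans[OF ordIso_symmetric[OF
          card_of_Field_ordIso[OF cardSuc_Card_order[OF natLeq_Card_order]]]])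
  then show False
    using not_ordLess_ordLeq[OF cardSuc_greater[OF natLeq_Card_order]] by simp
qed

subsection \<open>Successors, limits, transfinite recursion\<close>

text \<open>With the conventions of the type, \<open>osuc omega1 = omega1\<close>; everything else is as usual.\<close>

definition osuc :: "ordinal \<Rightarrow> ordinal" where
  "osuc \<alpha> = Inf {\<beta>. \<alpha> < \<beta>}"

definition opred :: "ordinal \<Rightarrow> ordinal" where
  "opred \<alpha> = Sup {..<\<alpha>}"

definition is_limit :: "ordinal \<Rightarrow> bool" where
  "is_limit \<alpha> \<longleftrightarrow> \<alpha> \<noteq> bot \<and> (\<forall>\<beta><\<alpha>. osuc \<beta> < \<alpha>)"

text \<open>The limit clause \<open>l\<close> receives the limit ordinal and the function of all previous values.\<close>

function ord_rec :: "'b \<Rightarrow> ('b \<Rightarrow> 'b) \<Rightarrow> (ordinal \<Rightarrow> (ordinal \<Rightarrow> 'b) \<Rightarrow> 'b) \<Rightarrow> ordinal \<Rightarrow> 'b" where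
  "ord_rec z s l \<alpha> =
     (if \<alpha> = bot then z
      else if opred \<alpha> < \<alpha> then s (ord_rec z s l (opred \<alpha>))
      else l \<alpha> (\<lambda>\<beta>. if \<beta> < \<alpha> then ord_rec z s l \<beta> else undefined))"
  by pat_completeness auto
termination
  by (relation "inv_image {(\<alpha>, \<beta>). \<alpha> < \<beta>} (\<lambda>(z, s, l, \<alpha>). \<alpha>)")
    (rule wf_inv_image, rule wf, simp_all)

declare ord_rec.simps [simp del]

lemma osuc_greater: "\<alpha> < omega1 \<Longrightarrow> \<alpha> < osuc \<alpha>"
  using Inf_ordinal_mem[of "{\<beta>. \<alpha> < \<beta>}"] unfolding osuc_def by auto

lemma osuc_least: "\<alpha> < \<beta> \<Longrightarrow> osuc \<alpha> \<le> \<beta>"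
  unfolding osuc_def by (simp add: Inf_lower)

lemma opred_osuc:
  assumes "\<alpha> < omega1"
  shows "opred (osuc \<alpha>) = \<alpha>"
  unfolding opred_def
proof (rule antisym)
  show "Sup {..<osuc \<alpha>} \<le> \<alpha>"
    by (rule Sup_least) (metis lessThan_iff osuc_least not_le)
  show "\<alpha> \<le> Sup {..<osuc \<alpha>}"
    by (rule Sup_upper) (simp add: osuc_greater assms)
qed

lemma opred_limit:
  assumes "is_limit \<alpha>"
  shows "opred \<alpha> = \<alpha>"
proof (rule antisym)
  show "opred \<alpha> \<le> \<alpha>" unfolding opred_def by (rule Sup_least) simp
  show "\<alpha> \<le> opred \<alpha>"
  proof (rule ccontr)
    assume "\<not> \<alpha> \<le> opred \<alpha>"
    then have *: "opred \<alpha> < \<alpha>" by simp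
    then have "osuc (opred \<alpha>) < \<alpha>" using assms by (simp add: is_limit_def)
    then have "osuc (opred \<alpha>) \<le> opred \<alpha>"
      unfolding opred_def by (intro Sup_upper) simp
    then show False
      using osuc_greater[of "opred \<alpha>"] * by (metis leD less_top order.strict_trans1 top_greatest)
  qed
qed

lemma zero_succ_or_limit:
  "\<alpha> = bot \<or> (\<exists>\<beta><\<alpha>. \<alpha> = osuc \<beta>) \<or> is_limit \<alpha>"
proof (cases "\<exists>\<beta><\<alpha>. \<not> osuc \<beta> < \<alpha>")
  case True
  then obtain \<beta> where "\<beta> < \<alpha>" "\<not> osuc \<beta> < \<alpha>" by blast
  then have "\<alpha> = osuc \<beta>" using osuc_least[of \<beta> \<alpha>] by simp
  then show ?thesis using \<open>\<beta> < \<alpha>\<close> by blast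
qed (auto simp: is_limit_def)

lemma ord_rec_zero: "ord_rec z s l bot = z"
  by (simp add: ord_rec.simps)

lemma ord_rec_osuc:
  assumes "\<alpha> < omega1"
  shows "ord_rec z s l (osuc \<alpha>) = s (ord_rec z s l \<alpha>)"
proof -
  have "osuc \<alpha> \<noteq> bot"
    using osuc_greater[OF assms] by auto
  then show ?thesis
    using osuc_greater[OF assms] opred_osuc[OF assms] by (subst ord_rec.simps) simp
qed

lemma ord_rec_limit:
  assumes "is_limit \<alpha>"
  shows "ord_rec z s l \<alpha> = l \<alpha> (\<lambda>\<beta>. if \<beta> < \<alpha> then ord_rec z s l \<beta> else undefined)"
  using assms opred_limit[OF assms] by (subst ord_rec.simps) (simp add: is_limit_def)

subsection \<open>Ordinal arithmetic\<close>

definition oadd :: "ordinal \<Rightarrow> ordinal \<Rightarrow> ordinal" where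
  "oadd \<alpha> = ord_rec \<alpha> osuc (\<lambda>\<mu> h. SUP \<beta>\<in>{..<\<mu>}. h \<beta>)"

definition omult :: "ordinal \<Rightarrow> ordinal \<Rightarrow> ordinal" where
  "omult \<alpha> = ord_rec bot (\<lambda>\<gamma>. oadd \<gamma> \<alpha>) (\<lambda>\<mu> h. SUP \<beta>\<in>{..<\<mu>}. h \<beta>)"

definition opow :: "ordinal \<Rightarrow> ordinal \<Rightarrow> ordinal" where
  "opow \<alpha> = ord_rec (osuc bot) (\<lambda>\<gamma>. omult \<gamma> \<alpha>) (\<lambda>\<mu> h. SUP \<beta>\<in>{..<\<mu>}. h \<beta>)"

definition omega :: ordinal where
  "omega = Inf {\<alpha>. is_limit \<alpha>}"

lemma opow_rec:
  "opow \<alpha> bot = osuc bot"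
  "\<beta> < omega1 \<Longrightarrow> opow \<alpha> (osuc \<beta>) = omult (opow \<alpha> \<beta>) \<alpha>"
  "is_limit \<beta> \<Longrightarrow> opow \<alpha> \<beta> = (SUP \<gamma>\<in>{..<\<beta>}. opow \<alpha> \<gamma>)"
  unfolding opow_def by (simp_all add: ord_rec_zero ord_rec_osuc ord_rec_limit)


section \<open>Bases, blocks and block subspaces\<close>

text \<open>
  Sequences are indexed from \<open>0\<close> as usual, so the basis \<open>e\<^sub>1, e\<^sub>2, \<dots>\<close> is \<open>e 0, e 1, \<dots>\<close>.  Only
  the supports, which have to be compared with the Schreier families on \<open>\<nat> = {1, 2, \<dots>}\<close>, use
  the positions \<open>1, 2, \<dots>\<close>.
\<close>

definition schauder_basis :: "(nat \<Rightarrow> 'a::real_normed_vector) \<Rightarrow> bool" where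
  "schauder_basis e \<longleftrightarrow> (\<forall>x. \<exists>!a :: nat \<Rightarrow> real. (\<lambda>i. a i *\<^sub>R e i) sums x)"

definition closed_span :: "(nat \<Rightarrow> 'a::real_normed_vector) \<Rightarrow> 'a set" where
  "closed_span e = closure (span (range e))"

text \<open>
  The remaining notions are relative to a sequence \<open>e\<close> that is a basis of the space
  \<open>closed_span e\<close>.  Thus they apply to the whole space as well as to a block subspace, regarded
  as a space with its block sequence as basis.
\<close>

definition coords :: "(nat \<Rightarrow> 'a::real_normed_vector) \<Rightarrow> 'a \<Rightarrow> nat \<Rightarrow> real" where
  "coords e x = (THE a. (\<lambda>i. a i *\<^sub>R e i) sums x)"

definition supp :: "(nat \<Rightarrow> 'a::real_normed_vector) \<Rightarrow> 'a \<Rightarrow> nat set" where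
  "supp e x = {Suc i | i. coords e x i \<noteq> 0}"

definition block :: "(nat \<Rightarrow> 'a::real_normed_vector) \<Rightarrow> 'a \<Rightarrow> bool" where
  "block e x \<longleftrightarrow> x \<in> closed_span e \<and> x \<noteq> 0 \<and> finite (supp e x)"

definition precedes :: "(nat \<Rightarrow> 'a::real_normed_vector) \<Rightarrow> 'a \<Rightarrow> 'a \<Rightarrow> bool" where
  "precedes e x y \<longleftrightarrow> Max (supp e x) < Min (supp e y)"

definition block_list :: "(nat \<Rightarrow> 'a::real_normed_vector) \<Rightarrow> 'a list \<Rightarrow> bool" where
  "block_list e xs \<longleftrightarrow> (\<forall>x\<in>set xs. block e x) \<and> successively (precedes e) xs"

definition block_sequence :: "(nat \<Rightarrow> 'a::real_normed_vector) \<Rightarrow> (nat \<Rightarrow> 'a) \<Rightarrow> bool" where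
  "block_sequence e y \<longleftrightarrow> (\<forall>n. block e (y n)) \<and> (\<forall>n. precedes e (y n) (y (Suc n)))"

definition block_subspace :: "(nat \<Rightarrow> 'a::real_normed_vector) \<Rightarrow> 'a set \<Rightarrow> bool" where
  "block_subspace e Y \<longleftrightarrow> (\<exists>y. block_sequence e y \<and> Y = closed_span y)"

text \<open>Equivalence to the unit vector basis \<open>(u\<^sub>i)\<close> of \<open>\<ell>\<^sub>1\<^sup>k\<close>, for which
  \<open>\<parallel>\<Sum> a\<^sub>i u\<^sub>i\<parallel> = \<Sum> |a\<^sub>i|\<close>; \<open>A\<close> and \<open>B\<close> bound the norms of the two isomorphisms.\<close>

definition l1_equivalent :: "real \<Rightarrow> 'a::real_normed_vector list \<Rightarrow> bool" where
  "l1_equivalent C xs \<longleftrightarrow>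
     (\<exists>A>0. \<exists>B>0. A * B \<le> C \<and>
        (\<forall>a :: nat \<Rightarrow> real.
           (\<Sum>i<length xs. \<bar>a i\<bar>) \<le> A * norm (\<Sum>i<length xs. a i *\<^sub>R xs ! i) \<and>
           norm (\<Sum>i<length xs. a i *\<^sub>R xs ! i) \<le> B * (\<Sum>i<length xs. \<bar>a i\<bar>)))"


section \<open>Trees and the block \<open>\<ell>\<^sub>1\<close>-indices\<close>

definition is_tree :: "'a set \<Rightarrow> 'a list set \<Rightarrow> bool" where
  "is_tree X T \<longleftrightarrow>
     T \<subseteq> {xs. xs \<noteq> [] \<and> set xs \<subseteq> X} \<and> (\<forall>xs x. xs \<noteq> [] \<and> xs @ [x] \<in> T \<longrightarrow> xs \<in> T)"

definition deriv_tree :: "'a list set \<Rightarrow> 'a list set" where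
  "deriv_tree T = {xs. xs \<noteq> [] \<and> (\<exists>x. xs @ [x] \<in> T)}"

definition deriv_iter :: "ordinal \<Rightarrow> 'a list set \<Rightarrow> 'a list set" where
  "deriv_iter \<alpha> T = ord_rec T deriv_tree (\<lambda>\<mu> h. \<Inter>\<beta>\<in>{..<\<mu>}. h \<beta>) \<alpha>"

lemma deriv_iter_rec:
  "deriv_iter bot T = T"
  "\<alpha> < omega1 \<Longrightarrow> deriv_iter (osuc \<alpha>) T = deriv_tree (deriv_iter \<alpha> T)"
  "is_limit \<alpha> \<Longrightarrow> deriv_iter \<alpha> T = (\<Inter>\<beta>\<in>{..<\<alpha>}. deriv_iter \<beta> T)"
  unfolding deriv_iter_def by (simp_all add: ord_rec_zero ord_rec_osuc ord_rec_limit)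

definition well_founded_tree :: "'a list set \<Rightarrow> bool" where
  "well_founded_tree T \<longleftrightarrow> \<not> (\<exists>x :: nat \<Rightarrow> 'a. \<forall>n\<ge>1. map x [0..<n] \<in> T)"

text \<open>Orders are taken in the ordinals up to \<open>\<omega>\<^sub>1\<close>: a well-founded tree all of whose countable
  derivatives are nonempty has order \<open>\<omega>\<^sub>1\<close>, too.\<close>

definition tree_order :: "'a list set \<Rightarrow> ordinal" where
  "tree_order T = (if well_founded_tree T then Inf {\<alpha>. deriv_iter \<alpha> T = {}} else omega1)"

definition l1_tree :: "real \<Rightarrow> 'a::real_normed_vector set \<Rightarrow> 'a list set \<Rightarrow> bool" where
  "l1_tree C X T \<longleftrightarrow>
     is_tree X T \<and> (\<forall>xs\<in>T. (\<forall>x\<in>set xs. norm x = 1) \<and> l1_equivalent C xs)"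

definition I_b :: "(nat \<Rightarrow> 'a::real_normed_vector) \<Rightarrow> ordinal" where
  "I_b e = Sup {tree_order T | T.
     (\<exists>C\<ge>1. l1_tree C (closed_span e) T) \<and> (\<forall>xs\<in>T. block_list e xs)}"

text \<open>The infimum is a minimum by \<open>Inf_ordinal_mem\<close>.\<close>

definition I_hb :: "(nat \<Rightarrow> 'a::real_normed_vector) \<Rightarrow> ordinal" where
  "I_hb e = Inf {I_b y | y. block_sequence e y}"


section \<open>Schreier families\<close>

text \<open>A choice of sequences \<open>\<xi>\<^sub>n \<nearrow> \<xi>\<close>, \<open>n = 1, 2, \<dots>\<close>, for all countable limit ordinals
  \<open>\<xi>\<close>; the value at \<open>n = 0\<close> is not used.\<close>

definition fundamental_sequences :: "(ordinal \<Rightarrow> nat \<Rightarrow> ordinal) \<Rightarrow> bool" where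
  "fundamental_sequences \<phi> \<longleftrightarrow>
     (\<forall>\<xi><omega1. is_limit \<xi> \<longrightarrow>
        strict_mono_on {1..} (\<phi> \<xi>) \<and> (\<forall>n\<ge>1. \<phi> \<xi> n < \<xi>) \<and> (SUP n\<in>{1..}. \<phi> \<xi> n) = \<xi>)"

text \<open>Some of the sets \<open>F\<^sub>i\<close> may be empty, so \<open>m \<le> F\<^sub>1 < \<dots> < F\<^sub>m\<close> has to be read as
  \<open>m \<le> F\<^sub>i\<close> for all \<open>i\<close> and \<open>F\<^sub>i < F\<^sub>j\<close> for all \<open>i < j\<close>.\<close>

definition schreier_succ :: "nat set set \<Rightarrow> nat set set" where
  "schreier_succ S =
     {(\<Union>i\<in>{1..m}. F i) | m F. m \<ge> 1 \<and> (\<forall>i\<in>{1..m}. F i \<in> S) \<and>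
        (\<forall>i\<in>{1..m}. \<forall>k\<in>F i. m \<le> k) \<and>
        (\<forall>i\<in>{1..m}. \<forall>j\<in>{1..m}. i < j \<longrightarrow> (\<forall>k\<in>F i. \<forall>l\<in>F j. k < l))}"

definition schreier :: "(ordinal \<Rightarrow> nat \<Rightarrow> ordinal) \<Rightarrow> ordinal \<Rightarrow> nat set set" where
  "schreier \<phi> =
     ord_rec ({{n} | n. n \<ge> 1} \<union> {{}}) schreier_succ
       (\<lambda>\<xi> h. {F. \<exists>n\<ge>1. F \<in> h (\<phi> \<xi> n) \<and> (\<forall>k\<in>F. n \<le> k)})"

lemma schreier_rec:
  "schreier \<phi> bot = {{n} | n. n \<ge> 1} \<union> {{}}"
  "\<xi> < omega1 \<Longrightarrow> schreier \<phi> (osuc \<xi>) = schreier_succ (schreier \<phi> \<xi>)"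
  "fundamental_sequences \<phi> \<Longrightarrow> is_limit \<xi> \<Longrightarrow> \<xi> < omega1 \<Longrightarrow>
     schreier \<phi> \<xi> = {F. \<exists>n\<ge>1. F \<in> schreier \<phi> (\<phi> \<xi> n) \<and> (\<forall>k\<in>F. n \<le> k)}"
proof -
  assume "fundamental_sequences \<phi>" "is_limit \<xi>" "\<xi> < omega1"
  then have "n \<ge> 1 \<Longrightarrow> \<phi> \<xi> n < \<xi>" for n
    by (simp add: fundamental_sequences_def)
  with \<open>is_limit \<xi>\<close>
  show "schreier \<phi> \<xi> = {F. \<exists>n\<ge>1. F \<in> schreier \<phi> (\<phi> \<xi> n) \<and> (\<forall>k\<in>F. n \<le> k)}"
    unfolding schreier_def by (subst ord_rec_limit) auto
qed (simp_all add: schreier_def ord_rec_zero ord_rec_osuc)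

definition schreier_maximal :: "(ordinal \<Rightarrow> nat \<Rightarrow> ordinal) \<Rightarrow> ordinal \<Rightarrow> nat set \<Rightarrow> bool" where
  "schreier_maximal \<phi> \<xi> F \<longleftrightarrow> F \<in> schreier \<phi> \<xi> \<and> \<not> (\<exists>G\<in>schreier \<phi> \<xi>. F \<subset> G)"

definition maximal_admissible ::
  "(ordinal \<Rightarrow> nat \<Rightarrow> ordinal) \<Rightarrow> (nat \<Rightarrow> 'a::real_normed_vector) \<Rightarrow> ordinal \<Rightarrow> 'a list \<Rightarrow> bool" where
  "maximal_admissible \<phi> e \<xi> xs \<longleftrightarrow>
     block_list e xs \<and> schreier_maximal \<phi> \<xi> ((\<lambda>x. Min (supp e x)) ` set xs)"


section \<open>The Schreier game and the hereditary strategic \<open>\<ell>\<^sub>1\<close>-index\<close>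

text \<open>
  A strategy \<open>\<sigma>\<close> of \<open>V\<close> maps the list of the moves of \<open>S\<close> made so far to the next vector.  The
  game stops at the move \<open>k\<close> at which the sequence chosen by \<open>V\<close> has become maximal admissible;
  no run has two such \<open>k\<close>, because maximal sets are not properly contained in each other.
\<close>

definition V_wins ::
  "(ordinal \<Rightarrow> nat \<Rightarrow> ordinal) \<Rightarrow> (nat \<Rightarrow> 'a::real_normed_vector) \<Rightarrow> ordinal \<Rightarrow> real \<Rightarrow> bool" where
  "V_wins \<phi> e \<xi> C \<longleftrightarrow>
     (\<exists>\<sigma> :: 'a set list \<Rightarrow> 'a. \<forall>Z :: nat \<Rightarrow> 'a set. (\<forall>i. block_subspace e (Z i)) \<longrightarrow>
        (let x = (\<lambda>i. \<sigma> (map Z [0..<Suc i])) in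
           \<exists>k. (\<forall>i<k. x i \<in> Z i \<and> block e (x i) \<and> norm (x i) = 1) \<and>
               l1_equivalent C (map x [0..<k]) \<and>
               maximal_admissible \<phi> e \<xi> (map x [0..<k])))"

definition I_hs :: "(ordinal \<Rightarrow> nat \<Rightarrow> ordinal) \<Rightarrow> (nat \<Rightarrow> 'a::real_normed_vector) \<Rightarrow> ordinal" where
  "I_hs \<phi> e = Sup {\<xi>. \<xi> < omega1 \<and> (\<forall>\<zeta><\<xi>. \<exists>C\<ge>1. V_wins \<phi> e \<zeta> C)}"

end

theory Submission
  imports Defs "HOL-Library.Sublist"
begin

text \<open>
  The tree of increasing enumerations of members of \<open>\<S>\<^sub>\<xi>\<close> has rank \<open>\<omega>\<^sup>\<xi>\<close>, with ranks stable under
  moving the last element far out.  If \<open>V\<close> wins the \<open>\<S>\<^sub>\<xi>\<close>-game, let \<open>S\<close> play tails of a block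
  subspace; the answers form a block \<open>\<ell>\<^sub>1\<close>-tree of order at least \<open>\<omega>\<^sup>\<xi>\<close>, and one more vector in
  front of all its branches gives order above \<open>\<omega>\<^sup>\<xi>\<close>.

  Conversely, two diagonalizations and passing to a sparse subsequence turn block \<open>\<ell>\<^sub>1\<close>-trees of
  order above \<open>\<omega>\<^sup>\<xi>\<close> on all block subspaces into a block subspace \<open>Y\<^sub>0\<close> in which \<open>V\<close> can always
  continue, in any block subspace chosen by \<open>S\<close>, while the rank decreases to any prescribed smaller
  value.  The value that \<open>V\<close> has to prescribe depends on the first support position \<open>n\<close> of the
  next vector \<open>x\<close>, which in turn depends on that value.  \<open>V\<close> avoids the circle by fixing \<open>n\<close> in
  advance: a small multiple of a vector starting at \<open>n\<close> is added to \<open>x\<close>.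
\<close>

section \<open>Countable ordinals\<close>

text \<open>The converse is shaped by an order of quantifiers: the hypothesis provides one tree for
  each block subspace, with its own constant, whereas \<open>S\<close> changes the subspace at every
  move. Hence \<open>good\<close> quantifies over all subspaces at each step. If a position is not
  good, some subspace contains no good continuation. Stabilization makes such failures permanent, so
  that the refuting subspaces of all positions can be fused into one sequence \<open>V\<close>, and
  a tree on a sparse subsequence of \<open>V\<close> then yields a continuation that the refutation
  forbids. The constant of this tree is known only after \<open>V\<close> has been built; therefore
  all constants in the natural numbers are treated in the same diagonalization. Countability of
  \<omega>^\<xi> and approximation from a countable set \<open>D\<close> leave only countably many
  positions to decide. Constants: \<open>C\<close> is at least twice the tree constant, because
  replacing tree vectors by elements of \<open>D\<close> within 1/(4C) costs a factor 2; normalizing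
  the answers of \<open>V\<close> and perturbing them again leads to 4C.\<close>

lemma less_omega1_iff_countable:
  fixes \<alpha> :: ordinal
  shows "\<alpha> < omega1 \<longleftrightarrow> countable {..<\<alpha>}"
  using countable_below uncountable_below_omega1 less_top by blast

lemma bot_less_omega1: "bot < omega1"
proof -
  have "{..<bot::ordinal} = {}" by auto
  then show ?thesis by (simp add: less_omega1_iff_countable)
qed

lemma lessThan_osuc: "\<alpha> < omega1 \<Longrightarrow> {..<osuc \<alpha>} = {..\<alpha>}"
  using osuc_greater osuc_least by (fastforce simp: not_less[symmetric])

lemma less_osuc_iff: "\<alpha> < omega1 \<Longrightarrow> \<beta> < osuc \<alpha> \<longleftrightarrow> \<beta> \<le> \<alpha>"
  using lessThan_osuc by blast

lemma countable_atMost_ordinal: "\<alpha> < omega1 \<Longrightarrow> countable {..\<alpha>}" for \<alpha> :: ordinal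
  using countable_below[of \<alpha>] ivl_disj_un_singleton(2)[of \<alpha>]
  by (metis countable_Un countable_empty countable_insert)

lemma osuc_less_omega1: "\<alpha> < omega1 \<Longrightarrow> osuc \<alpha> < omega1"
  by (simp add: less_omega1_iff_countable[of "osuc \<alpha>"] lessThan_osuc countable_atMost_ordinal)

text \<open>The ordinals below the supremum form a countable union of countable initial
  segments.\<close>

lemma Sup_less_omega1:
  fixes A :: "ordinal set"
  assumes "countable A" "\<And>\<alpha>. \<alpha> \<in> A \<Longrightarrow> \<alpha> < omega1"
  shows "Sup A < omega1"
proof -
  have "{..<Sup A} \<subseteq> (\<Union>\<alpha>\<in>A. {..<\<alpha>})"
    by (auto simp: less_Sup_iff)
  then have "countable {..<Sup A}"
    using assms by (meson countable_UN countable_below countable_subset)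
  then show ?thesis
    using less_omega1_iff_countable by blast
qed

lemma SUP_less_omega1:
  fixes f :: "'b \<Rightarrow> ordinal"
  assumes "countable I" "\<And>i. i \<in> I \<Longrightarrow> f i < omega1"
  shows "(SUP i\<in>I. f i) < omega1"
  by (rule Sup_less_omega1) (use assms in \<open>auto simp only: countable_image image_iff\<close>)

lemma is_limit_nonsucc: "is_limit \<alpha> \<Longrightarrow> \<beta> < \<alpha> \<Longrightarrow> osuc \<beta> < \<alpha>"
  by (simp add: is_limit_def)

lemma bot_less_limit: "is_limit \<alpha> \<Longrightarrow> bot < \<alpha>"
  unfolding is_limit_def using bot_least order.not_eq_order_implies_strict by metis

lemma countable_ordinal_induct [consumes 1, case_names zero succ limit]:
  assumes "\<alpha> < omega1"
    and "P bot"
    and "\<And>\<beta>. \<beta> < omega1 \<Longrightarrow> P \<beta> \<Longrightarrow> P (osuc \<beta>)"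
    and "\<And>\<mu>. is_limit \<mu> \<Longrightarrow> \<mu> < omega1 \<Longrightarrow> (\<And>\<beta>. \<beta> < \<mu> \<Longrightarrow> P \<beta>) \<Longrightarrow> P \<mu>"
  shows "P \<alpha>"
  using assms(1)
proof (induction \<alpha> rule: less_induct)
  case (less \<alpha>)
  then show ?case
    using zero_succ_or_limit[of \<alpha>] assms(2-4) by (metis order.strict_trans)
qed

text \<open>Limits exist because \<open>omega1\<close> is one. An ordinal below the least limit is
  zero or a successor, so well-founded descent through predecessors reaches \<open>bot\<close> in
  finitely many steps; conversely a limit is closed under \<open>osuc\<close>.\<close>

lemma less_omega_iff: "\<alpha> < omega \<longleftrightarrow> (\<exists>n. \<alpha> = (osuc ^^ n) bot)"
  and is_limit_omega: "is_limit omega"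
  and omega_less_omega1: "omega < omega1"
proof -
  have "is_limit omega1"
    using osuc_less_omega1 bot_less_omega1
    unfolding is_limit_def by auto
  then show lim: "is_limit omega"
    unfolding omega_def using Inf_ordinal_mem[of "{\<alpha>. is_limit \<alpha>}"] by blast
  have fin: "\<exists>n. \<alpha> = (osuc ^^ n) bot" if "\<alpha> < omega" for \<alpha>
    using that
  proof (induction \<alpha> rule: less_induct)
    case (less \<alpha>)
    have "\<not> is_limit \<alpha>"
      using less.prems unfolding omega_def using Inf_lower[of \<alpha> "{\<alpha>. is_limit \<alpha>}"] by auto
    then consider "\<alpha> = bot" | \<beta> where "\<beta> < \<alpha>" "\<alpha> = osuc \<beta>"
      using zero_succ_or_limit[of \<alpha>] by blast
    then show ?case
    proof cases
      case 1
      then show ?thesis by (intro exI[of _ 0]) simp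
    next
      case 2
      with less obtain n where "\<beta> = (osuc ^^ n) bot" by force
      with 2 show ?thesis by (intro exI[of _ "Suc n"]) simp
    qed
  qed
  have "(osuc ^^ n) bot < omega" for n
  proof (induction n)
    case 0
    show ?case
      unfolding funpow.simps(1) id_apply by (rule bot_less_limit[OF lim])
  next
    case (Suc n)
    then show ?case
      unfolding funpow.simps(2) o_apply by (rule is_limit_nonsucc[OF lim])
  qed
  with fin show "\<alpha> < omega \<longleftrightarrow> (\<exists>n. \<alpha> = (osuc ^^ n) bot)" by blast
  have "{..<omega} \<subseteq> range (\<lambda>n. (osuc ^^ n) bot)"
    using fin by blast
  then have "countable {..<omega}"
    by (rule countable_subset) simp
  then show "omega < omega1"
    by (simp add: less_omega1_iff_countable)
qed

lemma finite_ordinal_less_omega1: "(osuc ^^ n) bot < omega1"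
  by (induction n) (simp_all add: bot_less_omega1 osuc_less_omega1)

lemma is_limit_funpow: "is_limit \<mu> \<Longrightarrow> \<beta> < \<mu> \<Longrightarrow> (osuc ^^ n) \<beta> < \<mu>"
  by (induction n) (auto simp: is_limit_nonsucc)

section \<open>Ordinal sums and finite multiples\<close>

lemma oadd_rec:
  "oadd \<alpha> bot = \<alpha>"
  "\<beta> < omega1 \<Longrightarrow> oadd \<alpha> (osuc \<beta>) = osuc (oadd \<alpha> \<beta>)"
  "is_limit \<beta> \<Longrightarrow> oadd \<alpha> \<beta> = (SUP \<gamma>\<in>{..<\<beta>}. oadd \<alpha> \<gamma>)"
  unfolding oadd_def by (simp_all add: ord_rec_zero ord_rec_osuc ord_rec_limit)

lemma omult_rec:
  "omult \<alpha> bot = bot"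
  "\<beta> < omega1 \<Longrightarrow> omult \<alpha> (osuc \<beta>) = oadd (omult \<alpha> \<beta>) \<alpha>"
  "is_limit \<beta> \<Longrightarrow> omult \<alpha> \<beta> = (SUP \<gamma>\<in>{..<\<beta>}. omult \<alpha> \<gamma>)"
  unfolding omult_def by (simp_all add: ord_rec_zero ord_rec_osuc ord_rec_limit)

lemma oadd_less_omega1:
  assumes "\<beta> < omega1" "\<alpha> < omega1"
  shows "oadd \<alpha> \<beta> < omega1"
  using assms
proof (induction \<beta> rule: countable_ordinal_induct)
  case (limit \<mu>)
  then show ?case
    using SUP_less_omega1[OF countable_below] by (simp add: oadd_rec(3))
qed (simp_all add: oadd_rec osuc_less_omega1)

lemma oadd_strict_mono:
  assumes "\<gamma> < \<beta>" "\<beta> < omega1" "\<alpha> < omega1"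
  shows "oadd \<alpha> \<gamma> < oadd \<alpha> \<beta>"
proof -
  have "\<gamma> < \<beta> \<longrightarrow> oadd \<alpha> \<gamma> < oadd \<alpha> \<beta>" for \<gamma>
    using assms(2)
  proof (induction \<beta> arbitrary: \<gamma> rule: countable_ordinal_induct)
    case (succ \<beta>)
    have "oadd \<alpha> \<beta> < osuc (oadd \<alpha> \<beta>)"
      by (simp add: osuc_greater oadd_less_omega1 assms succ)
    then show ?case
      using succ by (metis less_osuc_iff oadd_rec(2) order.order_iff_strict order.strict_trans)
  next
    case (limit \<mu>)
    show ?case
    proof
      assume "\<gamma> < \<mu>"
      then have "osuc \<gamma> < \<mu>"
        by (simp add: is_limit_nonsucc limit.hyps)
      moreover have "\<gamma> < osuc \<gamma>"
        using \<open>\<gamma> < \<mu>\<close> by (metis limit.hyps(2) order.strict_trans osuc_greater)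
      ultimately have "oadd \<alpha> \<gamma> < oadd \<alpha> (osuc \<gamma>)" "oadd \<alpha> (osuc \<gamma>) \<le> oadd \<alpha> \<mu>"
        using limit by (auto simp: oadd_rec(3) intro!: Sup_upper)
      then show "oadd \<alpha> \<gamma> < oadd \<alpha> \<mu>" by simp
    qed
  qed simp
  then show ?thesis using assms by blast
qed

lemma oadd_ge:
  assumes "\<beta> < omega1" "\<alpha> < omega1"
  shows "\<alpha> \<le> oadd \<alpha> \<beta>"
proof (cases "\<beta> = bot")
  case False
  then have "bot < \<beta>"
    by (metis bot_least order.not_eq_order_implies_strict)
  then have "oadd \<alpha> bot < oadd \<alpha> \<beta>"
    using assms by (rule oadd_strict_mono)
  then show ?thesis unfolding oadd_rec(1) by (rule less_imp_le)
qed (simp add: oadd_rec)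

text \<open>For a concatenation of two families this decides how to extend a set: values below the
  left summand are reached by starting a new piece, the others by continuing the current
  one.\<close>

lemma less_oadd_cases:
  assumes "\<delta> < oadd \<alpha> \<beta>" "\<beta> < omega1" "\<alpha> < omega1"
  obtains "\<delta> < \<alpha>" | \<gamma> where "\<gamma> < \<beta>" "\<delta> \<le> oadd \<alpha> \<gamma>"
proof -
  consider "\<beta> = bot" | \<gamma> where "\<gamma> < \<beta>" "\<beta> = osuc \<gamma>" | "is_limit \<beta>"
    using zero_succ_or_limit by blast
  then show ?thesis
  proof cases
    case 1
    show ?thesis
      by (rule that(1)) (use assms(1) in \<open>simp only: 1 oadd_rec(1)\<close>)
  next
    case 2
    then have "\<gamma> < omega1"
      using assms(2) by (meson order.strict_trans)
    then have "\<delta> \<le> oadd \<alpha> \<gamma>"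
      using assms(1) unfolding 2(2) oadd_rec(2)[OF \<open>\<gamma> < omega1\<close>]
      by (simp only: less_osuc_iff oadd_less_omega1 assms(3))
    then show ?thesis
      using that(2) 2(1) by blast
  next
    case 3
    then obtain \<gamma> where "\<gamma> < \<beta>" "\<delta> < oadd \<alpha> \<gamma>"
      using assms(1) unfolding oadd_rec(3)[OF 3] less_SUP_iff by blast
    then show ?thesis using that(2) less_imp_le by blast
  qed
qed

text \<open>A strictly increasing map sends no ordinal below itself: a least counterexample would be
  mapped to a smaller counterexample.\<close>

lemma oadd_bot_ge:
  assumes "\<beta> < omega1"
  shows "\<beta> \<le> oadd bot \<beta>"
  using assms
proof (induction \<beta> rule: less_induct)
  case (less \<beta>)
  show ?case
  proof (rule ccontr)
    assume *: "\<not> \<beta> \<le> oadd bot \<beta>"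
    then have **: "oadd bot \<beta> < \<beta>"
      by (rule not_le_imp_less)
    then have "oadd bot (oadd bot \<beta>) < oadd bot \<beta>"
      by (rule oadd_strict_mono[OF _ less.prems bot_less_omega1])
    with less.IH[OF **] less.prems ** show False
      by (meson not_le order.strict_trans)
  qed
qed

lemma omult_omega: "omult \<alpha> omega = (SUP n. omult \<alpha> ((osuc ^^ n) bot))"
proof -
  have "{..<omega} = range (\<lambda>n. (osuc ^^ n) bot)"
    using less_omega_iff by blast
  then show ?thesis
    by (simp add: omult_rec(3) is_limit_omega image_comp comp_def)
qed

lemma omult_finite_Suc: "omult \<alpha> ((osuc ^^ Suc n) bot) = oadd (omult \<alpha> ((osuc ^^ n) bot)) \<alpha>"
  using omult_rec(2)[OF finite_ordinal_less_omega1] by simp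

lemma omult_finite_less_omega1: "\<alpha> < omega1 \<Longrightarrow> omult \<alpha> ((osuc ^^ n) bot) < omega1"
  by (induction n)
    (simp_all add: omult_rec omult_finite_Suc oadd_less_omega1 bot_less_omega1 del: funpow.simps(2))

section \<open>Powers of \<omega>\<close>

lemma opow_omega_osuc:
  "\<xi> < omega1 \<Longrightarrow> opow omega (osuc \<xi>) = (SUP n. omult (opow omega \<xi>) ((osuc ^^ n) bot))"
  by (simp add: opow_rec omult_omega)

lemma opow_omega_bounds:
  assumes "\<xi> < omega1"
  shows "bot < opow omega \<xi> \<and> opow omega \<xi> < omega1"
  using assms
proof (induction \<xi> rule: countable_ordinal_induct)
  case zero
  then show ?case
    using osuc_greater[of bot] osuc_less_omega1[of bot] bot_less_omega1
    by (simp add: opow_rec)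
next
  case (succ \<xi>)
  have "omult (opow omega \<xi>) ((osuc ^^ Suc 0) bot) \<le> opow omega (osuc \<xi>)"
    unfolding opow_omega_osuc[OF succ(1)] by (rule SUP_upper) simp
  moreover have "opow omega \<xi> \<le> omult (opow omega \<xi>) ((osuc ^^ Suc 0) bot)"
    using succ(2) oadd_bot_ge by (simp add: omult_finite_Suc omult_rec(1) del: funpow.simps(2))
  moreover have "opow omega (osuc \<xi>) < omega1"
    unfolding opow_omega_osuc[OF succ(1)]
    using succ(2) by (intro SUP_less_omega1) (simp_all add: omult_finite_less_omega1)
  ultimately show ?case
    using succ by auto
next
  case (limit \<mu>)
  then have "bot < \<mu>"
    by (simp add: bot_less_limit)
  then have "opow omega bot \<le> opow omega \<mu>" "bot < opow omega bot"
    using limit by (simp_all add: opow_rec(3)[OF limit(1)] SUP_upper)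
  moreover have "opow omega \<mu> < omega1"
    using limit SUP_less_omega1[OF countable_below] by (simp add: opow_rec(3))
  ultimately show ?case by simp
qed

lemmas opow_omega_pos = opow_omega_bounds[THEN conjunct1]
  and opow_omega_less_omega1 = opow_omega_bounds[THEN conjunct2]

lemma omult_finite_strict:
  assumes "bot < \<alpha>" "\<alpha> < omega1"
  shows "omult \<alpha> ((osuc ^^ n) bot) < omult \<alpha> ((osuc ^^ Suc n) bot)"
  using oadd_strict_mono[OF assms omult_finite_less_omega1[OF assms(2), of n]]
  by (simp add: omult_finite_Suc oadd_rec(1) del: funpow.simps(2))

lemma opow_omega_less_osuc:
  assumes "\<xi> < omega1"
  shows "opow omega \<xi> < opow omega (osuc \<xi>)"
proof -
  let ?m = "\<lambda>n. omult (opow omega \<xi>) ((osuc ^^ n) bot)"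
  have "?m (Suc 0) \<le> opow omega (osuc \<xi>)" "?m 1 < ?m (Suc 1)" "?m (Suc 1) \<le> opow omega (osuc \<xi>)"
    unfolding opow_omega_osuc[OF assms]
    by (rule SUP_upper, simp, rule omult_finite_strict[OF opow_omega_pos opow_omega_less_omega1],
        simp_all only: assms, rule SUP_upper, simp)
  moreover have "?m (Suc 0) = oadd bot (opow omega \<xi>)"
    by (simp add: omult_finite_Suc omult_rec(1) del: funpow.simps(2))
  moreover have "opow omega \<xi> \<le> oadd bot (opow omega \<xi>)"
    using assms oadd_bot_ge opow_omega_less_omega1 by blast
  ultimately show ?thesis by auto
qed

lemma opow_omega_mono:
  assumes "\<xi> < omega1" "\<zeta> \<le> \<xi>"
  shows "opow omega \<zeta> \<le> opow omega \<xi>"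
proof -
  have "\<zeta> \<le> \<xi> \<longrightarrow> opow omega \<zeta> \<le> opow omega \<xi>"
    using assms(1)
  proof (induction \<xi> rule: countable_ordinal_induct)
    case (succ \<xi>)
    show ?case
    proof
      assume "\<zeta> \<le> osuc \<xi>"
      then consider "\<zeta> = osuc \<xi>" | "\<zeta> \<le> \<xi>"
        using less_osuc_iff[OF succ(1)] by fastforce
      then show "opow omega \<zeta> \<le> opow omega (osuc \<xi>)"
        using succ(2) opow_omega_less_osuc[OF succ(1)] by cases auto
    qed
  next
    case (limit \<mu>)
    show ?case
    proof
      assume "\<zeta> \<le> \<mu>"
      then consider "\<zeta> = \<mu>" | "\<zeta> < \<mu>"
        by fastforce
      then show "opow omega \<zeta> \<le> opow omega \<mu>"
        by cases (auto simp: opow_rec(3)[OF limit(1)] intro: SUP_upper)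
    qed
  qed (simp add: bot_unique)
  then show ?thesis using assms(2) by blast
qed

text \<open>Below the power there is always a further finite multiple (successor exponent) or a
  further smaller power (limit exponent), which leaves room for one more successor. Being a limit is
  what permits skipping vectors at the start of \<open>tree_imp_good\<close>.\<close>

lemma is_limit_opow_omega:
  assumes "\<xi> < omega1" "\<xi> \<noteq> bot"
  shows "is_limit (opow omega \<xi>)"
proof -
  have *: "osuc \<beta> < opow omega \<xi>" if \<beta>: "\<beta> < opow omega \<xi>" for \<beta>
  proof -
    consider \<zeta> where "\<zeta> < \<xi>" "\<xi> = osuc \<zeta>" | "is_limit \<xi>"
      using zero_succ_or_limit[of \<xi>] assms(2) by blast
    then show ?thesis
    proof cases
      case 1
      then have \<zeta>: "\<zeta> < omega1"
        using assms(1) by simp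
      let ?m = "\<lambda>n. omult (opow omega \<zeta>) ((osuc ^^ n) bot)"
      obtain n where "\<beta> < ?m n"
        using \<beta> unfolding 1(2) opow_omega_osuc[OF \<zeta>] less_SUP_iff by blast
      then have "osuc \<beta> \<le> ?m n"
        by (rule osuc_least)
      also have "?m n < ?m (Suc n)"
        using omult_finite_strict opow_omega_pos opow_omega_less_omega1 \<zeta> by blast
      also have "?m (Suc n) \<le> opow omega \<xi>"
        unfolding 1(2) opow_omega_osuc[OF \<zeta>] by (rule SUP_upper) simp
      finally show ?thesis .
    next
      case 2
      then obtain \<zeta> where \<zeta>: "\<zeta> < \<xi>" "\<beta> < opow omega \<zeta>"
        using \<beta> by (auto simp: opow_rec(3) less_SUP_iff)
      then have "osuc \<beta> \<le> opow omega \<zeta>"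
        by (simp add: osuc_least)
      also have "\<dots> < opow omega (osuc \<zeta>)"
        using \<zeta>(1) assms(1) by (intro opow_omega_less_osuc) simp
      also have "\<dots> \<le> opow omega \<xi>"
        using \<zeta>(1) assms(1) by (intro opow_omega_mono) (simp_all add: osuc_least)
      finally show ?thesis .
    qed
  qed
  then show ?thesis
    using opow_omega_pos[OF assms(1)] by (auto simp: is_limit_def)
qed

section \<open>Derivatives and the order of trees\<close>

text \<open>Replaces the zero, successor and limit clauses by a single recursion, suited to
  well-founded induction: a child that survives \<beta> derivations also survives fewer, so the last
  stage of a successor ordinal accounts for all earlier ones.\<close>

lemma deriv_iter_iff:
  assumes "is_tree X T" "\<alpha> < omega1"
  shows "xs \<in> deriv_iter \<alpha> T \<longleftrightarrow> xs \<in> T \<and> (\<forall>\<gamma><\<alpha>. \<exists>x. xs @ [x] \<in> deriv_iter \<gamma> T)"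
  using assms(2)
proof (induction \<alpha> arbitrary: xs rule: less_induct)
  case (less \<alpha>)
  have IH: "xs \<in> deriv_iter \<beta> T \<longleftrightarrow> xs \<in> T \<and> (\<forall>\<gamma><\<beta>. \<exists>x. xs @ [x] \<in> deriv_iter \<gamma> T)"
    if "\<beta> < \<alpha>" for \<beta> xs
    by (rule less.IH[OF that]) (use that less.prems in \<open>meson order.strict_trans\<close>)
  have T: "xs \<noteq> []" "ys \<noteq> [] \<and> ys @ [x] \<in> T \<Longrightarrow> ys \<in> T" if "xs \<in> T" for xs ys x
    using that assms(1) unfolding is_tree_def by blast+
  consider "\<alpha> = bot" | \<beta> where "\<beta> < \<alpha>" "\<alpha> = osuc \<beta>" | "is_limit \<alpha>"
    using zero_succ_or_limit by blast
  then show ?case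
  proof cases
    case 1
    then show ?thesis by (simp add: deriv_iter_rec(1))
  next
    case 2
    have \<beta>: "\<beta> < omega1"
      using 2(1) less.prems by (rule order.strict_trans)
    show ?thesis
    proof
      assume "xs \<in> deriv_iter \<alpha> T"
      then obtain x where x: "xs \<noteq> []" "xs @ [x] \<in> deriv_iter \<beta> T"
        unfolding 2(2) deriv_iter_rec(2)[OF \<beta>] deriv_tree_def by blast
      have "xs @ [x] \<in> deriv_iter \<gamma> T" if "\<gamma> < \<alpha>" for \<gamma>
      proof -
        have "\<gamma> \<le> \<beta>" using that unfolding 2(2) less_osuc_iff[OF \<beta>] .
        then show ?thesis
          using x(2) IH[OF 2(1)] IH[OF that] by (meson order.strict_trans2)
      qed
      moreover have "xs @ [x] \<in> T"
        using x(2) IH[OF 2(1)] by blast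
      ultimately show "xs \<in> T \<and> (\<forall>\<gamma><\<alpha>. \<exists>x. xs @ [x] \<in> deriv_iter \<gamma> T)"
        using x(1) assms(1) unfolding is_tree_def by blast
    next
      assume "xs \<in> T \<and> (\<forall>\<gamma><\<alpha>. \<exists>x. xs @ [x] \<in> deriv_iter \<gamma> T)"
      then show "xs \<in> deriv_iter \<alpha> T"
        using 2(1) T(1) unfolding 2(2) deriv_iter_rec(2)[OF \<beta>] deriv_tree_def by blast
    qed
  next
    case 3
    show ?thesis
    proof
      assume xs: "xs \<in> deriv_iter \<alpha> T"
      then have xs: "xs \<in> deriv_iter \<beta> T" if "\<beta> < \<alpha>" for \<beta>
        using that unfolding deriv_iter_rec(3)[OF 3] by blast
      have "\<exists>x. xs @ [x] \<in> deriv_iter \<gamma> T" if "\<gamma> < \<alpha>" for \<gamma>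
      proof -
        have "\<gamma> < omega1" using that less.prems by (rule order.strict_trans)
        then show ?thesis
          using xs[OF is_limit_nonsucc[OF 3 that]] by (simp add: deriv_iter_rec(2) deriv_tree_def)
      qed
      moreover have "xs \<in> T"
        using xs[OF bot_less_limit[OF 3]] by (simp add: deriv_iter_rec(1))
      ultimately show "xs \<in> T \<and> (\<forall>\<gamma><\<alpha>. \<exists>x. xs @ [x] \<in> deriv_iter \<gamma> T)" by blast
    next
      assume *: "xs \<in> T \<and> (\<forall>\<gamma><\<alpha>. \<exists>x. xs @ [x] \<in> deriv_iter \<gamma> T)"
      have "xs \<in> deriv_iter \<beta> T" if "\<beta> < \<alpha>" for \<beta>
        unfolding IH[OF that] using * that by (meson order.strict_trans)
      then show "xs \<in> deriv_iter \<alpha> T"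
        unfolding deriv_iter_rec(3)[OF 3] by blast
    qed
  qed
qed

lemma deriv_iter_antimono:
  assumes "is_tree X T" "\<beta> < omega1" "\<alpha> \<le> \<beta>"
  shows "deriv_iter \<beta> T \<subseteq> deriv_iter \<alpha> T"
proof -
  have "\<alpha> < omega1" using assms(2,3) by (meson order.strict_trans1)
  then show ?thesis
    using deriv_iter_iff[OF assms(1,2)] deriv_iter_iff[OF assms(1)] assms(3)
    by (meson order.strict_trans2 subsetI)
qed

lemma deriv_iter_butlast:
  assumes "is_tree X T" "\<alpha> < omega1" "xs @ [x] \<in> deriv_iter \<alpha> T" "xs \<noteq> []"
  shows "xs \<in> deriv_iter \<alpha> T"
proof -
  have "xs @ [x] \<in> deriv_iter \<gamma> T" if "\<gamma> < \<alpha>" for \<gamma>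
    using deriv_iter_antimono[OF assms(1,2)] that assms(3) by (meson less_imp_le subsetD)
  moreover have "xs \<in> T"
    using assms deriv_iter_iff[OF assms(1,2)] unfolding is_tree_def by blast
  ultimately show ?thesis
    using deriv_iter_iff[OF assms(1,2)] by blast
qed

text \<open>Each successor stage gives up one node, so n stages in reserve allow n further vectors
  to be appended. These supply the vectors that are skipped at limit ranks.\<close>

lemma deriv_iter_funpow_osuc:
  assumes "is_tree X T" "\<gamma> < omega1" "xs \<in> deriv_iter ((osuc ^^ n) \<gamma>) T"
  shows "\<exists>vs. length vs = n \<and> xs @ vs \<in> deriv_iter \<gamma> T"
  using assms(3)
proof (induction n arbitrary: xs)
  case (Suc n)
  have "(osuc ^^ n) \<gamma> < omega1"
    using assms(2) by (induction n) (simp_all add: osuc_less_omega1)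
  then obtain x where "xs @ [x] \<in> deriv_iter ((osuc ^^ n) \<gamma>) T"
    using Suc.prems by (auto simp: deriv_iter_rec(2) deriv_tree_def)
  with Suc.IH obtain vs where "length vs = n" "(xs @ [x]) @ vs \<in> deriv_iter \<gamma> T"
    by blast
  then show ?case
    by (intro exI[of _ "x # vs"]) simp
qed simp

text \<open>Derivatives decrease, so emptiness persists once it occurs. If the tree is not
  well-founded, each initial segment of an infinite branch has a child on the branch and survives
  every countable derivation, in agreement with the conventional order
  \<open>omega1\<close>.\<close>

lemma less_tree_order_iff:
  assumes T: "is_tree X T" and \<alpha>: "\<alpha> < omega1"
  shows "\<alpha> < tree_order T \<longleftrightarrow> deriv_iter \<alpha> T \<noteq> {}"
proof (cases "well_founded_tree T")
  case True
  let ?E = "{\<beta>. deriv_iter \<beta> T = {}}"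
  have order: "tree_order T = Inf ?E"
    using True by (simp add: tree_order_def)
  show ?thesis
  proof
    assume "\<alpha> < tree_order T"
    then show "deriv_iter \<alpha> T \<noteq> {}"
      unfolding order using Inf_lower[of \<alpha> ?E] by (meson leD mem_Collect_eq)
  next
    assume ne: "deriv_iter \<alpha> T \<noteq> {}"
    show "\<alpha> < tree_order T"
    \<comment> \<open>If no derivative is empty, the order is the infimum of the empty set, which is
      \<open>omega1\<close>.\<close>
    proof (cases "?E = {}")
      case True
      then show ?thesis using \<alpha> by (simp only: order Inf_empty)
    next
      case False
      then have "deriv_iter (Inf ?E) T = {}"
        using Inf_ordinal_mem[of ?E] by (simp only: mem_Collect_eq not_False_eq_True)
      then have "\<not> Inf ?E \<le> \<alpha>"
        using deriv_iter_antimono[OF T \<alpha>, of "Inf ?E"] ne by blast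
      then show ?thesis unfolding order by (rule not_le_imp_less)
    qed
  qed
next
  case False
  then obtain x :: "nat \<Rightarrow> 'a" where x: "map x [0..<n] \<in> T" if "n \<ge> 1" for n
    unfolding well_founded_tree_def by blast
  have "\<beta> < omega1 \<Longrightarrow> \<forall>n\<ge>1. map x [0..<n] \<in> deriv_iter \<beta> T" for \<beta>
  proof (induction \<beta> rule: less_induct)
    case (less \<beta>)
    show ?case
    proof (intro allI impI)
      fix n :: nat assume n: "n \<ge> 1"
      have "map x [0..<n] @ [x n] \<in> deriv_iter \<gamma> T" if "\<gamma> < \<beta>" for \<gamma>
      proof -
        have "\<gamma> < omega1" using that less.prems by (rule order.strict_trans)
        then have "map x [0..<Suc n] \<in> deriv_iter \<gamma> T"
          using less.IH[OF that] by (metis le_Suc_eq n)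
        then show ?thesis by simp
      qed
      then show "map x [0..<n] \<in> deriv_iter \<beta> T"
        using x[OF n] deriv_iter_iff[OF T less.prems] by blast
    qed
  qed
  from this[OF \<alpha>] have "deriv_iter \<alpha> T \<noteq> {}" by blast
  with False \<alpha> show ?thesis by (simp add: tree_order_def)
qed

section \<open>Ranks of the Schreier families\<close>

definition hereditary :: "nat set set \<Rightarrow> bool" where
  "hereditary \<F> \<longleftrightarrow> {} \<in> \<F> \<and> (\<forall>F\<in>\<F>. finite F \<and> (\<forall>G\<subseteq>F. G \<in> \<F>))"

definition spreading :: "nat set set \<Rightarrow> bool" where
  "spreading \<F> \<longleftrightarrow> (\<forall>F\<in>\<F>. \<forall>f. strict_mono_on F f \<and> (\<forall>k\<in>F. k \<le> f k) \<longrightarrow> f ` F \<in> \<F>)"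

text \<open>This is the rank function of the tree of increasing enumerations of members of \<open>\<F>\<close>, together
  with the stability of its values under moving the last element far out.\<close>

definition rank_function :: "nat set set \<Rightarrow> (nat set \<Rightarrow> ordinal) \<Rightarrow> ordinal \<Rightarrow> bool" where
  "rank_function \<F> rk \<alpha> \<longleftrightarrow> rk {} = \<alpha> \<and>
     (\<forall>F n. insert n F \<in> \<F> \<longrightarrow> (\<forall>k\<in>F. k < n) \<longrightarrow> rk (insert n F) < rk F) \<and>
     (\<forall>F\<in>\<F>. \<forall>\<beta><rk F. \<exists>n0. \<forall>n\<ge>n0. insert n F \<in> \<F> \<and> \<beta> \<le> rk (insert n F))"

lemma hereditaryD:
  assumes "hereditary \<F>"
  shows "{} \<in> \<F>" "F \<in> \<F> \<Longrightarrow> finite F" "F \<in> \<F> \<Longrightarrow> G \<subseteq> F \<Longrightarrow> G \<in> \<F>"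
  using assms unfolding hereditary_def by blast+

lemma rank_functionD:
  assumes "rank_function \<F> rk \<alpha>"
  shows "rk {} = \<alpha>"
    "insert n F \<in> \<F> \<Longrightarrow> \<forall>k\<in>F. k < n \<Longrightarrow> rk (insert n F) < rk F"
    "F \<in> \<F> \<Longrightarrow> \<beta> < rk F \<Longrightarrow> \<exists>n0. \<forall>n\<ge>n0. insert n F \<in> \<F> \<and> \<beta> \<le> rk (insert n F)"
  using assms unfolding rank_function_def by blast+

text \<open>The set is built in increasing order; every new maximum lowers the rank.\<close>

lemma rank_function_less:
  assumes "hereditary \<F>" "rank_function \<F> rk \<alpha>" "F \<in> \<F>" "F \<noteq> {}"
  shows "rk F < \<alpha>"
proof -
  have "finite F" using assms hereditaryD by blast
  then show ?thesis
    using assms(3,4)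
  proof (induction F rule: finite_linorder_max_induct)
    case (insert n F)
    have less: "rk (insert n F) < rk F"
      using rank_functionD(2)[OF assms(2)] insert by blast
    have "F \<in> \<F>"
      using hereditaryD(3)[OF assms(1)] insert.prems by blast
    then have "rk F \<le> \<alpha>"
      using insert.IH rank_functionD(1)[OF assms(2)] by (cases "F = {}") (auto intro: less_imp_le)
    with less show ?case by (rule order.strict_trans2)
  qed simp
qed

section \<open>Concatenation of two families\<close>

definition concat_family :: "nat set set \<Rightarrow> nat set set \<Rightarrow> nat set set" where
  "concat_family \<A> \<B> = {F \<union> G | F G. F \<in> \<A> \<and> G \<in> \<B> \<and> (\<forall>k\<in>F. \<forall>l\<in>G. k < l)}"

lemma hereditary_concat_family:
  assumes "hereditary \<A>" "hereditary \<B>"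
  shows "hereditary (concat_family \<A> \<B>)"
  unfolding hereditary_def
proof (intro conjI ballI allI impI)
  show "{} \<in> concat_family \<A> \<B>"
    using hereditaryD(1)[OF assms(1)] hereditaryD(1)[OF assms(2)]
    unfolding concat_family_def by blast
  fix H assume "H \<in> concat_family \<A> \<B>"
  then obtain F G where FG: "H = F \<union> G" "F \<in> \<A>" "G \<in> \<B>" "\<forall>k\<in>F. \<forall>l\<in>G. k < l"
    unfolding concat_family_def by blast
  show "finite H"
    using FG hereditaryD(2) assms by blast
  fix H' assume "H' \<subseteq> H"
  then have "H' = (F \<inter> H') \<union> (G \<inter> H')" using FG(1) by blast
  moreover have "F \<inter> H' \<in> \<A>" "G \<inter> H' \<in> \<B>"
    using FG hereditaryD(3) assms by blast+
  ultimately show "H' \<in> concat_family \<A> \<B>"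
    using FG(4) unfolding concat_family_def by blast
qed

lemma spreading_concat_family:
  assumes "spreading \<A>" "spreading \<B>"
  shows "spreading (concat_family \<A> \<B>)"
  unfolding spreading_def
proof (intro ballI allI impI)
  fix H f assume "H \<in> concat_family \<A> \<B>" and f: "strict_mono_on H f \<and> (\<forall>k\<in>H. k \<le> f k)"
  then obtain F G where FG: "H = F \<union> G" "F \<in> \<A>" "G \<in> \<B>" "\<forall>k\<in>F. \<forall>l\<in>G. k < l"
    unfolding concat_family_def by blast
  have "f ` F \<in> \<A>" "f ` G \<in> \<B>"
    using assms f FG unfolding spreading_def
    by (metis UnCI monotone_on_subset sup_ge1, metis UnCI monotone_on_subset sup_ge2)
  moreover have "\<forall>k\<in>f ` F. \<forall>l\<in>f ` G. k < l"
    using f FG unfolding strict_mono_on_def by blast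
  ultimately show "f ` H \<in> concat_family \<A> \<B>"
    unfolding concat_family_def FG(1) image_Un by blast
qed

text \<open>The elements from \<A> come first and use up \<alpha>, while all of \<beta> remains in
  reserve; hence \<alpha> is the right summand. A set outside \<A> has only a \<B>-rank left, and
  since it may split in several ways the best split is taken.\<close>

lemma rank_function_concat_family:
  assumes A: "hereditary \<A>" "rank_function \<A> rkA \<alpha>" "\<alpha> < omega1"
    and B: "hereditary \<B>" "rank_function \<B> rkB \<beta>" "\<beta> < omega1"
  shows "\<exists>rk. rank_function (concat_family \<A> \<B>) rk (oadd \<beta> \<alpha>)"
proof -
  define splits where "splits H = {G \<in> \<B>. \<exists>F\<in>\<A>. H = F \<union> G \<and> (\<forall>k\<in>F. \<forall>l\<in>G. k < l)}" for H
  define rk where "rk H = (if H \<in> \<A> then oadd \<beta> (rkA H) else Max (rkB ` splits H))" for H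
  have conc: "H \<in> concat_family \<A> \<B> \<longleftrightarrow> splits H \<noteq> {}" for H
    unfolding concat_family_def splits_def by blast
  have finH: "finite H" if "H \<in> concat_family \<A> \<B>" for H
    using that hereditary_concat_family[OF A(1) B(1)] hereditaryD(2) by blast
  have fin: "finite (splits H)" if "H \<in> concat_family \<A> \<B>" for H
  proof (rule finite_subset)
    show "splits H \<subseteq> Pow H" unfolding splits_def by blast
  qed (simp add: finH[OF that])
  have rkA_le: "rkA H \<le> \<alpha>" if "H \<in> \<A>" for H
    using rank_function_less[OF A(1,2) that] rank_functionD(1)[OF A(2)]
    by (cases "H = {}") (auto intro: less_imp_le)
  have rkA_less: "rkA H < omega1" if "H \<in> \<A>" for H
    using rkA_le[OF that] A(3) by (rule order.strict_trans1)
  have splits_ne: "G \<noteq> {}" if "G \<in> splits H" "H \<notin> \<A>" for G H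
    using that unfolding splits_def by auto
  have rk_max: "\<exists>G\<in>splits H. rk H = rkB G" if "H \<in> concat_family \<A> \<B>" "H \<notin> \<A>" for H
  proof -
    have "Max (rkB ` splits H) \<in> rkB ` splits H"
      using fin[OF that(1)] that(1) by (intro Max_in) (simp_all add: conc)
    then show ?thesis using that(2) unfolding rk_def by auto
  qed
  have rk_ge: "rkB G \<le> rk H" if "G \<in> splits H" "H \<notin> \<A>" for G H
  proof -
    have "H \<in> concat_family \<A> \<B>" using that conc by blast
    then show ?thesis
      using that fin[of H] by (simp add: rk_def)
  qed
  have "rank_function (concat_family \<A> \<B>) rk (oadd \<beta> \<alpha>)"
    unfolding rank_function_def
  proof (intro conjI allI impI ballI)
    show "rk {} = oadd \<beta> \<alpha>"
      using hereditaryD(1)[OF A(1)] rank_functionD(1)[OF A(2)] by (simp add: rk_def)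
  next
    fix H n assume H: "insert n H \<in> concat_family \<A> \<B>" and n: "\<forall>k\<in>H. k < n"
    show "rk (insert n H) < rk H"
    proof (cases "insert n H \<in> \<A>")
      case True
      then have "H \<in> \<A>" using hereditaryD(3)[OF A(1)] by blast
      then show ?thesis
        using True rank_functionD(2)[OF A(2) True n] rkA_less B(3)
        by (simp add: rk_def oadd_strict_mono)
    next
      case False
      then obtain G where G: "G \<in> splits (insert n H)" "rk (insert n H) = rkB G"
        using rk_max[OF H] by blast
      then obtain F where F: "F \<in> \<A>" "insert n H = F \<union> G" "\<forall>k\<in>F. \<forall>l\<in>G. k < l" "G \<in> \<B>"
        unfolding splits_def by blast
      have Gne: "G \<noteq> {}" using splits_ne[OF G(1) False] .
      show ?thesis
      proof (cases "H \<in> \<A>")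
        case True
        \<comment> \<open>The set has just left \<A>. Its \<B>-part is nonempty and so has rank
          below \<beta>, whereas ranks of members of \<A> are at least \<beta>.\<close>
        have "rkB G < \<beta>"
          using rank_function_less[OF B(1,2) F(4) Gne] .
        also have "\<beta> \<le> rk H"
          using True rkA_less oadd_ge B(3) by (simp add: rk_def)
        finally show ?thesis by (simp add: G(2))
      next
        case H': False
        have "n \<in> G"
        proof (rule ccontr)
          assume "n \<notin> G"
          then have "n \<in> F" using F(2) by blast
          then have "\<forall>l\<in>G. n < l" using F(3) by blast
          moreover obtain l where "l \<in> G" using Gne by blast
          ultimately show False using F(2) n \<open>n \<notin> G\<close>
            by (metis UnCI insertE less_asym)
        qed
        have nH: "n \<notin> H" and nF: "n \<notin> F" using n F(3) \<open>n \<in> G\<close> by blast+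
        define G' where "G' = G - {n}"
        have G': "G = insert n G'" "H = F \<union> G'"
          using \<open>n \<in> G\<close> F(2) nH nF unfolding G'_def by auto
        then have G'n: "\<forall>k\<in>G'. k < n"
          using n by blast
        have "G' \<in> \<B>" using hereditaryD(3)[OF B(1) F(4)] G'(1) by blast
        then have "G' \<in> splits H"
          using F(1,3) G' unfolding splits_def by auto
        then have "rkB G' \<le> rk H" using rk_ge H' by blast
        moreover have "rkB G < rkB G'"
          using rank_functionD(2)[OF B(2) _ G'n] F(4) G'(1) by blast
        ultimately show ?thesis by (simp add: G(2))
      qed
    qed
  next
    fix H \<delta> assume H: "H \<in> concat_family \<A> \<B>" and \<delta>: "\<delta> < rk H"
    obtain b where b: "\<forall>k\<in>H. k < b"
      using finH[OF H] finite_nat_set_iff_bounded by blast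
    show "\<exists>n0. \<forall>n\<ge>n0. insert n H \<in> concat_family \<A> \<B> \<and> \<delta> \<le> rk (insert n H)"
    proof (cases "H \<in> \<A>")
      case True
      then have "\<delta> < oadd \<beta> (rkA H)" using \<delta> by (simp add: rk_def)
      \<comment> \<open>Below \<beta>, the new element may start the \<B>-part (should the enlarged
        set happen to stay in \<A>, its rank is at least \<beta> anyway); otherwise the \<A>-part is
        extended.\<close>
      then consider "\<delta> < \<beta>" | \<gamma> where "\<gamma> < rkA H" "\<delta> \<le> oadd \<beta> \<gamma>"
        by (rule less_oadd_cases[OF _ rkA_less[OF True] B(3)])
      then show ?thesis
      proof cases
        case 1
        then have "\<delta> < rkB {}" using rank_functionD(1)[OF B(2)] by (simp only:)
        then obtain n0 where n0: "\<And>n. n \<ge> n0 \<Longrightarrow> {n} \<in> \<B> \<and> \<delta> \<le> rkB {n}"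
          using rank_functionD(3)[OF B(2) hereditaryD(1)[OF B(1)]] by blast
        have "insert n H \<in> concat_family \<A> \<B> \<and> \<delta> \<le> rk (insert n H)" if n: "n \<ge> max n0 b" for n
        proof -
          have "k < n" if "k \<in> H" for k
            using that n b by fastforce
          then have sp: "{n} \<in> splits (insert n H)"
            using True n0[of n] n unfolding splits_def by auto
          have "\<delta> \<le> rk (insert n H)"
          proof (cases "insert n H \<in> \<A>")
            case True
            have "\<delta> \<le> \<beta>" using \<open>\<delta> < \<beta>\<close> by (rule less_imp_le)
            also have "\<beta> \<le> rk (insert n H)"
              using True oadd_ge[OF rkA_less[OF True] B(3)] by (simp add: rk_def)
            finally show ?thesis .
          next
            case False
            then show ?thesis
              using rk_ge[OF sp] n0[of n] n by (meson max.boundedE order.trans)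
          qed
          then show ?thesis using sp conc by blast
        qed
        then show ?thesis by blast
      next
        case 2
        then obtain n0 where n0: "\<And>n. n \<ge> n0 \<Longrightarrow> insert n H \<in> \<A> \<and> \<gamma> \<le> rkA (insert n H)"
          using rank_functionD(3)[OF A(2) True] by blast
        have "insert n H \<in> concat_family \<A> \<B> \<and> \<delta> \<le> rk (insert n H)" if "n \<ge> n0" for n
        proof
          have iH: "insert n H \<in> \<A>" "\<gamma> \<le> rkA (insert n H)" using n0[OF that] by blast+
          show "insert n H \<in> concat_family \<A> \<B>"
            using iH(1) hereditaryD(1)[OF B(1)] unfolding concat_family_def by blast
          have "oadd \<beta> \<gamma> \<le> oadd \<beta> (rkA (insert n H))"
            using oadd_strict_mono[OF _ rkA_less[OF iH(1)] B(3), of \<gamma>] iH(2)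
            by (metis order.order_iff_strict)
          then show "\<delta> \<le> rk (insert n H)"
            using 2(2) iH(1) by (simp add: rk_def)
        qed
        then show ?thesis by blast
      qed
    next
      case False
      then obtain G where G: "G \<in> splits H" "rk H = rkB G"
        using rk_max[OF H] by blast
      then obtain F where F: "F \<in> \<A>" "H = F \<union> G" "\<forall>k\<in>F. \<forall>l\<in>G. k < l" "G \<in> \<B>"
        unfolding splits_def by blast
      obtain n0 where n0: "\<And>n. n \<ge> n0 \<Longrightarrow> insert n G \<in> \<B> \<and> \<delta> \<le> rkB (insert n G)"
        using rank_functionD(3)[OF B(2) F(4)] \<delta> G(2) by metis
      have "insert n H \<in> concat_family \<A> \<B> \<and> \<delta> \<le> rk (insert n H)" if n: "n \<ge> max n0 b" for n
      proof -
        have "k < n" if "k \<in> H" for k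
          using that n b by fastforce
        then have "\<forall>k\<in>F. \<forall>l\<in>insert n G. k < l" "insert n H = F \<union> insert n G"
          using F(2,3) by auto
        then have sp: "insert n G \<in> splits (insert n H)"
          using F(1) n0[of n] n unfolding splits_def by auto
        have "insert n H \<notin> \<A>"
          using False hereditaryD(3)[OF A(1)] by blast
        then have "\<delta> \<le> rk (insert n H)"
          using rk_ge[OF sp] n0[of n] n by (meson max.boundedE order.trans)
        then show ?thesis
          using sp conc by blast
      qed
      then show ?thesis by blast
    qed
  qed
  then show ?thesis by blast
qed

section \<open>Diagonal unions: the common form of the successor and limit clauses\<close>

definition diag_family :: "(nat \<Rightarrow> nat set set) \<Rightarrow> nat set set" where
  "diag_family \<F> = {F. \<exists>n\<ge>1. F \<in> \<F> n \<and> (\<forall>k\<in>F. n \<le> k)}"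

lemma hereditary_diag_family:
  assumes "\<And>n. n \<ge> 1 \<Longrightarrow> hereditary (\<F> n)"
  shows "hereditary (diag_family \<F>)"
  using hereditaryD[OF assms] unfolding hereditary_def diag_family_def by blast

lemma spreading_diag_family:
  assumes "\<And>n. n \<ge> 1 \<Longrightarrow> spreading (\<F> n)"
  shows "spreading (diag_family \<F>)"
  unfolding spreading_def diag_family_def
proof (intro ballI allI impI)
  fix F f assume "F \<in> {F. \<exists>n\<ge>1. F \<in> \<F> n \<and> (\<forall>k\<in>F. n \<le> k)}"
    and f: "strict_mono_on F f \<and> (\<forall>k\<in>F. k \<le> f k)"
  then obtain n where n: "n \<ge> 1" "F \<in> \<F> n" "\<forall>k\<in>F. n \<le> k" by blast
  have "f ` F \<in> \<F> n"
    using assms[OF n(1)] n(2) f unfolding spreading_def by blast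
  moreover have "\<forall>k\<in>f ` F. n \<le> k"
    using n(3) f by fastforce
  ultimately show "f ` F \<in> {F. \<exists>n\<ge>1. F \<in> \<F> n \<and> (\<forall>k\<in>F. n \<le> k)}"
    using n(1) by blast
qed

text \<open>A nonempty \<open>F\<close> belongs to the n-th constituent only for n up to its
  minimum, so the best of finitely many ranks can be taken. The empty set is restricted by no n,
  which makes its rank the supremum.\<close>

lemma rank_function_diag_family:
  assumes her: "\<And>n. n \<ge> 1 \<Longrightarrow> hereditary (\<F> n)"
    and rank: "\<And>n. n \<ge> 1 \<Longrightarrow> rank_function (\<F> n) (r n) (\<alpha> n)"
  shows "\<exists>rk. rank_function (diag_family \<F>) rk (SUP n\<in>{1..}. \<alpha> n)"
proof -
  define N where "N F = {n. n \<ge> 1 \<and> F \<in> \<F> n \<and> (\<forall>k\<in>F. n \<le> k)}" for F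
  define rk where "rk F = (if F = {} then SUP n\<in>{1..}. \<alpha> n else Max ((\<lambda>n. r n F) ` N F))" for F
  have mem: "F \<in> diag_family \<F> \<longleftrightarrow> N F \<noteq> {}" for F
    unfolding diag_family_def N_def by blast
  have fin: "finite (N F)" if "F \<noteq> {}" for F
  proof -
    from that obtain k where "k \<in> F" by (meson equals0I)
    then have "N F \<subseteq> {..k}" unfolding N_def by blast
    then show ?thesis by (rule finite_subset) simp
  qed
  have rk_max: "\<exists>n\<in>N F. rk F = r n F" if "F \<in> diag_family \<F>" "F \<noteq> {}" for F
  proof -
    have "Max ((\<lambda>n. r n F) ` N F) \<in> (\<lambda>n. r n F) ` N F"
      using fin[OF that(2)] that(1) by (intro Max_in) (simp_all add: mem)
    then show ?thesis using that(2) unfolding rk_def by auto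
  qed
  have rk_ge: "r n F \<le> rk F" if "n \<in> N F" "F \<noteq> {}" for n F
    using that fin[OF that(2)] by (simp add: rk_def)
  have \<alpha>_le: "\<alpha> n \<le> (SUP n\<in>{1..}. \<alpha> n)" if "n \<ge> 1" for n
    using that by (intro SUP_upper) simp
  have "rank_function (diag_family \<F>) rk (SUP n\<in>{1..}. \<alpha> n)"
    unfolding rank_function_def
  proof (intro conjI allI impI ballI)
    show "rk {} = (SUP n\<in>{1..}. \<alpha> n)" by (simp add: rk_def)
  next
    fix F n assume F: "insert n F \<in> diag_family \<F>" and n: "\<forall>k\<in>F. k < n"
    obtain m where m: "m \<in> N (insert n F)" "rk (insert n F) = r m (insert n F)"
      using rk_max[OF F] by blast
    then have m': "m \<ge> 1" "insert n F \<in> \<F> m" unfolding N_def by blast+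
    have less: "r m (insert n F) < r m F"
      using rank_functionD(2)[OF rank[OF m'(1)] m'(2) n] .
    also have "r m F \<le> rk F"
    proof (cases "F = {}")
      case True
      then show ?thesis
        using rank_functionD(1)[OF rank[OF m'(1)]] \<alpha>_le[OF m'(1)] by (simp add: rk_def)
    next
      case False
      have "m \<in> N F"
        using m(1) hereditaryD(3)[OF her[OF m'(1)] m'(2)] unfolding N_def by blast
      then show ?thesis using rk_ge False by blast
    qed
    finally show "rk (insert n F) < rk F" unfolding m(2) .
  next
    fix F \<beta> assume F: "F \<in> diag_family \<F>" and \<beta>: "\<beta> < rk F"
    have "\<exists>m\<ge>1. F \<in> \<F> m \<and> \<beta> < r m F \<and> (\<forall>k\<in>F. m \<le> k)"
    proof (cases "F = {}")
      case True
      then obtain m where "m \<ge> 1" "\<beta> < \<alpha> m"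
        using \<beta> unfolding rk_def by (auto simp: less_SUP_iff)
      then show ?thesis
        using True rank_functionD(1)[OF rank] hereditaryD(1)[OF her] by auto
    next
      case False
      then show ?thesis
        using rk_max[OF F] \<beta> unfolding N_def by auto
    qed
    then obtain m where m: "m \<ge> 1" "F \<in> \<F> m" "\<beta> < r m F" "\<forall>k\<in>F. m \<le> k" by blast
    then obtain n0 where n0: "\<And>n. n \<ge> n0 \<Longrightarrow> insert n F \<in> \<F> m \<and> \<beta> \<le> r m (insert n F)"
      using rank_functionD(3)[OF rank[OF m(1)] m(2,3)] by blast
    have "insert n F \<in> diag_family \<F> \<and> \<beta> \<le> rk (insert n F)" if "n \<ge> max n0 m" for n
    proof -
      have N: "m \<in> N (insert n F)"
        using m n0[of n] that unfolding N_def by auto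
      then have "r m (insert n F) \<le> rk (insert n F)" using rk_ge by blast
      then have "\<beta> \<le> rk (insert n F)"
        using n0[of n] that by (meson max.boundedE order.trans)
      then show ?thesis
        using N mem by blast
    qed
    then show "\<exists>n0. \<forall>n\<ge>n0. insert n F \<in> diag_family \<F> \<and> \<beta> \<le> rk (insert n F)" by blast
  qed
  then show ?thesis by blast
qed

section \<open>Finite concatenation powers and the Schreier families\<close>

primrec concat_power :: "nat set set \<Rightarrow> nat \<Rightarrow> nat set set" where
  "concat_power \<S> 0 = {{}}"
| "concat_power \<S> (Suc m) = concat_family \<S> (concat_power \<S> m)"

lemma concat_power_eq:
  "concat_power \<S> m = {(\<Union>i\<in>{1..m}. F i) | F. (\<forall>i\<in>{1..m}. F i \<in> \<S>) \<and>
     (\<forall>i\<in>{1..m}. \<forall>j\<in>{1..m}. i < j \<longrightarrow> (\<forall>k\<in>F i. \<forall>l\<in>F j. k < l))}"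
proof (induction m)
  case (Suc m)
  have split: "{1..Suc m} = insert 1 (Suc ` {1..m})"
    by auto
  show ?case (is "_ = ?R")
  proof (intro equalityI subsetI)
    fix H assume "H \<in> concat_power \<S> (Suc m)"
    then obtain F L where FL: "H = F \<union> L" "F \<in> \<S>" "L \<in> concat_power \<S> m" "\<forall>k\<in>F. \<forall>l\<in>L. k < l"
      unfolding concat_power.simps concat_family_def by blast
    from FL(3) obtain G where G: "L = (\<Union>i\<in>{1..m}. G i)" "\<forall>i\<in>{1..m}. G i \<in> \<S>"
      "\<forall>i\<in>{1..m}. \<forall>j\<in>{1..m}. i < j \<longrightarrow> (\<forall>k\<in>G i. \<forall>l\<in>G j. k < l)"
      unfolding Suc.IH by blast
    define K where "K i = (if i = 1 then F else G (i - 1))" for i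
    have K: "K 1 = F" "\<And>i. i \<in> {1..m} \<Longrightarrow> K (Suc i) = G i"
      unfolding K_def by auto
    have k1: "H = (\<Union>i\<in>{1..Suc m}. K i)"
      unfolding split FL(1) G(1) using K by (simp del: image_Suc_atLeastAtMost One_nat_def)
    have k2: "\<forall>i\<in>{1..Suc m}. K i \<in> \<S>"
      unfolding split using FL(2) G(2) K by (simp del: image_Suc_atLeastAtMost One_nat_def)
    have k3: "\<forall>i\<in>{1..Suc m}. \<forall>j\<in>{1..Suc m}. i < j \<longrightarrow> (\<forall>k\<in>K i. \<forall>l\<in>K j. k < l)"
    proof (intro ballI impI)
      fix i j k l assume i: "i \<in> {1..Suc m}" and j: "j \<in> {1..Suc m}" and ij: "i < j"
        and k: "k \<in> K i" and l: "l \<in> K j"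
      obtain j' where j': "j = Suc j'" "j' \<in> {1..m}"
        using i j ij by (cases j) auto
      then have l': "l \<in> G j'" using l K(2) by simp
      show "k < l"
      proof (cases "i = 1")
        case True
        then show ?thesis using FL(4) G(1) j'(2) l' k K(1) by blast
      next
        case False
        then obtain i' where i': "i = Suc i'" "i' \<in> {1..m}"
          using i by (cases i) auto
        then have "k \<in> G i'" using k K(2) by simp
        moreover have "i' < j'" using ij i'(1) j'(1) by simp
        ultimately show ?thesis using G(3) i'(2) j'(2) l' by blast
      qed
    qed
    show "H \<in> ?R"
      unfolding mem_Collect_eq by (intro exI conjI) (rule k1 k2 k3)+
  next
    fix H assume "H \<in> ?R"
    then obtain K where K: "H = (\<Union>i\<in>{1..Suc m}. K i)" "\<forall>i\<in>{1..Suc m}. K i \<in> \<S>"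
      "\<forall>i\<in>{1..Suc m}. \<forall>j\<in>{1..Suc m}. i < j \<longrightarrow> (\<forall>k\<in>K i. \<forall>l\<in>K j. k < l)"
      by blast
    have h1: "H = K 1 \<union> (\<Union>i\<in>{1..m}. K (Suc i))"
      unfolding K(1) split by (simp del: image_Suc_atLeastAtMost One_nat_def)
    have h3: "(\<Union>i\<in>{1..m}. K (Suc i)) \<in> concat_power \<S> m"
    proof -
      have "\<forall>i\<in>{1..m}. K (Suc i) \<in> \<S>" using K(2) by simp
      moreover have "\<forall>i\<in>{1..m}. \<forall>j\<in>{1..m}. i < j \<longrightarrow> (\<forall>k\<in>K (Suc i). \<forall>l\<in>K (Suc j). k < l)"
      proof (intro ballI impI)
        fix i j k l assume ij: "i \<in> {1..m}" "j \<in> {1..m}" "i < j" and kl: "k \<in> K (Suc i)" "l \<in> K (Suc j)"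
        have "Suc i \<in> {1..Suc m}" "Suc j \<in> {1..Suc m}" "Suc i < Suc j" using ij by auto
        then show "k < l" using K(3) kl by blast
      qed
      ultimately show ?thesis unfolding Suc.IH by blast
    qed
    have h4: "\<forall>k\<in>K 1. \<forall>l\<in>(\<Union>i\<in>{1..m}. K (Suc i)). k < l"
    proof (intro ballI)
      fix k l assume k: "k \<in> K 1" and "l \<in> (\<Union>i\<in>{1..m}. K (Suc i))"
      then obtain i where i: "i \<in> {1..m}" "l \<in> K (Suc i)" by blast
      have "1 \<in> {1..Suc m}" "Suc i \<in> {1..Suc m}" "1 < Suc i" using i(1) by auto
      then show "k < l" using K(3) k i(2) by blast
    qed
    have h2: "K 1 \<in> \<S>" using K(2) by auto
    show "H \<in> concat_power \<S> (Suc m)"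
      unfolding concat_power.simps concat_family_def mem_Collect_eq
      by (intro exI conjI) (rule h1 h2 h3 h4)+
  qed
qed simp

text \<open>The conditions \<open>m <= F i\<close> amount to one condition on the union, and can be
  separated from the concatenation.\<close>

lemma schreier_succ_eq: "schreier_succ \<S> = diag_family (concat_power \<S>)"
proof (intro equalityI subsetI)
  fix H assume "H \<in> schreier_succ \<S>"
  then obtain m F where F: "m \<ge> 1" "H = (\<Union>i\<in>{1..m}. F i)" "\<forall>i\<in>{1..m}. F i \<in> \<S>"
    "\<forall>i\<in>{1..m}. \<forall>k\<in>F i. m \<le> k"
    "\<forall>i\<in>{1..m}. \<forall>j\<in>{1..m}. i < j \<longrightarrow> (\<forall>k\<in>F i. \<forall>l\<in>F j. k < l)"
    unfolding schreier_succ_def by blast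
  then have "H \<in> concat_power \<S> m" "\<forall>k\<in>H. m \<le> k"
    unfolding concat_power_eq by blast+
  then show "H \<in> diag_family (concat_power \<S>)"
    using F(1) unfolding diag_family_def by blast
next
  fix H assume "H \<in> diag_family (concat_power \<S>)"
  then obtain m where m: "m \<ge> 1" "H \<in> concat_power \<S> m" "\<forall>k\<in>H. m \<le> k"
    unfolding diag_family_def by blast
  from m(2) obtain F where F: "H = (\<Union>i\<in>{1..m}. F i)" "\<forall>i\<in>{1..m}. F i \<in> \<S>"
    "\<forall>i\<in>{1..m}. \<forall>j\<in>{1..m}. i < j \<longrightarrow> (\<forall>k\<in>F i. \<forall>l\<in>F j. k < l)"
    unfolding concat_power_eq by blast
  have "\<forall>i\<in>{1..m}. \<forall>k\<in>F i. m \<le> k"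
    using m(3) F(1) by blast
  with m(1) F show "H \<in> schreier_succ \<S>"
    unfolding schreier_succ_def by blast
qed

lemma concat_power_properties:
  assumes "hereditary \<S>" "spreading \<S>" "rank_function \<S> rk \<alpha>" "\<alpha> < omega1"
  shows "hereditary (concat_power \<S> m)" "spreading (concat_power \<S> m)"
    "\<exists>r. rank_function (concat_power \<S> m) r (omult \<alpha> ((osuc ^^ m) bot))"
proof (induction m)
  case 0
  show "hereditary (concat_power \<S> 0)" by (simp add: hereditary_def)
  show "spreading (concat_power \<S> 0)" by (simp add: spreading_def)
  show "\<exists>r. rank_function (concat_power \<S> 0) r (omult \<alpha> ((osuc ^^ 0) bot))"
    by (intro exI[of _ "\<lambda>_. bot"]) (simp add: rank_function_def omult_rec(1))
next
  case (Suc m)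
  show "hereditary (concat_power \<S> (Suc m))"
    using hereditary_concat_family[OF assms(1) Suc(1)] by simp
  show "spreading (concat_power \<S> (Suc m))"
    using spreading_concat_family[OF assms(2) Suc(2)] by simp
  from Suc(3) obtain r where r: "rank_function (concat_power \<S> m) r (omult \<alpha> ((osuc ^^ m) bot))"
    by blast
  show "\<exists>r. rank_function (concat_power \<S> (Suc m)) r (omult \<alpha> ((osuc ^^ Suc m) bot))"
    using rank_function_concat_family[OF assms(1,3,4) Suc(1) r omult_finite_less_omega1[OF assms(4)]]
    unfolding concat_power.simps omult_finite_Suc .
qed

text \<open>The choice of \<phi> does not affect the rank at limits: the sequence is cofinal and
  \<xi> \<mapsto> \<omega>^\<xi> is monotone and continuous. Spreading is carried along for
  \<open>nonmaximal_insert\<close>.\<close>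

lemma schreier_properties:
  assumes \<phi>: "fundamental_sequences \<phi>" and "\<xi> < omega1"
  shows "hereditary (schreier \<phi> \<xi>) \<and> spreading (schreier \<phi> \<xi>) \<and>
    (\<exists>rk. rank_function (schreier \<phi> \<xi>) rk (opow omega \<xi>))"
  using assms(2)
proof (induction \<xi> rule: countable_ordinal_induct)
  case zero
  let ?rk = "\<lambda>F::nat set. if F = {} then osuc bot else bot"
  have pos: "bot < osuc bot" using osuc_greater[OF bot_less_omega1] .
  have "rank_function (schreier \<phi> bot) ?rk (opow omega bot)"
    unfolding rank_function_def opow_rec(1)
  proof (intro conjI allI impI ballI)
    fix F :: "nat set" and n assume "insert n F \<in> schreier \<phi> bot" "\<forall>k\<in>F. k < n"
    then have "F = {}" unfolding schreier_rec(1) by auto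
    then show "?rk (insert n F) < ?rk F" using pos by simp
  next
    fix F :: "nat set" and \<beta> assume F: "F \<in> schreier \<phi> bot" "\<beta> < ?rk F"
    have "F = {}"
    proof (rule ccontr)
      assume "F \<noteq> {}"
      with F(2) show False by simp
    qed
    with F(2) have "\<beta> = bot" by (simp add: less_osuc_iff[OF bot_less_omega1] bot_unique)
    with \<open>F = {}\<close> show "\<exists>n0. \<forall>n\<ge>n0. insert n F \<in> schreier \<phi> bot \<and> \<beta> \<le> ?rk (insert n F)"
      by (intro exI[of _ 1]) (simp add: schreier_rec(1))
  qed simp
  moreover have "hereditary (schreier \<phi> bot)"
    unfolding hereditary_def schreier_rec(1) by (auto simp: subset_singleton_iff)
  moreover have "spreading (schreier \<phi> bot)"
    unfolding spreading_def schreier_rec(1) by (auto intro: order.trans)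
  ultimately show ?case by blast
next
  case (succ \<xi>)
  then obtain rk where S: "hereditary (schreier \<phi> \<xi>)" "spreading (schreier \<phi> \<xi>)"
    "rank_function (schreier \<phi> \<xi>) rk (opow omega \<xi>)" by blast
  note props = concat_power_properties[OF S opow_omega_less_omega1[OF succ(1)]]
  let ?\<alpha> = "\<lambda>m. omult (opow omega \<xi>) ((osuc ^^ m) bot)"
  obtain r where r: "rank_function (concat_power (schreier \<phi> \<xi>) m) (r m) (?\<alpha> m)" for m
    using props(3) by metis
  \<comment> \<open>The Schreier families start at n = 1, the multiples of \<omega>^\<xi> at n = 0;
    the extra multiple is \<open>bot\<close>.\<close>
  have "(SUP n\<in>{1..}. ?\<alpha> n) = (SUP n. ?\<alpha> n)"
  proof (rule antisym)
    have "?\<alpha> n \<le> (SUP n\<in>{1..}. ?\<alpha> n)" for n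
    proof (cases n)
      case (Suc m)
      then show ?thesis by (intro SUP_upper) simp
    qed (simp add: omult_rec(1))
    then show "(SUP n. ?\<alpha> n) \<le> (SUP n\<in>{1..}. ?\<alpha> n)" by (rule SUP_least)
    show "(SUP n\<in>{1..}. ?\<alpha> n) \<le> (SUP n. ?\<alpha> n)" by (rule SUP_subset_mono) auto
  qed
  then have "\<exists>rk. rank_function (schreier \<phi> (osuc \<xi>)) rk (opow omega (osuc \<xi>))"
    using rank_function_diag_family[of "concat_power (schreier \<phi> \<xi>)" r ?\<alpha>] props(1) r
    unfolding schreier_rec(2)[OF succ(1)] schreier_succ_eq opow_omega_osuc[OF succ(1)] by simp
  then show ?case
    using hereditary_diag_family[of "concat_power (schreier \<phi> \<xi>)"]
      spreading_diag_family[of "concat_power (schreier \<phi> \<xi>)"] props(1,2)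
    unfolding schreier_rec(2)[OF succ(1)] schreier_succ_eq by blast
next
  case (limit \<xi>)
  have mono: "\<phi> \<xi> n < \<xi>" if "n \<ge> 1" for n
    using \<phi> limit(1,2) that unfolding fundamental_sequences_def by blast
  have cofinal: "(SUP n\<in>{1..}. \<phi> \<xi> n) = \<xi>"
    using \<phi> limit(1,2) unfolding fundamental_sequences_def by blast
  have S: "schreier \<phi> \<xi> = diag_family (\<lambda>n. schreier \<phi> (\<phi> \<xi> n))"
    unfolding schreier_rec(3)[OF \<phi> limit(1,2)] diag_family_def ..
  have IH: "hereditary (schreier \<phi> (\<phi> \<xi> n))" "spreading (schreier \<phi> (\<phi> \<xi> n))"
    "\<exists>rk. rank_function (schreier \<phi> (\<phi> \<xi> n)) rk (opow omega (\<phi> \<xi> n))" if "n \<ge> 1" for n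
    using limit(3)[OF mono[OF that]] by blast+
  then obtain r where r: "n \<ge> 1 \<Longrightarrow> rank_function (schreier \<phi> (\<phi> \<xi> n)) (r n) (opow omega (\<phi> \<xi> n))" for n
    by metis
  have "(SUP n\<in>{1..}. opow omega (\<phi> \<xi> n)) = opow omega \<xi>"
    unfolding opow_rec(3)[OF limit(1)]
  proof (rule antisym)
    show "(SUP n\<in>{1..}. opow omega (\<phi> \<xi> n)) \<le> (SUP \<gamma>\<in>{..<\<xi>}. opow omega \<gamma>)"
      using mono by (intro SUP_least SUP_upper) auto
    show "(SUP \<gamma>\<in>{..<\<xi>}. opow omega \<gamma>) \<le> (SUP n\<in>{1..}. opow omega (\<phi> \<xi> n))"
    proof (rule SUP_least)
      fix \<gamma> assume "\<gamma> \<in> {..<\<xi>}"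
      then obtain n where n: "n \<ge> 1" "\<gamma> < \<phi> \<xi> n"
        using cofinal by (metis atLeast_iff lessThan_iff less_SUP_iff)
      have "\<phi> \<xi> n < omega1" using mono[OF n(1)] limit(2) by (rule order.strict_trans)
      then have "opow omega \<gamma> \<le> opow omega (\<phi> \<xi> n)"
        using n(2) by (intro opow_omega_mono less_imp_le)
      also have "\<dots> \<le> (SUP n\<in>{1..}. opow omega (\<phi> \<xi> n))"
        using n(1) by (intro SUP_upper) simp
      finally show "opow omega \<gamma> \<le> (SUP n\<in>{1..}. opow omega (\<phi> \<xi> n))" .
    qed
  qed
  then have "\<exists>rk. rank_function (schreier \<phi> \<xi>) rk (opow omega \<xi>)"
    using rank_function_diag_family[of "\<lambda>n. schreier \<phi> (\<phi> \<xi> n)" r "\<lambda>n. opow omega (\<phi> \<xi> n)"] IH(1) r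
    unfolding S by simp
  then show ?case
    using hereditary_diag_family[of "\<lambda>n. schreier \<phi> (\<phi> \<xi> n)"]
      spreading_diag_family[of "\<lambda>n. schreier \<phi> (\<phi> \<xi> n)"] IH(1,2) unfolding S by blast
qed

text \<open>If \<open>g \<in> G - F\<close>, then \<open>insert n F\<close> is a spread of \<open>insert g F\<close> for all large \<open>n\<close>: move
  each element of \<open>insert g F\<close> from \<open>g\<close> on to the next element of \<open>insert n F\<close>.\<close>

lemma nonmaximal_insert:
  assumes "hereditary \<F>" "spreading \<F>" "G \<in> \<F>" "F \<subset> G"
  shows "\<exists>n0. \<forall>n\<ge>n0. insert n F \<in> \<F>"
proof -
  obtain g where g: "g \<in> G" "g \<notin> F" using assms(4) by blast
  define H where "H = insert g F"
  have "H \<subseteq> G" using g(1) assms(4) unfolding H_def by blast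
  then have H: "H \<in> \<F>" "finite H"
    using hereditaryD(2,3)[OF assms(1)] assms(3) by blast+
  have finF: "finite F" using H(2) unfolding H_def by simp
  have "insert n F \<in> \<F>" if n: "n \<ge> Suc (Max H)" for n
  proof -
    have lt: "x < n" if "x \<in> H" for x
      using n Max_ge[OF H(2) that] by simp
    define nxt where "nxt x = Min {y \<in> insert n F. x < y}" for x
    have nxt: "nxt x \<in> insert n F" "x < nxt x" if "x \<in> H" for x
    proof -
      have "nxt x \<in> {y \<in> insert n F. x < y}"
        unfolding nxt_def using finF lt[OF that] by (intro Min_in) auto
      then show "nxt x \<in> insert n F" "x < nxt x" by auto
    qed
    have nxt_le: "nxt x \<le> y" if "x < y" "y \<in> F" for x y
      unfolding nxt_def using finF that by (intro Min_le) auto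
    define f where "f x = (if x < g then x else nxt x)" for x
    have mono: "strict_mono_on H f"
    proof (rule strict_mono_onI)
      fix x y assume xy: "x \<in> H" "y \<in> H" "x < y"
      show "f x < f y"
      proof (cases "x < g")
        case True
        then show ?thesis using xy nxt(2)[OF xy(2)] unfolding f_def by simp
      next
        case False
        then have "y \<in> F" using xy unfolding H_def by auto
        then show ?thesis
          using False xy nxt_le[of x y] nxt(2)[OF xy(2)] unfolding f_def by simp
      qed
    qed
    have ge: "\<forall>x\<in>H. x \<le> f x"
      using nxt(2) unfolding f_def by (simp add: less_imp_le)
    have "f ` H \<subseteq> insert n F"
      using nxt(1) unfolding f_def H_def by auto
    \<comment> \<open>\<open>f\<close> is injective, and both \<open>H\<close> and
      \<open>insert n F\<close> have one element more than \<open>F\<close>; so the inclusion of the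
      image is an equality.\<close>
    moreover have "card (f ` H) = card (insert n F)"
    proof -
      have "n \<notin> F" using lt unfolding H_def by blast
      then show ?thesis
        using card_image[OF strict_mono_on_imp_inj_on[OF mono]] g(2) finF unfolding H_def by simp
    qed
    ultimately have "f ` H = insert n F"
      using finF by (intro card_subset_eq) auto
    moreover have "f ` H \<in> \<F>"
      using assms(2) H(1) mono ge unfolding spreading_def by blast
    ultimately show ?thesis by simp
  qed
  then show ?thesis by blast
qed

section \<open>Basic sequences\<close>

text \<open>This is Grunblum's criterion for a basis of the closed span, with \<open>K\<close> a
  bound for the basis constant. Unlike \<open>schauder_basis\<close> it does not refer to the
  ambient space, and block sequences inherit it with the same \<open>K\<close>.\<close>

locale basic_sequence =
  fixes e :: "nat \<Rightarrow> 'a::banach" and K :: real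
  assumes nonzero: "e i \<noteq> 0"
    and partial_sum_bound:
      "n \<le> m \<Longrightarrow> norm (\<Sum>i<n. a i *\<^sub>R e i) \<le> K * norm (\<Sum>i<m. a i *\<^sub>R e i)"

text \<open>Each coefficient is controlled by a difference of two partial sums, so the coefficients
  converge; the bound is uniform in n, which permits exchanging the limit of the vectors with that
  of the partial sums. It serves the approximation argument of the next theorem and the passage from
  the span to its closure.\<close>

lemma sums_limit:
  fixes e :: "nat \<Rightarrow> 'a::banach"
  assumes nz: "\<And>i. e i \<noteq> 0"
    and f: "f \<longlonglongrightarrow> x" and c: "\<And>k. (\<lambda>i. c k i *\<^sub>R e i) sums f k"
    and \<eta>: "\<eta> \<longlonglongrightarrow> (0::real)"
    and bound: "\<And>k l n. k \<le> l \<Longrightarrow> norm (\<Sum>i<n. (c k i - c l i) *\<^sub>R e i) \<le> \<eta> k"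
  shows "\<exists>b. (\<lambda>i. b i *\<^sub>R e i) sums x \<and>
    (\<forall>k n. norm ((\<Sum>i<n. c k i *\<^sub>R e i) - (\<Sum>i<n. b i *\<^sub>R e i)) \<le> \<eta> k)"
proof -
  have coeff: "\<bar>c k i - c l i\<bar> * norm (e i) \<le> 2 * \<eta> k" if "k \<le> l" for k l i
  proof -
    have eq: "(c k i - c l i) *\<^sub>R e i
        = (\<Sum>j<Suc i. (c k j - c l j) *\<^sub>R e j) - (\<Sum>j<i. (c k j - c l j) *\<^sub>R e j)"
      by simp
    have "norm ((c k i - c l i) *\<^sub>R e i) \<le> \<eta> k + \<eta> k"
      unfolding eq by (rule order.trans[OF norm_triangle_ineq4 add_mono]) (rule bound[OF that])+
    then show ?thesis by simp
  qed
  have "convergent (\<lambda>k. c k i)" for i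
    unfolding Cauchy_convergent_iff[symmetric]
  proof (rule metric_CauchyI)
    fix r :: real assume "r > 0"
    then have "r * norm (e i) / 4 > 0" using nz by simp
    then obtain k where "\<bar>\<eta> k\<bar> < r * norm (e i) / 4"
      using LIMSEQ_D[OF \<eta>] by fastforce
    then have k: "2 * \<eta> k < (r / 2) * norm (e i)" by simp
    have half: "\<bar>c k i - c l i\<bar> < r / 2" if "l \<ge> k" for l
    proof -
      have "\<bar>c k i - c l i\<bar> * norm (e i) < (r / 2) * norm (e i)"
        using coeff[OF that, of i] k by linarith
      then show ?thesis by (rule mult_right_less_imp_less) simp
    qed
    show "\<exists>M. \<forall>m\<ge>M. \<forall>n\<ge>M. dist (c m i) (c n i) < r"
    proof (intro exI[of _ k] allI impI)
      fix m n assume "m \<ge> k" "n \<ge> k"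
      then show "dist (c m i) (c n i) < r"
        using half[of m] half[of n] abs_triangle_ineq4[of "c k i - c n i" "c k i - c m i"]
        unfolding dist_real_def by simp
    qed
  qed
  then obtain b where b: "(\<lambda>k. c k i) \<longlonglongrightarrow> b i" for i
    unfolding convergent_def by metis
  have lim: "norm ((\<Sum>i<n. c k i *\<^sub>R e i) - (\<Sum>i<n. b i *\<^sub>R e i)) \<le> \<eta> k" for k n
  proof -
    have "(\<lambda>l. norm (\<Sum>i<n. (c k i - c l i) *\<^sub>R e i)) \<longlonglongrightarrow> norm (\<Sum>i<n. (c k i - b i) *\<^sub>R e i)"
      by (intro tendsto_intros b)
    then have "norm (\<Sum>i<n. (c k i - b i) *\<^sub>R e i) \<le> \<eta> k"
      by (rule Lim_bounded) (use bound in blast)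
    then show ?thesis
      by (simp add: scaleR_left_diff_distrib sum_subtractf)
  qed
  have "(\<lambda>i. b i *\<^sub>R e i) sums x"
    unfolding sums_def
  proof (rule LIMSEQ_I)
    fix r :: real assume r: "r > 0"
    obtain k1 where k1: "\<And>k. k \<ge> k1 \<Longrightarrow> \<bar>\<eta> k\<bar> < r / 3"
      using LIMSEQ_D[OF \<eta>, of "r / 3"] r by auto
    obtain k2 where k2: "\<And>k. k \<ge> k2 \<Longrightarrow> norm (f k - x) < r / 3"
      using LIMSEQ_D[OF f, of "r / 3"] r by auto
    define k where "k = max k1 k2"
    obtain N where N: "\<And>n. n \<ge> N \<Longrightarrow> norm ((\<Sum>i<n. c k i *\<^sub>R e i) - f k) < r / 3"
      using LIMSEQ_D[OF c[of k, unfolded sums_def], of "r / 3"] r by auto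
    show "\<exists>N. \<forall>n\<ge>N. norm ((\<Sum>i<n. b i *\<^sub>R e i) - x) < r"
    proof (intro exI[of _ N] allI impI)
      fix n assume n: "n \<ge> N"
      let ?C = "\<Sum>i<n. c k i *\<^sub>R e i" and ?B = "\<Sum>i<n. b i *\<^sub>R e i"
      have "norm (?B - x) = norm ((?C - f k) + (f k - x) - (?C - ?B))" by simp
      also have "\<dots> \<le> norm ((?C - f k) + (f k - x)) + norm (?C - ?B)"
        by (rule norm_triangle_ineq4)
      also have "\<dots> \<le> norm (?C - f k) + norm (f k - x) + norm (?C - ?B)"
        using norm_triangle_ineq[of "?C - f k" "f k - x"] by simp
      finally have "norm (?B - x) \<le> norm (?C - f k) + norm (f k - x) + norm (?C - ?B)" .
      moreover have "norm (?C - ?B) \<le> \<eta> k" by (rule lim)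
      moreover have "\<bar>\<eta> k\<bar> < r / 3" "norm (f k - x) < r / 3"
        using k1[of k] k2[of k] unfolding k_def by auto
      ultimately show "norm (?B - x) < r"
        using N[OF n] by linarith
    qed
  qed
  with lim show ?thesis by blast
qed

text \<open>The partial sum operators are not known to be continuous here, so neither the uniform
  boundedness principle nor the closed graph theorem applies directly.  As in the open mapping
  theorem, Baire's theorem gives approximations by vectors with bounded partial sums, whose sums
  then have the coordinates of the limit, by uniqueness.\<close>

theorem schauder_basis_imp_basic_sequence:
  fixes e :: "nat \<Rightarrow> 'a::banach"
  assumes basis: "schauder_basis e"
  shows "\<exists>K. basic_sequence e K"
proof -
  have ex1: "\<exists>!a. (\<lambda>i. a i *\<^sub>R e i) sums x" for x
    using basis unfolding schauder_basis_def by blast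
  define c where "c x = (THE a. (\<lambda>i. a i *\<^sub>R e i) sums x)" for x
  have c: "(\<lambda>i. c x i *\<^sub>R e i) sums x" for x
    unfolding c_def by (rule theI'[OF ex1])
  have c_eq: "c x = a" if "(\<lambda>i. a i *\<^sub>R e i) sums x" for x a
    using ex1[of x] c[of x] that by blast
  have c_comb: "c (r *\<^sub>R x + s *\<^sub>R y) = (\<lambda>i. r * c x i + s * c y i)" for r s x y
    by (rule c_eq) (use sums_add[OF sums_scaleR_right[OF c] sums_scaleR_right[OF c]]
        in \<open>simp add: scaleR_add_left\<close>)
  have c_diff: "c (x - y) = (\<lambda>i. c x i - c y i)" for x y
    using c_comb[of 1 x "-1" y] by simp
  have nz: "e i \<noteq> 0" for i
  proof
    assume "e i = 0"
    then have "(\<lambda>j. (if j = i then 1 else 0) *\<^sub>R e j) = (\<lambda>j. 0)" by auto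
    then have h: "(\<lambda>j. (if j = i then 1 else 0) *\<^sub>R e j) sums 0" "(\<lambda>j. 0 *\<^sub>R e j) sums 0"
      by simp_all
    have "(\<lambda>j. if j = i then 1 else 0) = (\<lambda>j. 0 :: real)"
      by (rule trans[OF c_eq[OF h(1), symmetric] c_eq[OF h(2)]])
    then have "(if i = i then 1 else 0) = (0 :: real)"
      by (rule fun_cong)
    then show False by simp
  qed
  define S where "S n x = (\<Sum>i<n. c x i *\<^sub>R e i)" for n x
  have S_comb: "S n (r *\<^sub>R x + s *\<^sub>R y) = r *\<^sub>R S n x + s *\<^sub>R S n y" for n r s x y
    unfolding S_def c_comb by (simp add: scaleR_add_left sum.distrib scaleR_sum_right)
  have S_scale: "S n (r *\<^sub>R x) = r *\<^sub>R S n x" for n r x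
    using S_comb[of n r x 0 x] by simp
  define A where "A k = {x. \<forall>n. norm (S n x) \<le> real k}" for k :: nat
  have "\<exists>k. x \<in> A k" for x
  proof -
    have "Bseq (\<lambda>n. S n x)"
      using c[of x] unfolding S_def sums_def by (intro convergent_imp_Bseq) (auto simp: convergent_def)
    then obtain b where b: "\<And>n. norm (S n x) \<le> b" unfolding Bseq_def by blast
    obtain k where "b \<le> real k" using real_arch_simple by blast
    with b have "\<forall>n. norm (S n x) \<le> real k" using order.trans by blast
    then show ?thesis unfolding A_def by blast
  qed
  then have union: "\<Union>(range (\<lambda>k. closure (A k))) = UNIV"
    using subsetD[OF closure_subset] by fastforce
  have "\<exists>k. interior (closure (A k)) \<noteq> {}"
  proof (rule ccontr)
    assume "\<not> ?thesis"
    then have "euclidean interior_of (closure (A k)) = {}" for k by simp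
    then have "euclidean interior_of (\<Union>(range (\<lambda>k. closure (A k)))) = {}"
      unfolding mtopology_is_euclidean[symmetric]
      by (intro Met_TC.metric_Baire_category_alt) (auto simp: complete_UNIV)
    then show False unfolding union by simp
  qed
  then obtain k x0 where "x0 \<in> interior (closure (A k))" by blast
  then obtain r where r: "r > 0" "ball x0 r \<subseteq> closure (A k)"
    unfolding mem_interior by blast
  \<comment> \<open>\<open>A k\<close> is convex and symmetric. Since \<open>x\<close> is half the
    difference of \<open>x0 + x\<close> and \<open>x0 - x\<close>, density of \<open>A k\<close>
    near \<open>x0\<close> carries over to a ball around 0.\<close>
  have A_mid: "(1/2) *\<^sub>R u + (-1/2) *\<^sub>R v \<in> A k" if "u \<in> A k" "v \<in> A k" for u v
  proof -
    have "norm (S n ((1/2) *\<^sub>R u + (-1/2) *\<^sub>R v)) \<le> real k" for n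
    proof -
      have "norm (S n ((1/2) *\<^sub>R u + (-1/2) *\<^sub>R v)) \<le> (1/2) * norm (S n u) + (1/2) * norm (S n v)"
        unfolding S_comb by (rule order.trans[OF norm_triangle_ineq]) simp
      moreover have "norm (S n u) \<le> real k" "norm (S n v) \<le> real k"
        using that unfolding A_def by blast+
      ultimately show ?thesis by linarith
    qed
    then show ?thesis unfolding A_def by blast
  qed
  have approx0: "\<exists>u\<in>A k. norm (x - u) < \<epsilon>" if x: "norm x < r" and \<epsilon>: "\<epsilon> > 0" for x \<epsilon>
  proof -
    have "x0 + x \<in> closure (A k)" "x0 - x \<in> closure (A k)"
      using r(2) x by (auto simp: dist_norm)
    then obtain u v where uv: "u \<in> A k" "dist u (x0 + x) < \<epsilon>" "v \<in> A k" "dist v (x0 - x) < \<epsilon>"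
      using \<epsilon> unfolding closure_approachable by blast
    have eq: "x - ((1/2) *\<^sub>R u + (-1/2) *\<^sub>R v) = (-1/2) *\<^sub>R (u - (x0 + x)) + (1/2) *\<^sub>R (v - (x0 - x))"
      by (simp add: algebra_simps flip: scaleR_add_left)
    have "norm (x - ((1/2) *\<^sub>R u + (-1/2) *\<^sub>R v)) \<le> (1/2) * norm (u - (x0 + x)) + (1/2) * norm (v - (x0 - x))"
      unfolding eq by (rule order.trans[OF norm_triangle_ineq]) simp
    also have "\<dots> < \<epsilon>" using uv by (simp add: dist_norm)
    finally show ?thesis using A_mid uv by blast
  qed
  \<comment> \<open>Vectors are rescaled to norm r/2, well inside the ball of radius r, where
    \<open>A k\<close> with its bound k is dense.\<close>
  define M where "M = 2 * real k / r"
  have M: "M \<ge> 0" unfolding M_def using r(1) by simp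
  have approx: "\<exists>u. norm (x - u) < \<epsilon> \<and> (\<forall>n. norm (S n u) \<le> M * norm x)" if \<epsilon>: "\<epsilon> > 0" for x \<epsilon>
  proof (cases "x = 0")
    case True
    then show ?thesis using \<epsilon> S_scale[of _ 0 0] by (intro exI[of _ 0]) simp
  next
    case False
    define t where "t = r / (2 * norm x)"
    have t: "t > 0" unfolding t_def using r(1) False by simp
    have "norm (t *\<^sub>R x) < r" unfolding t_def using r(1) False by simp
    then obtain u where u: "u \<in> A k" "norm (t *\<^sub>R x - u) < t * \<epsilon>"
      using approx0[of "t *\<^sub>R x" "t * \<epsilon>"] t \<epsilon> by auto
    have "x - (1/t) *\<^sub>R u = (1/t) *\<^sub>R (t *\<^sub>R x - u)"
      using t by (simp add: scaleR_diff_right)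
    then have "norm (x - (1/t) *\<^sub>R u) = (1/t) * norm (t *\<^sub>R x - u)"
      using t by simp
    also have "\<dots> < (1/t) * (t * \<epsilon>)" using t u(2) by (intro mult_strict_left_mono) auto
    also have "\<dots> = \<epsilon>" using t by simp
    finally have 1: "norm (x - (1/t) *\<^sub>R u) < \<epsilon>" .
    have "norm (S n ((1/t) *\<^sub>R u)) \<le> M * norm x" for n
    proof -
      have "norm (S n ((1/t) *\<^sub>R u)) = (1/t) * norm (S n u)"
        unfolding S_scale using t by simp
      also have "\<dots> \<le> (1/t) * real k"
        using u(1) t unfolding A_def by (intro mult_left_mono) auto
      also have "\<dots> = M * norm x" unfolding t_def M_def by simp
      finally show ?thesis .
    qed
    with 1 show ?thesis by blast
  qed
  have S_bound: "norm (S n x) \<le> 2 * M * norm x" for n x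
  proof (cases "x = 0")
    case True
    then show ?thesis using S_scale[of n 0 0] by simp
  next
    case False
    have "\<forall>y \<epsilon>. \<exists>u. \<epsilon> > 0 \<longrightarrow> norm (y - u) < \<epsilon> \<and> (\<forall>n. norm (S n u) \<le> M * norm y)"
      using approx by blast
    then obtain g where "\<forall>y \<epsilon>. \<epsilon> > 0 \<longrightarrow> norm (y - g y \<epsilon>) < \<epsilon> \<and> (\<forall>n. norm (S n (g y \<epsilon>)) \<le> M * norm y)"
      by metis
    then have g: "\<epsilon> > 0 \<Longrightarrow> norm (y - g y \<epsilon>) < \<epsilon>"
      "\<epsilon> > 0 \<Longrightarrow> norm (S n (g y \<epsilon>)) \<le> M * norm y" for y \<epsilon> n
      by blast+
    \<comment> \<open>Successive remainders: at each step the current remainder is approximated by a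
      vector with controlled partial sums, and the j-th remainder has norm at most
      \<open>norm x / 2 ^ j\<close>.\<close>
    define R where "R = rec_nat x (\<lambda>j y. y - g y (norm x / 2 ^ Suc j))"
    have R: "R 0 = x" "R (Suc j) = R j - g (R j) (norm x / 2 ^ Suc j)" for j
      unfolding R_def by simp_all
    have pos: "norm x / 2 ^ j > 0" for j :: nat using False by simp
    have R_le: "norm (R j) \<le> norm x / 2 ^ j" for j
    proof (cases j)
      case (Suc i)
      then show ?thesis using g(1)[OF pos[of "Suc i"], of "R i"] R(2)[of i] by simp
    qed (simp add: R(1))
    have step: "norm (S n (R j - R (Suc j))) \<le> M * norm x * (1/2) ^ j" for n j
    proof -
      have "norm (S n (R j - R (Suc j))) \<le> M * norm (R j)"
        using g(2)[OF pos[of "Suc j"], of n "R j"] R(2)[of j] by simp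
      also have "\<dots> \<le> M * (norm x / 2 ^ j)"
        using M R_le by (intro mult_left_mono)
      finally show ?thesis by (simp add: power_one_over divide_simps)
    qed
    define f where "f j = x - R j" for j
    \<comment> \<open>The tail from j on of the geometric series that bounds the increments of the
      partial sums.\<close>
    define \<eta> where "\<eta> j = 2 * M * norm x * (1/2) ^ j" for j :: nat
    have S_diff: "S n (y - z) = S n y - S n z" for n y z
      using S_comb[of n 1 y "-1" z] by simp
    have cauchy: "norm (S n (f k) - S n (f l)) \<le> \<eta> k - \<eta> l" if "k \<le> l" for k l n
      using that
    proof (induction l rule: dec_induct)
      case (step l)
      have "f (Suc l) - f l = R l - R (Suc l)" unfolding f_def by simp
      then have "norm (S n (f l) - S n (f (Suc l))) \<le> M * norm x * (1/2) ^ l"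
        using \<open>\<And>n j. norm (S n (R j - R (Suc j))) \<le> M * norm x * (1/2) ^ j\<close>[of n l]
        by (metis S_diff norm_minus_commute)
      also have "\<dots> = \<eta> l - \<eta> (Suc l)" unfolding \<eta>_def by simp
      finally show ?case
        using step.IH norm_triangle_ineq[of "S n (f k) - S n (f l)" "S n (f l) - S n (f (Suc l))"]
        by simp
    qed simp
    have \<eta>0: "\<eta> j \<ge> 0" for j unfolding \<eta>_def using M by simp
    have "\<exists>b. (\<lambda>i. b i *\<^sub>R e i) sums x \<and>
      (\<forall>k n. norm ((\<Sum>i<n. c (f k) i *\<^sub>R e i) - (\<Sum>i<n. b i *\<^sub>R e i)) \<le> \<eta> k)"
    proof (rule sums_limit[OF nz _ c])
      have "(\<lambda>j. norm x * (1/2) ^ j) \<longlonglongrightarrow> norm x * 0"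
        by (intro tendsto_intros LIMSEQ_power_zero) simp
      then have "R \<longlonglongrightarrow> 0"
        using R_le by (intro Lim_null_comparison[of R "\<lambda>j. norm x * (1/2) ^ j"])
          (auto simp: power_one_over divide_simps)
      then have "(\<lambda>j. x - R j) \<longlonglongrightarrow> x - 0" by (intro tendsto_intros)
      then show "f \<longlonglongrightarrow> x" unfolding f_def by simp
      have "(\<lambda>j. 2 * M * norm x * (1/2) ^ j) \<longlonglongrightarrow> 2 * M * norm x * 0"
        by (intro tendsto_intros LIMSEQ_power_zero) simp
      then show "\<eta> \<longlonglongrightarrow> 0" unfolding \<eta>_def by simp
      fix k l n :: nat assume "k \<le> l"
      then have "norm (S n (f k) - S n (f l)) \<le> \<eta> k"
        using cauchy[of k l n] \<eta>0[of l] by simp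
      then show "norm (\<Sum>i<n. (c (f k) i - c (f l) i) *\<^sub>R e i) \<le> \<eta> k"
        unfolding S_def by (simp add: scaleR_left_diff_distrib sum_subtractf)
    qed
    then obtain b where b: "(\<lambda>i. b i *\<^sub>R e i) sums x"
      "\<And>k n. norm ((\<Sum>i<n. c (f k) i *\<^sub>R e i) - (\<Sum>i<n. b i *\<^sub>R e i)) \<le> \<eta> k" by blast
    \<comment> \<open>For k = 0 the error estimate is already the claim, since
      \<open>f 0 = 0\<close> and \<open>\<eta> 0 = 2 * M * norm x\<close>.\<close>
    have "f 0 = 0" unfolding f_def R(1) by simp
    then have "S n (f 0) = 0" using S_scale[of n 0 0] by simp
    then show ?thesis
      using b(2)[where k=0 and n=n] c_eq[OF b(1)] unfolding S_def \<eta>_def by simp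
  qed
  have "basic_sequence e (2 * M)"
  proof
    fix n m :: nat and a :: "nat \<Rightarrow> real" assume nm: "n \<le> m"
    define a' where "a' i = (if i < m then a i else 0)" for i
    have "(\<lambda>i. a' i *\<^sub>R e i) sums (\<Sum>i<m. a' i *\<^sub>R e i)"
      by (rule sums_finite) (auto simp: a'_def)
    moreover have eq: "(\<Sum>i<n. a' i *\<^sub>R e i) = (\<Sum>i<n. a i *\<^sub>R e i)" if "n \<le> m" for n
      using that by (intro sum.cong) (auto simp: a'_def)
    ultimately have "c (\<Sum>i<m. a i *\<^sub>R e i) = a'"
      using c_eq by (metis order.refl)
    then have "S n (\<Sum>i<m. a i *\<^sub>R e i) = (\<Sum>i<n. a i *\<^sub>R e i)"
      unfolding S_def using eq[OF nm] by simp
    then show "norm (\<Sum>i<n. a i *\<^sub>R e i) \<le> 2 * M * norm (\<Sum>i<m. a i *\<^sub>R e i)"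
      using S_bound by metis
  qed (rule nz)
  then show ?thesis by blast
qed

section \<open>Coordinates and supports\<close>

context basic_sequence
begin

lemma K_ge_1: "K \<ge> 1"
proof -
  have "norm (e 0) \<le> K * norm (e 0)"
    using partial_sum_bound[of 1 1 "\<lambda>_. 1"] by simp
  then show ?thesis using nonzero[of 0] by simp
qed

lemma sums_partial_bound:
  assumes "(\<lambda>i. a i *\<^sub>R e i) sums x"
  shows "norm (\<Sum>i<n. a i *\<^sub>R e i) \<le> K * norm x"
proof -
  have "(\<lambda>m. K * norm (\<Sum>i<m. a i *\<^sub>R e i)) \<longlonglongrightarrow> K * norm x"
    using assms unfolding sums_def by (intro tendsto_intros)
  then show ?thesis
    by (rule LIMSEQ_le_const) (use partial_sum_bound in blast)
qed

lemma sums_coeff_bound: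
  assumes "(\<lambda>i. a i *\<^sub>R e i) sums x"
  shows "\<bar>a i\<bar> * norm (e i) \<le> 2 * K * norm x"
proof -
  have eq: "a i *\<^sub>R e i = (\<Sum>j<Suc i. a j *\<^sub>R e j) - (\<Sum>j<i. a j *\<^sub>R e j)" by simp
  have "norm (a i *\<^sub>R e i) \<le> K * norm x + K * norm x"
    unfolding eq
    by (rule order.trans[OF norm_triangle_ineq4 add_mono]) (rule sums_partial_bound[OF assms])+
  then show ?thesis by simp
qed

lemma sums_unique_coeffs:
  assumes "(\<lambda>i. a i *\<^sub>R e i) sums x" "(\<lambda>i. b i *\<^sub>R e i) sums x"
  shows "a = b"
proof
  fix i
  have "(\<lambda>i. (a i - b i) *\<^sub>R e i) sums 0"
    using sums_diff[OF assms] by (simp add: scaleR_left_diff_distrib)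
  then have "\<bar>a i - b i\<bar> * norm (e i) \<le> 0"
    using sums_coeff_bound by fastforce
  then show "a i = b i"
    using nonzero[of i] by (simp add: mult_le_0_iff)
qed

lemma coords_eq: "(\<lambda>i. a i *\<^sub>R e i) sums x \<Longrightarrow> coords e x = a"
  unfolding coords_def using sums_unique_coeffs by blast

lemma span_sums:
  assumes "x \<in> span (range e)"
  shows "\<exists>a N. (\<forall>i\<ge>N. a i = 0) \<and> (\<lambda>i. a i *\<^sub>R e i) sums x"
  using assms
proof (induction rule: span_induct_alt)
  case base
  show ?case by (rule exI[of _ "\<lambda>_. 0"]) simp
next
  case (step r y x)
  then obtain j a N where j: "y = e j" and a: "\<forall>i\<ge>N. a i = 0" "(\<lambda>i. a i *\<^sub>R e i) sums x"
    by blast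
  have "(\<lambda>i. (if i = j then r else 0) *\<^sub>R e i) = (\<lambda>i. if i = j then r *\<^sub>R e i else 0)"
    by auto
  then have "(\<lambda>i. (if i = j then r else 0) *\<^sub>R e i) sums (r *\<^sub>R e j)"
    using sums_single[of j "\<lambda>i. r *\<^sub>R e i"] by (simp only:)
  then have h1: "(\<lambda>i. ((if i = j then r else 0) + a i) *\<^sub>R e i) sums (r *\<^sub>R y + x)"
    using sums_add[OF _ a(2)] unfolding j by (simp add: scaleR_add_left)
  have h2: "\<forall>i\<ge>max N (Suc j). (if i = j then r else 0) + a i = 0"
    using a(1) by auto
  show ?case by (intro exI conjI) (rule h2 h1)+
qed

lemma span_coords:
  assumes "x \<in> span (range e)"
  shows "\<exists>N. \<forall>i\<ge>N. coords e x i = 0" "(\<lambda>i. coords e x i *\<^sub>R e i) sums x"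
  using span_sums[OF assms] coords_eq by blast+

text \<open>For approximants from the span, \<open>sums_partial_bound\<close> applied to their
  differences gives the uniform Cauchy estimate that \<open>sums_limit\<close> asks for.\<close>

lemma closed_span_coords:
  assumes "x \<in> closed_span e"
  shows "(\<lambda>i. coords e x i *\<^sub>R e i) sums x"
proof -
  have "\<forall>k::nat. \<exists>y\<in>span (range e). dist y x < 1 / Suc k"
    using assms unfolding closed_span_def closure_approachable by simp
  then obtain f where f: "\<And>k. f k \<in> span (range e)" "\<And>k::nat. dist (f k) x < 1 / Suc k"
    by metis
  define \<eta> where "\<eta> k = K * (2 * (1 / Suc k))" for k :: nat
  have lim0: "(\<lambda>k. 1 / real (Suc k)) \<longlonglongrightarrow> 0"
    using LIMSEQ_inverse_real_of_nat by (simp add: inverse_eq_divide)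
  have "\<exists>b. (\<lambda>i. b i *\<^sub>R e i) sums x \<and>
    (\<forall>k n. norm ((\<Sum>i<n. coords e (f k) i *\<^sub>R e i) - (\<Sum>i<n. b i *\<^sub>R e i)) \<le> \<eta> k)"
  proof (rule sums_limit[OF nonzero _ span_coords(2)[OF f(1)]])
    show "f \<longlonglongrightarrow> x"
    proof (rule metric_LIMSEQ_I)
      fix r :: real assume "r > 0"
      then obtain N where N: "1 / real (Suc N) < r" using nat_approx_posE by blast
      have "dist (f n) x < r" if "n \<ge> N" for n
      proof -
        have "1 / real (Suc n) \<le> 1 / real (Suc N)" using that by (simp add: frac_le)
        then show ?thesis using f(2)[of n] N by linarith
      qed
      then show "\<exists>N. \<forall>n\<ge>N. dist (f n) x < r" by blast
    qed
    have "(\<lambda>k. K * (2 * (1 / real (Suc k)))) \<longlonglongrightarrow> K * (2 * 0)"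
      by (intro tendsto_intros lim0)
    then show "\<eta> \<longlonglongrightarrow> 0" unfolding \<eta>_def by simp
    fix k l n :: nat assume "k \<le> l"
    have "(\<lambda>i. (coords e (f k) i - coords e (f l) i) *\<^sub>R e i) sums (f k - f l)"
      using sums_diff[OF span_coords(2)[OF f(1)] span_coords(2)[OF f(1)]]
      by (simp add: scaleR_left_diff_distrib)
    then have "norm (\<Sum>i<n. (coords e (f k) i - coords e (f l) i) *\<^sub>R e i) \<le> K * norm (f k - f l)"
      by (rule sums_partial_bound)
    also have "\<dots> \<le> \<eta> k"
    proof -
      have "norm (f k - f l) \<le> dist (f k) x + dist (f l) x"
        by (metis dist_norm dist_triangle2)
      moreover have "1 / real (Suc l) \<le> 1 / real (Suc k)" using \<open>k \<le> l\<close> by (simp add: frac_le)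
      ultimately have "norm (f k - f l) \<le> 2 * (1 / Suc k)"
        using f(2)[of k] f(2)[of l] by linarith
      then show ?thesis unfolding \<eta>_def using K_ge_1 by (intro mult_left_mono) auto
    qed
    finally show "norm (\<Sum>i<n. (coords e (f k) i - coords e (f l) i) *\<^sub>R e i) \<le> \<eta> k" .
  qed
  then show ?thesis using coords_eq by blast
qed

lemma span_subset_closed_span: "span (range e) \<subseteq> closed_span e"
  unfolding closed_span_def by (rule closure_subset)

lemma coords_scaleR: "x \<in> span (range e) \<Longrightarrow> coords e (r *\<^sub>R x) i = r * coords e x i"
  using coords_eq[of "\<lambda>i. r * coords e x i"] sums_scaleR_right[OF span_coords(2), of x r] by simp

lemma coords_add:
  assumes "x \<in> span (range e)" "y \<in> span (range e)"
  shows "coords e (x + y) i = coords e x i + coords e y i"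
proof -
  have "(\<lambda>i. (coords e x i + coords e y i) *\<^sub>R e i) sums (x + y)"
    unfolding scaleR_add_left by (intro sums_add span_coords(2) assms)
  then show ?thesis by (simp add: coords_eq)
qed

lemma coords_diff:
  "x \<in> span (range e) \<Longrightarrow> y \<in> span (range e) \<Longrightarrow> coords e (x - y) i = coords e x i - coords e y i"
  using coords_add[of x "(-1) *\<^sub>R y" i] coords_scaleR[of y "-1" i] span_scale[of y "range e" "-1"] by simp

lemma coords_zero: "coords e 0 i = 0"
  using coords_eq[of "\<lambda>_. 0" 0] by simp

lemma coords_sum:
  assumes "\<And>i. i \<in> I \<Longrightarrow> f i \<in> span (range e)"
  shows "coords e (\<Sum>i\<in>I. f i) j = (\<Sum>i\<in>I. coords e (f i) j)"
proof (cases "finite I")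
  case True
  then show ?thesis
    using assms
  proof (induction I rule: finite_induct)
    case (insert i I)
    then show ?case by (simp add: coords_add span_sum)
  qed (simp add: coords_zero)
qed (simp add: coords_zero)

lemma coords_basis: "coords e (e j) i = (if i = j then 1 else 0)"
proof -
  have "(\<lambda>i. (if i = j then 1 else 0) *\<^sub>R e i) = (\<lambda>i. if i = j then e i else 0)"
    by auto
  then have "(\<lambda>i. (if i = j then 1 else 0) *\<^sub>R e i) sums e j"
    using sums_single[of j e] by (simp only:)
  then show ?thesis by (simp add: coords_eq)
qed

lemma coords_bound: "x \<in> closed_span e \<Longrightarrow> \<bar>coords e x i\<bar> * norm (e i) \<le> 2 * K * norm x"
  using sums_coeff_bound closed_span_coords by blast

lemma span_image_iff:
  "x \<in> span (e ` I) \<longleftrightarrow> x \<in> span (range e) \<and> (\<forall>i. coords e x i \<noteq> 0 \<longrightarrow> i \<in> I)"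
proof
  assume "x \<in> span (e ` I)"
  then show "x \<in> span (range e) \<and> (\<forall>i. coords e x i \<noteq> 0 \<longrightarrow> i \<in> I)"
  proof (induction rule: span_induct_alt)
    case base
    show ?case by (simp add: coords_zero span_zero)
  next
    case (step r y x)
    then obtain j where j: "j \<in> I" "y = e j" by blast
    have y: "y \<in> span (range e)" unfolding j by (simp add: span_base)
    have "coords e (r *\<^sub>R y + x) i = r * (if i = j then 1 else 0) + coords e x i" for i
      using step.IH y by (simp add: coords_add coords_scaleR span_scale coords_basis j(2))
    then show ?case
      using step.IH j(1) y by (auto simp: span_add span_scale split: if_splits)
  qed
next
  assume *: "x \<in> span (range e) \<and> (\<forall>i. coords e x i \<noteq> 0 \<longrightarrow> i \<in> I)"
  then obtain N where N: "\<And>i. i \<ge> N \<Longrightarrow> coords e x i = 0"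
    using span_coords(1) by blast
  have "(\<lambda>i. coords e x i *\<^sub>R e i) sums (\<Sum>i<N. coords e x i *\<^sub>R e i)"
    by (rule sums_finite) (auto simp: N)
  then have x: "x = (\<Sum>i<N. coords e x i *\<^sub>R e i)"
    using span_coords(2)[of x] * sums_unique2 by blast
  have "(\<Sum>i<N. coords e x i *\<^sub>R e i) \<in> span (e ` I)"
  proof (rule span_sum)
    fix i
    show "coords e x i *\<^sub>R e i \<in> span (e ` I)"
      using * by (cases "coords e x i = 0") (auto simp: span_zero intro: span_scale span_base)
  qed
  then show "x \<in> span (e ` I)" using x by simp
qed

lemma span_iff_finite_supp:
  assumes "x \<in> closed_span e"
  shows "x \<in> span (range e) \<longleftrightarrow> finite (supp e x)"
proof
  assume "x \<in> span (range e)"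
  then obtain N where "\<And>i. i \<ge> N \<Longrightarrow> coords e x i = 0" using span_coords(1) by blast
  then have "supp e x \<subseteq> {..N}" unfolding supp_def by (auto simp: Suc_le_eq not_le[symmetric])
  then show "finite (supp e x)" by (rule finite_subset) simp
next
  assume "finite (supp e x)"
  moreover have "{i. coords e x i \<noteq> 0} = Suc -` supp e x" unfolding supp_def by auto
  ultimately have "finite {i. coords e x i \<noteq> 0}" by (simp add: finite_vimageI)
  then have "(\<lambda>i. coords e x i *\<^sub>R e i) sums (\<Sum>i\<in>{i. coords e x i \<noteq> 0}. coords e x i *\<^sub>R e i)"
    by (rule sums_finite) auto
  then have "x = (\<Sum>i\<in>{i. coords e x i \<noteq> 0}. coords e x i *\<^sub>R e i)"
    using closed_span_coords[OF assms] sums_unique2 by blast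
  also have "\<dots> \<in> span (range e)"
    by (intro span_sum span_scale span_base) auto
  finally show "x \<in> span (range e)" .
qed

lemma block_iff: "block e x \<longleftrightarrow> x \<in> span (range e) \<and> x \<noteq> 0"
  unfolding block_def using span_iff_finite_supp span_subset_closed_span by blast

lemma finite_supp: "x \<in> span (range e) \<Longrightarrow> finite (supp e x)"
  using span_iff_finite_supp span_subset_closed_span by blast

lemma supp_nonempty:
  assumes "x \<in> span (range e)" "x \<noteq> 0"
  shows "supp e x \<noteq> {}"
proof
  assume "supp e x = {}"
  then have "coords e x = (\<lambda>_. 0)" unfolding supp_def by auto
  then have "(\<lambda>_. 0) sums x" using span_coords(2)[OF assms(1)] by simp
  then show False using assms(2) sums_0 sums_unique2 by blast
qed

lemma supp_scaleR: "x \<in> span (range e) \<Longrightarrow> r \<noteq> 0 \<Longrightarrow> supp e (r *\<^sub>R x) = supp e x"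
  unfolding supp_def by (simp add: coords_scaleR)

lemma precedes_iff:
  assumes "block e x" "block e y"
  shows "precedes e x y \<longleftrightarrow> (\<forall>p\<in>supp e x. \<forall>q\<in>supp e y. p < q)"
proof -
  have "finite (supp e x)" "supp e x \<noteq> {}" "finite (supp e y)" "supp e y \<noteq> {}"
    using assms finite_supp supp_nonempty unfolding block_iff by blast+
  then show ?thesis unfolding precedes_def by auto
qed

lemma precedes_trans:
  assumes "block e y" "precedes e x y" "precedes e y z"
  shows "precedes e x z"
proof -
  have "finite (supp e y)" "supp e y \<noteq> {}"
    using assms finite_supp supp_nonempty unfolding block_iff by blast+
  then have "Min (supp e y) \<le> Max (supp e y)" by simp
  then show ?thesis using assms(2,3) unfolding precedes_def by linarith
qed

end

section \<open>Block sequences\<close>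

context basic_sequence
begin

lemma span_eq_sum:
  assumes "x \<in> span (range e)" "\<And>i. i \<ge> N \<Longrightarrow> coords e x i = 0"
  shows "x = (\<Sum>i<N. coords e x i *\<^sub>R e i)"
proof -
  have "(\<lambda>i. coords e x i *\<^sub>R e i) sums (\<Sum>i<N. coords e x i *\<^sub>R e i)"
    by (rule sums_finite) (auto simp: assms(2))
  then show ?thesis
    using span_coords(2)[OF assms(1)] sums_unique2 by blast
qed

text \<open>The last inequality is strict because positions are counted from 1 and blocks from 0. It
  pushes tails of block sequences beyond any given position.\<close>

lemma block_sequenceD:
  assumes "block_sequence e y"
  shows "y n \<in> span (range e)" "y n \<noteq> 0" "block e (y n)"
    and "m < n \<Longrightarrow> precedes e (y m) (y n)"
    and "m < n \<Longrightarrow> p \<in> supp e (y m) \<Longrightarrow> q \<in> supp e (y n) \<Longrightarrow> p < q"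
    and "p \<in> supp e (y n) \<Longrightarrow> n < p"
proof -
  show block: "block e (y n)" for n
    using assms unfolding block_sequence_def by blast
  then show "y n \<in> span (range e)" "y n \<noteq> 0"
    unfolding block_iff by blast+
  show prec: "precedes e (y m) (y n)" if "m < n" for m n
    using that
  proof (induction rule: strict_inc_induct)
    case (base i)
    then show ?case using assms unfolding block_sequence_def by blast
  next
    case (step i)
    then show ?case
      using assms block precedes_trans unfolding block_sequence_def by blast
  qed
  show less: "p < q" if "m < n" "p \<in> supp e (y m)" "q \<in> supp e (y n)" for m n p q
    using prec[OF that(1)] precedes_iff[OF block block] that by blast
  show "n < p" if "p \<in> supp e (y n)"
    using that
  proof (induction n arbitrary: p)
    case 0
    then show ?case unfolding supp_def by auto
  next
    case (Suc n)
    obtain q where "q \<in> supp e (y n)"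
      using supp_nonempty block unfolding block_iff by blast
    then show ?case
      using Suc.IH less[OF lessI _ Suc.prems] by fastforce
  qed
qed

lemma block_sequence_subseq:
  assumes "block_sequence e y" "strict_mono \<kappa>"
  shows "block_sequence e (\<lambda>n. y (\<kappa> n))"
  unfolding block_sequence_def
  using block_sequenceD(3,4)[OF assms(1)] strict_monoD[OF assms(2)] by blast

lemma block_sequence_shift: "block_sequence e y \<Longrightarrow> block_sequence e (\<lambda>n. y (k + n))"
  by (rule block_sequence_subseq) (simp_all add: strict_mono_def)

lemma block_sequence_basis: "block_sequence e e"
  unfolding block_sequence_def
proof (intro conjI allI)
  show block: "block e (e n)" for n
    unfolding block_iff by (simp add: nonzero span_base)
  have "supp e (e n) = {Suc n}" for n
    unfolding supp_def by (auto simp: coords_basis)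
  then show "precedes e (e n) (e (Suc n))" for n
    unfolding precedes_def by simp
qed

lemma block_sequence_span: "block_sequence e y \<Longrightarrow> span (range y) \<subseteq> span (range e)"
  using block_sequenceD(1) by (intro span_minimal) auto

lemma block_sequence_coords_zero:
  assumes "block_sequence e y" "coords e (y i) j \<noteq> 0" "i \<noteq> k"
  shows "coords e (y k) j = 0"
proof (rule ccontr)
  assume "coords e (y k) j \<noteq> 0"
  then have "Suc j \<in> supp e (y k)" "Suc j \<in> supp e (y i)"
    using assms(2) unfolding supp_def by auto
  then show False
    using block_sequenceD(5)[OF assms(1)] assms(3) by (metis less_irrefl nat_neq_iff)
qed

text \<open>The first n terms of a block combination are its partial sum with respect to
  \<open>e\<close> up to the last position of the n-th block, so the bound \<open>K\<close> is
  inherited.\<close>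

lemma basic_sequence_block:
  assumes y: "block_sequence e y"
  shows "basic_sequence y K"
proof
  show "y i \<noteq> 0" for i using block_sequenceD(2)[OF y] .
  fix n m :: nat and a :: "nat \<Rightarrow> real" assume nm: "n \<le> m"
  show "norm (\<Sum>i<n. a i *\<^sub>R y i) \<le> K * norm (\<Sum>i<m. a i *\<^sub>R y i)"
  proof (cases n)
    case 0
    then show ?thesis using K_ge_1 by simp
  next
    case (Suc n')
    define N where "N = Max (supp e (y n'))"
    let ?w = "\<Sum>i<n. a i *\<^sub>R y i" and ?z = "\<Sum>i<m. a i *\<^sub>R y i"
    have fin: "finite (supp e (y n'))" "supp e (y n') \<noteq> {}"
      using finite_supp supp_nonempty block_sequenceD(1,2)[OF y] by blast+
    have low: "coords e (y i) j = 0" if "i < n" "j \<ge> N" for i j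
    proof (rule ccontr)
      assume "coords e (y i) j \<noteq> 0"
      then have j: "Suc j \<in> supp e (y i)" unfolding supp_def by blast
      have "Suc j \<le> N"
      proof (cases "i = n'")
        case True
        then show ?thesis using j fin unfolding N_def by simp
      next
        case False
        then have "i < n'" using that Suc by simp
        then have "Suc j < N"
          using block_sequenceD(5)[OF y _ j] Max_in[OF fin] unfolding N_def by blast
        then show ?thesis by simp
      qed
      with that show False by simp
    qed
    have high: "coords e (y i) j = 0" if "i \<ge> n" "j < N" for i j
    proof (rule ccontr)
      assume "coords e (y i) j \<noteq> 0"
      then have j: "Suc j \<in> supp e (y i)" unfolding supp_def by blast
      have "n' < i" using that Suc by simp
      then have "N < Suc j"
        using block_sequenceD(5)[OF y _ _ j] Max_in[OF fin] unfolding N_def by blast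
      with that show False by simp
    qed
    have ysp: "a i *\<^sub>R y i \<in> span (range e)" for i
      by (intro span_scale block_sequenceD(1)[OF y])
    have co: "coords e (\<Sum>i<k. a i *\<^sub>R y i) j = (\<Sum>i<k. a i * coords e (y i) j)" for k j
      using ysp block_sequenceD(1)[OF y] by (simp add: coords_sum coords_scaleR)
    have wsp: "?w \<in> span (range e)" and zsp: "?z \<in> span (range e)"
      by (intro span_sum ysp)+
    have "?w = (\<Sum>j<N. coords e ?w j *\<^sub>R e j)"
      by (rule span_eq_sum[OF wsp]) (simp add: co low)
    also have "\<dots> = (\<Sum>j<N. coords e ?z j *\<^sub>R e j)"
    proof (rule sum.cong[OF refl])
      fix j assume "j \<in> {..<N}"
      then have "(\<Sum>i<n. a i * coords e (y i) j) = (\<Sum>i<m. a i * coords e (y i) j)"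
        using nm high by (intro sum.mono_neutral_left) auto
      then show "coords e ?w j *\<^sub>R e j = coords e ?z j *\<^sub>R e j" by (simp add: co)
    qed
    also have "norm \<dots> \<le> K * norm ?z"
      by (rule sums_partial_bound[OF span_coords(2)[OF zsp]])
    finally show ?thesis .
  qed
qed

text \<open>Distinct blocks have disjoint supports, so no coordinates cancel.\<close>

lemma supp_block_combination:
  assumes y: "block_sequence e y" and x: "x \<in> span (range y)"
  shows "supp e x = (\<Union>i\<in>{i. Suc i \<in> supp y x}. supp e (y i))"
proof -
  interpret Y: basic_sequence y K by (rule basic_sequence_block[OF y])
  obtain M where M: "\<And>i. i \<ge> M \<Longrightarrow> coords y x i = 0" using Y.span_coords(1)[OF x] by blast
  have "x = (\<Sum>i<M. coords y x i *\<^sub>R y i)" by (rule Y.span_eq_sum[OF x M])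
  moreover have "coords e (\<Sum>i<M. coords y x i *\<^sub>R y i) j = (\<Sum>i<M. coords y x i * coords e (y i) j)" for j
    using block_sequenceD(1)[OF y] by (simp add: coords_sum coords_scaleR span_scale)
  ultimately have co: "coords e x j = (\<Sum>i<M. coords y x i * coords e (y i) j)" for j
    by metis
  show ?thesis
  proof (intro equalityI subsetI)
    fix p assume "p \<in> supp e x"
    then obtain j where j: "p = Suc j" "coords e x j \<noteq> 0" unfolding supp_def by blast
    then obtain i where "coords y x i * coords e (y i) j \<noteq> 0"
      unfolding co by (meson sum.not_neutral_contains_not_neutral)
    then have "Suc i \<in> supp y x" "p \<in> supp e (y i)" unfolding supp_def j(1) by auto
    then show "p \<in> (\<Union>i\<in>{i. Suc i \<in> supp y x}. supp e (y i))" by blast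
  next
    fix p assume "p \<in> (\<Union>i\<in>{i. Suc i \<in> supp y x}. supp e (y i))"
    then obtain i j where ij: "p = Suc j" "coords y x i \<noteq> 0" "coords e (y i) j \<noteq> 0"
      unfolding supp_def by auto
    have "i < M" using ij(2) M by (meson not_le)
    have "(\<Sum>k<M. coords y x k * coords e (y k) j) = (\<Sum>k\<in>{i}. coords y x k * coords e (y k) j)"
      using \<open>i < M\<close> block_sequence_coords_zero[OF y ij(3)] by (intro sum.mono_neutral_right) auto
    then have "coords e x j \<noteq> 0" unfolding co using ij by simp
    then show "p \<in> supp e x" unfolding supp_def ij(1) by blast
  qed
qed

lemma block_of_block:
  assumes "block_sequence e y" "block y x"
  shows "block e x"
proof -
  interpret Y: basic_sequence y K by (rule basic_sequence_block[OF assms(1)])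
  show ?thesis
    using assms(2) block_sequence_span[OF assms(1)] unfolding block_iff Y.block_iff by blast
qed

text \<open>A block subspace carries its own basis; this makes block lists with respect to
  \<open>y\<close> and with respect to \<open>e\<close> interchangeable.\<close>

lemma precedes_block_iff:
  assumes y: "block_sequence e y" and x: "block y x" and x': "block y x'"
  shows "precedes y x x' \<longleftrightarrow> precedes e x x'"
proof -
  interpret Y: basic_sequence y K by (rule basic_sequence_block[OF y])
  have sp: "x \<in> span (range y)" "x' \<in> span (range y)"
    using x x' unfolding Y.block_iff by blast+
  have ne: "\<exists>p. p \<in> supp e (y i)" for i
    using supp_nonempty[OF block_sequenceD(1,2)[OF y]] by blast
  show ?thesis
    unfolding Y.precedes_iff[OF x x'] precedes_iff[OF block_of_block[OF y x] block_of_block[OF y x']]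
  proof
    assume *: "\<forall>p\<in>supp y x. \<forall>q\<in>supp y x'. p < q"
    show "\<forall>p\<in>supp e x. \<forall>q\<in>supp e x'. p < q"
      unfolding supp_block_combination[OF y sp(1)] supp_block_combination[OF y sp(2)]
    proof (intro ballI)
      fix p q assume "p \<in> (\<Union>i\<in>{i. Suc i \<in> supp y x}. supp e (y i))"
        "q \<in> (\<Union>i\<in>{i. Suc i \<in> supp y x'}. supp e (y i))"
      then obtain i i' where i: "Suc i \<in> supp y x" "p \<in> supp e (y i)"
        "Suc i' \<in> supp y x'" "q \<in> supp e (y i')" by blast
      then have "i < i'" using * by blast
      then show "p < q" using block_sequenceD(5)[OF y] i by blast
    qed
  next
    assume *: "\<forall>p\<in>supp e x. \<forall>q\<in>supp e x'. p < q"
    show "\<forall>p\<in>supp y x. \<forall>q\<in>supp y x'. p < q"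
    proof (intro ballI)
      fix p q assume pq: "p \<in> supp y x" "q \<in> supp y x'"
      then obtain i i' where i: "p = Suc i" "q = Suc i'" unfolding supp_def by blast
      have less: "u < v" if "u \<in> supp e (y i)" "v \<in> supp e (y i')" for u v
        using * pq i that supp_block_combination[OF y] sp by blast
      obtain u v where "u \<in> supp e (y i)" "v \<in> supp e (y i')" using ne by blast
      then have "i < i'"
        using less[of u] less block_sequenceD(5)[OF y, of i' i v u]
        by (metis less_asym less_irrefl linorder_neqE_nat)
      then show "p < q" using i by simp
    qed
  qed
qed

lemma block_sequence_trans:
  assumes "block_sequence e y" "block_sequence y z"
  shows "block_sequence e z"
  using assms(2) block_of_block[OF assms(1)] precedes_block_iff[OF assms(1)]
  unfolding block_sequence_def by blast

text \<open>\<open>S\<close> plays closed subspaces, but the arguments below work with finite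
  combinations. Every \<open>y i\<close> that occurs in the expansion contributes its whole support
  to that of \<open>x\<close>, so finite support admits only finitely many of them.\<close>

lemma closed_span_block_span:
  assumes y: "block_sequence e y" and x: "x \<in> closed_span y" "x \<in> span (range e)"
  shows "x \<in> span (range y)"
proof -
  interpret Y: basic_sequence y K by (rule basic_sequence_block[OF y])
  let ?S = "\<lambda>n. \<Sum>i<n. coords y x i *\<^sub>R y i"
  have lim: "?S \<longlonglongrightarrow> x"
    using Y.closed_span_coords[OF x(1)] unfolding sums_def .
  have Ssp: "?S n \<in> span (range e)" for n
    by (intro span_sum span_scale block_sequenceD(1)[OF y])
  have sub: "supp e (y i) \<subseteq> supp e x" if i: "coords y x i \<noteq> 0" for i
  proof
    fix p assume "p \<in> supp e (y i)"
    then obtain j where j: "p = Suc j" "coords e (y i) j \<noteq> 0" unfolding supp_def by blast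
    \<comment> \<open>All partial sums past i have j-th coordinate \<open>c\<close>; by the
      coordinate bound this passes to the limit \<open>x\<close>.\<close>
    define c where "c = coords y x i * coords e (y i) j"
    have cS: "coords e (?S n) j = c" if "n > i" for n
    proof -
      have "coords e (?S n) j = (\<Sum>k<n. coords y x k * coords e (y k) j)"
        using block_sequenceD(1)[OF y] by (simp add: coords_sum coords_scaleR span_scale)
      also have "\<dots> = (\<Sum>k\<in>{i}. coords y x k * coords e (y k) j)"
        using that block_sequence_coords_zero[OF y j(2)] by (intro sum.mono_neutral_right) auto
      finally show ?thesis unfolding c_def by simp
    qed
    have "\<bar>coords e x j - c\<bar> * norm (e j) \<le> 2 * K * norm (x - ?S n)" if "n \<ge> Suc i" for n
    proof -
      have "x - ?S n \<in> span (range e)" using x(2) Ssp by (rule span_diff)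
      then have "\<bar>coords e (x - ?S n) j\<bar> * norm (e j) \<le> 2 * K * norm (x - ?S n)"
        using coords_bound span_subset_closed_span by blast
      then show ?thesis using cS[of n] that coords_diff[OF x(2) Ssp] by simp
    qed
    moreover have "(\<lambda>n. 2 * K * norm (x - ?S n)) \<longlonglongrightarrow> 2 * K * norm (x - x)"
      by (intro tendsto_intros lim)
    ultimately have "\<bar>coords e x j - c\<bar> * norm (e j) \<le> 2 * K * norm (x - x)"
      by (intro LIMSEQ_le_const) blast+
    then have "coords e x j = c"
      using nonzero[of j] by (simp add: mult_le_0_iff)
    then show "p \<in> supp e x" unfolding supp_def j(1) using i j(2) c_def by simp
  qed
  have "finite (supp e x)" using finite_supp[OF x(2)] .
  then obtain b where b: "\<forall>p\<in>supp e x. p < b" unfolding finite_nat_set_iff_bounded ..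
  have "supp y x \<subseteq> {..b}"
  proof
    fix q assume "q \<in> supp y x"
    then obtain i where i: "q = Suc i" "coords y x i \<noteq> 0" unfolding supp_def by blast
    obtain p where p: "p \<in> supp e (y i)"
      using supp_nonempty[OF block_sequenceD(1,2)[OF y]] by blast
    have "i < p" using block_sequenceD(6)[OF y p] .
    also have "p < b" using b sub[OF i(2)] p by blast
    finally show "q \<in> {..b}" using i by simp
  qed
  then have "finite (supp y x)" by (rule finite_subset) simp
  then show ?thesis using Y.span_iff_finite_supp[OF x(1)] by blast
qed

section \<open>Almost containment and diagonal sequences\<close>

definition almost_sub :: "(nat \<Rightarrow> 'a) \<Rightarrow> (nat \<Rightarrow> 'a) \<Rightarrow> bool" where
  "almost_sub z y \<longleftrightarrow> (\<exists>N. \<forall>n\<ge>N. z n \<in> span (range y))"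

text \<open>The first M blocks of \<open>y\<close> occupy finitely many positions, and
  \<open>z n\<close> lies beyond position n; so \<open>z n\<close> eventually involves none of these
  blocks.\<close>

lemma almost_sub_tail:
  assumes y: "block_sequence e y" and z: "block_sequence e z" and zy: "almost_sub z y"
  shows "\<exists>N. \<forall>n\<ge>N. z n \<in> span (y ` {M..})"
proof -
  interpret Y: basic_sequence y K by (rule basic_sequence_block[OF y])
  obtain N where N: "\<And>n. n \<ge> N \<Longrightarrow> z n \<in> span (range y)"
    using zy unfolding almost_sub_def by blast
  have "finite (\<Union>i<M. supp e (y i))" using finite_supp block_sequenceD(1)[OF y] by blast
  then obtain b where b: "\<forall>p\<in>(\<Union>i<M. supp e (y i)). p < b"
    unfolding finite_nat_set_iff_bounded ..
  have "z n \<in> span (y ` {M..})" if n: "n \<ge> max N b" for n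
  proof -
    have zn: "z n \<in> span (range y)" using N n by simp
    have "i \<in> {M..}" if "coords y (z n) i \<noteq> 0" for i
    proof (rule ccontr)
      assume "i \<notin> {M..}"
      then have "i < M" by simp
      obtain p where p: "p \<in> supp e (y i)"
        using supp_nonempty[OF block_sequenceD(1,2)[OF y]] by blast
      have "Suc i \<in> supp y (z n)" using that unfolding supp_def by blast
      then have "p \<in> supp e (z n)"
        unfolding supp_block_combination[OF y zn] using p by blast
      then have "n < p" using block_sequenceD(6)[OF z] by blast
      moreover have "p < b" using b p \<open>i < M\<close> by blast
      ultimately show False using n by simp
    qed
    then show ?thesis using zn by (intro Y.span_image_iff[THEN iffD2]) blast
  qed
  then show ?thesis by blast
qed

lemma almost_sub_refl: "almost_sub y y"
  unfolding almost_sub_def by (simp add: span_base)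

lemma almost_sub_trans:
  assumes "block_sequence e y" "block_sequence e z" "almost_sub z y" "almost_sub y w"
  shows "almost_sub z w"
proof -
  obtain M where M: "\<And>n. n \<ge> M \<Longrightarrow> y n \<in> span (range w)"
    using assms(4) unfolding almost_sub_def by blast
  then have "span (y ` {M..}) \<subseteq> span (range w)" by (intro span_minimal) auto
  then show ?thesis
    using almost_sub_tail[OF assms(1-3), of M] unfolding almost_sub_def by blast
qed

lemma almost_subI: "range z \<subseteq> span (range y) \<Longrightarrow> almost_sub z y"
  unfolding almost_sub_def by blast

text \<open>The diagonal sequence is almost contained in each sequence of the construction.\<close>

lemma fusion:
  assumes "countable I" and y: "block_sequence e y"
    and dense: "\<And>i z. i \<in> I \<Longrightarrow> block_sequence e z \<Longrightarrow> almost_sub z y \<Longrightarrow>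
      \<exists>w. block_sequence e w \<and> almost_sub w z \<and> P i w"
    and hered: "\<And>i z w. i \<in> I \<Longrightarrow> block_sequence e z \<Longrightarrow> P i z \<Longrightarrow>
      block_sequence e w \<Longrightarrow> almost_sub w z \<Longrightarrow> P i w"
  shows "\<exists>z. block_sequence e z \<and> almost_sub z y \<and> (\<forall>i\<in>I. P i z)"
proof (cases "I = {}")
  case True
  then show ?thesis using y almost_sub_refl by blast
next
  case False
  define t where "t = from_nat_into I"
  have t: "t n \<in> I" "range t = I" for n
    unfolding t_def using from_nat_into[OF False] range_from_nat_into[OF False assms(1)] by auto
  have step: "\<exists>w. block_sequence e w \<and> range w \<subseteq> span (range z) \<and> P (t n) w"
    if z: "block_sequence e z" "almost_sub z y" for z n
  proof -
    obtain w where w: "block_sequence e w" "almost_sub w z" "P (t n) w"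
      using dense[OF t(1) z] by blast
    obtain N where N: "\<And>k. k \<ge> N \<Longrightarrow> w k \<in> span (range z)"
      using w(2) unfolding almost_sub_def by blast
    \<comment> \<open>Dropping finitely many terms turns almost containment into containment, so
      that the spans in the construction are nested.\<close>
    define w' where "w' k = w (N + k)" for k
    have w': "block_sequence e w'" unfolding w'_def by (rule block_sequence_shift[OF w(1)])
    have "almost_sub w' w" by (rule almost_subI) (auto simp: w'_def intro: span_base)
    then have "P (t n) w'" using hered[OF t(1) w(1,3) w'] by blast
    then show ?thesis using w' N unfolding w'_def by auto
  qed
  define Q where "Q n z \<longleftrightarrow> block_sequence e z \<and> almost_sub z y" for n :: nat and z
  have "\<exists>Y. \<forall>n. Q n (Y n) \<and> range (Y (Suc n)) \<subseteq> span (range (Y n)) \<and> P (t n) (Y (Suc n))"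
  proof (rule dependent_nat_choice)
    show "\<exists>z. Q 0 z" using y almost_sub_refl unfolding Q_def by blast
    fix z n assume "Q n z"
    then have z: "block_sequence e z" "almost_sub z y" unfolding Q_def by blast+
    obtain w where w: "block_sequence e w" "range w \<subseteq> span (range z)" "P (t n) w"
      using step[OF z] by blast
    have "almost_sub w y"
      using almost_sub_trans[OF z(1) w(1) almost_subI[OF w(2)] z(2)] .
    then show "\<exists>w. Q (Suc n) w \<and> range w \<subseteq> span (range z) \<and> P (t n) w"
      using w unfolding Q_def by blast
  qed
  then obtain Y where Y: "\<And>n. block_sequence e (Y n)" "\<And>n. almost_sub (Y n) y"
    "\<And>n. range (Y (Suc n)) \<subseteq> span (range (Y n))" "\<And>n. P (t n) (Y (Suc n))"
    unfolding Q_def by blast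
  have sub: "span (range (Y m)) \<subseteq> span (range (Y n))" if "n \<le> m" for n m
    using that
  proof (induction rule: dec_induct)
    case (step m)
    have "span (range (Y (Suc m))) \<subseteq> span (range (Y m))"
      using Y(3) by (rule span_minimal) (rule subspace_span)
    with step.IH show ?case by blast
  qed simp
  have "\<exists>d. \<forall>n. (block e (d n) \<and> d n \<in> span (range (Y n))) \<and> precedes e (d n) (d (Suc n))"
  proof (rule dependent_nat_choice)
      show "\<exists>x. block e x \<and> x \<in> span (range (Y 0))"
        using block_sequenceD(3)[OF Y(1), of 0 0] span_base[OF rangeI, of "Y 0" 0] by blast
      fix x n assume x: "block e x \<and> x \<in> span (range (Y n))"
      \<comment> \<open>The term of index k of any block sequence is supported beyond position k,
        hence after \<open>x\<close>.\<close>
      define k where "k = Max (supp e x)"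
      have b: "block e (Y (Suc n) k)" using block_sequenceD(3)[OF Y(1)] .
      then have "finite (supp e (Y (Suc n) k))" "supp e (Y (Suc n) k) \<noteq> {}"
        using finite_supp supp_nonempty unfolding block_iff by blast+
      then have "Min (supp e (Y (Suc n) k)) \<in> supp e (Y (Suc n) k)" by simp
      then have "k < Min (supp e (Y (Suc n) k))" by (rule block_sequenceD(6)[OF Y(1)])
      then have "precedes e x (Y (Suc n) k)" unfolding precedes_def k_def .
      then show "\<exists>x'. (block e x' \<and> x' \<in> span (range (Y (Suc n)))) \<and> precedes e x x'"
        using b span_base[OF rangeI, of "Y (Suc n)" k] by blast
  qed
  then obtain d where d: "\<And>n. block e (d n)" "\<And>n. d n \<in> span (range (Y n))"
    "\<And>n. precedes e (d n) (d (Suc n))" by blast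
  have bd: "block_sequence e d" unfolding block_sequence_def using d by blast
  have dY: "almost_sub d (Y n)" for n
    unfolding almost_sub_def using d(2) sub by blast
  have "P i d" if i: "i \<in> I" for i
  proof -
    obtain n where "i = t n" using t(2) i by blast
    then show ?thesis using hered[OF i Y(1) _ bd dY] Y(4) by blast
  qed
  moreover have "almost_sub d y"
    using almost_sub_trans[OF Y(1) bd dY Y(2)] .
  ultimately show ?thesis using bd by blast
qed

section \<open>Finite nets and countable dense sets\<close>

lemma compact_combinations:
  fixes f :: "nat \<Rightarrow> 'b::real_normed_vector"
  shows "compact {\<Sum>i<n. c i *\<^sub>R f i | c. \<forall>i<n. \<bar>c i\<bar> \<le> R}"
proof (induction n)
  case 0
  have "{\<Sum>i<0. c i *\<^sub>R f i | c. \<forall>i<0. \<bar>c i\<bar> \<le> R} \<subseteq> {0}" by auto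
  then show ?case by (meson finite.emptyI finite.insertI finite_imp_compact finite_subset)
next
  case (Suc n)
  let ?A = "{\<Sum>i<n. c i *\<^sub>R f i | c. \<forall>i<n. \<bar>c i\<bar> \<le> R}" and ?B = "(\<lambda>r. r *\<^sub>R f n) ` {-R..R}"
  have "compact ?B" by (intro compact_continuous_image continuous_intros) simp
  with Suc have "compact {x + y | x y. x \<in> ?A \<and> y \<in> ?B}" by (rule compact_sums)
  also have "{x + y | x y. x \<in> ?A \<and> y \<in> ?B} = {\<Sum>i<Suc n. c i *\<^sub>R f i | c. \<forall>i<Suc n. \<bar>c i\<bar> \<le> R}"
    (is "?L = ?R")
  proof (intro equalityI subsetI)
    fix u assume "u \<in> ?L"
    then obtain c r where c: "u = (\<Sum>i<n. c i *\<^sub>R f i) + r *\<^sub>R f n" "\<forall>i<n. \<bar>c i\<bar> \<le> R" "r \<in> {-R..R}"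
      by blast
    have "u = (\<Sum>i<Suc n. (c(n := r)) i *\<^sub>R f i)" unfolding c(1) by simp
    moreover have "\<forall>i<Suc n. \<bar>(c(n := r)) i\<bar> \<le> R" using c(2,3) by (auto simp: less_Suc_eq)
    ultimately show "u \<in> ?R" by blast
  next
    fix u assume "u \<in> ?R"
    then obtain c where c: "u = (\<Sum>i<n. c i *\<^sub>R f i) + c n *\<^sub>R f n" "\<forall>i<Suc n. \<bar>c i\<bar> \<le> R"
      by auto
    have "(\<Sum>i<n. c i *\<^sub>R f i) \<in> ?A" using c(2) by auto
    moreover have "c n \<in> {-R..R}" using c(2) by (auto simp: abs_le_iff minus_le_iff)
    then have "c n *\<^sub>R f n \<in> ?B" by (rule imageI)
    ultimately show "u \<in> ?L" unfolding c(1) by blast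
  qed
  finally show ?case .
qed

text \<open>The span is exhausted by the compact sets \<open>A n\<close> of combinations of n basis
  vectors with coefficients bounded by n; finite nets of all of them are collected.\<close>

lemma countable_dense_span: "\<exists>D. countable D \<and> (\<forall>x\<in>span (range e). \<forall>\<epsilon>>0. \<exists>d\<in>D. norm (x - d) < \<epsilon>)"
proof -
  define A where "A n = {\<Sum>i<n. c i *\<^sub>R e i | c. \<forall>i<n. \<bar>c i\<bar> \<le> real n}" for n
  have "\<exists>F. finite F \<and> A n \<subseteq> (\<Union>x\<in>F. ball x (1 / Suc k))" for n k
  proof -
    have "seq_compact (A n)"
      unfolding A_def by (rule compact_imp_seq_compact[OF compact_combinations])
    moreover have "0 < 1 / real (Suc k)" by simp
    ultimately obtain F where "finite F" "A n \<subseteq> (\<Union>x\<in>F. ball x (1 / Suc k))"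
      using seq_compact_imp_totally_bounded[of "A n"] by metis
    then show ?thesis by blast
  qed
  then obtain F where F: "\<And>n k. finite (F n k)" "\<And>n k. A n \<subseteq> (\<Union>x\<in>F n k. ball x (1 / Suc k))"
    by metis
  have "\<exists>d\<in>(\<Union>n k. F n k). norm (x - d) < \<epsilon>" if x: "x \<in> span (range e)" and \<epsilon>: "\<epsilon> > 0" for x \<epsilon>
  proof -
    obtain N where N: "\<And>i. i \<ge> N \<Longrightarrow> coords e x i = 0" using span_coords(1)[OF x] by blast
    obtain n where n: "n \<ge> N" "\<And>i. i < N \<Longrightarrow> \<bar>coords e x i\<bar> \<le> real n"
    proof -
      obtain m where m: "Max ((\<lambda>i. \<bar>coords e x i\<bar>) ` {..N}) \<le> real m"
        using real_arch_simple by blast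
      have "\<bar>coords e x i\<bar> \<le> real (max m N)" if "i < N" for i
      proof -
        have "\<bar>coords e x i\<bar> \<le> Max ((\<lambda>i. \<bar>coords e x i\<bar>) ` {..N})" using that by (intro Max_ge) auto
        also have "\<dots> \<le> real (max m N)" using m by linarith
        finally show ?thesis .
      qed
      then show ?thesis using that[of "max m N"] by simp
    qed
    have "\<bar>coords e x i\<bar> \<le> real n" for i
      using n(2)[of i] N[of i] by (cases "i < N") auto
    moreover have "x = (\<Sum>i<n. coords e x i *\<^sub>R e i)"
      by (rule span_eq_sum[OF x]) (use N n(1) in auto)
    ultimately have "x \<in> A n" unfolding A_def by blast
    obtain k where k: "1 / real (Suc k) < \<epsilon>" using nat_approx_posE[OF \<epsilon>] .
    obtain d where "d \<in> F n k" "dist d x < 1 / Suc k"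
      using F(2)[of n k] \<open>x \<in> A n\<close> by auto
    then have "norm (x - d) < \<epsilon>" using k by (simp add: dist_norm norm_minus_commute)
    then show ?thesis using \<open>d \<in> F n k\<close> by blast
  qed
  moreover have "countable (\<Union>n k. F n k)" using F(1) by (simp add: countable_finite)
  ultimately show ?thesis by blast
qed

text \<open>The coordinate bound places the unit ball of a finite-dimensional span in a compact set
  of combinations. The centres come from the prescribed \<open>D\<close> and may lie outside that
  span; this keeps all approximating lists over one countable set.\<close>

lemma finite_net:
  assumes D: "\<forall>x\<in>span (range e). \<forall>\<epsilon>>0. \<exists>d\<in>D. norm (x - d) < \<epsilon>" and \<epsilon>: "\<epsilon> > 0"
  shows "\<exists>E. finite E \<and> E \<subseteq> D \<and> (\<forall>x\<in>span (e ` {..<n}). norm x \<le> 1 \<longrightarrow> (\<exists>d\<in>E. norm (x - d) < \<epsilon>))"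
proof -
  \<comment> \<open>The range includes n so that the maximum is over a nonempty set even for n =
    0.\<close>
  define R where "R = Max ((\<lambda>i. 2 * K / norm (e i)) ` {..n})"
  define A where "A = {\<Sum>i<n. c i *\<^sub>R e i | c. \<forall>i<n. \<bar>c i\<bar> \<le> R}"
  have "compact A" unfolding A_def by (rule compact_combinations)
  moreover have "A \<subseteq> (\<Union>d\<in>D. ball d \<epsilon>)"
  proof
    fix x assume "x \<in> A"
    then have "x \<in> span (range e)"
      unfolding A_def by (auto intro!: span_sum span_scale intro: span_base)
    then obtain d where "d \<in> D" "norm (x - d) < \<epsilon>" using D \<epsilon> by blast
    then show "x \<in> (\<Union>d\<in>D. ball d \<epsilon>)" by (auto simp: dist_norm norm_minus_commute)
  qed
  ultimately obtain E where E: "E \<subseteq> D" "finite E" "A \<subseteq> (\<Union>d\<in>E. ball d \<epsilon>)"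
    using compactE_image[of A D "\<lambda>d. ball d \<epsilon>"] by auto
  have "\<exists>d\<in>E. norm (x - d) < \<epsilon>" if x: "x \<in> span (e ` {..<n})" "norm x \<le> 1" for x
  proof -
    have xs: "x \<in> span (range e)" and N: "\<And>i. i \<ge> n \<Longrightarrow> coords e x i = 0"
      using x(1)[THEN span_image_iff[THEN iffD1]] by force+
    have "\<bar>coords e x i\<bar> \<le> R" if "i < n" for i
    proof -
      have "\<bar>coords e x i\<bar> * norm (e i) \<le> 2 * K * 1"
        using coords_bound[OF subsetD[OF span_subset_closed_span xs], of i] x(2) K_ge_1
        by (meson mult_left_mono order.trans zero_le_numeral mult_nonneg_nonneg zero_le_one)
      then have "\<bar>coords e x i\<bar> \<le> 2 * K / norm (e i)"
        using nonzero[of i] by (simp add: pos_le_divide_eq)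
      also have "\<dots> \<le> R" unfolding R_def using that by (intro Max_ge) auto
      finally show ?thesis .
    qed
    moreover have "x = (\<Sum>i<n. coords e x i *\<^sub>R e i)"
      by (rule span_eq_sum[OF xs N])
    ultimately have "x \<in> A" unfolding A_def by blast
    then obtain d where "d \<in> E" "dist d x < \<epsilon>" using E(3) by auto
    then show ?thesis by (auto simp: dist_norm norm_minus_commute)
  qed
  then show ?thesis using E by blast
qed

section \<open>Extending block lists\<close>

lemma block_list_snoc:
  "block_list e (xs @ [x]) \<longleftrightarrow>
    block_list e xs \<and> block e x \<and> (xs = [] \<or> precedes e (last xs) x)"
  unfolding block_list_def by (auto simp: successively_append_iff)

text \<open>A position is an index plus one, so \<open>Max (supp e x)\<close>, read as an index, is
  the first one beyond \<open>x\<close>.\<close>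

lemma precedes_span:
  assumes "block e x" "block e y" "precedes e x y"
  shows "y \<in> span (e ` {Max (supp e x)..})"
proof (rule span_image_iff[THEN iffD2], intro conjI allI impI)
  show "y \<in> span (range e)" using assms(2) unfolding block_iff by blast
  fix i assume "coords e y i \<noteq> 0"
  then have "Suc i \<in> supp e y" unfolding supp_def by blast
  moreover have "Max (supp e x) \<in> supp e x"
    using assms(1) finite_supp supp_nonempty unfolding block_iff by (intro Max_in) blast+
  ultimately have "Max (supp e x) < Suc i"
    using assms(3) precedes_iff[OF assms(1,2)] by blast
  then show "i \<in> {Max (supp e x)..}" by simp
qed

lemma block_span_Max:
  assumes "block e x"
  shows "x \<in> span (e ` {..<Max (supp e x)})"
proof (rule span_image_iff[THEN iffD2], intro conjI allI impI)
  show "x \<in> span (range e)" using assms unfolding block_iff by blast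
  then have fin: "finite (supp e x)" by (rule finite_supp)
  fix i assume "coords e x i \<noteq> 0"
  then have "Suc i \<in> supp e x" unfolding supp_def by blast
  then have "Suc i \<le> Max (supp e x)" by (rule Max_ge[OF fin])
  then show "i \<in> {..<Max (supp e x)}" by simp
qed

text \<open>Each further vector advances the last occupied position by at least one. Long branches
  of a tree are therefore far out.\<close>

lemma block_list_bounds:
  assumes "block_list e xs" "xs \<noteq> []"
  shows "length xs \<le> Max (supp e (last xs)) \<and>
    (\<forall>x\<in>set xs. x \<in> span (e ` {..<Max (supp e (last xs))}))"
  using assms
proof (induction xs rule: rev_induct)
  case (snoc x xs)
  have x: "block e x" and xs: "block_list e xs" "xs = [] \<or> precedes e (last xs) x"
    using snoc.prems(1) unfolding block_list_snoc by blast+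
  have fin: "finite (supp e x)" "supp e x \<noteq> {}"
    using x finite_supp supp_nonempty unfolding block_iff by blast+
  show ?case
  proof (cases "xs = []")
    case True
    have "0 < Max (supp e x)"
      using Max_in[OF fin] unfolding supp_def by auto
    then show ?thesis using True block_span_Max[OF x] by simp
  next
    case False
    have "Max (supp e (last xs)) < Min (supp e x)"
      using xs(2) False unfolding precedes_def by blast
    also have "\<dots> \<le> Max (supp e x)" using fin by simp
    finally have less: "Max (supp e (last xs)) < Max (supp e x)" .
    then have "span (e ` {..<Max (supp e (last xs))}) \<subseteq> span (e ` {..<Max (supp e x)})"
      by (intro span_mono image_mono) auto
    then show ?thesis
      using snoc.IH[OF xs(1) False] less block_span_Max[OF x] by auto
  qed
qed simp

lemma block_list_Max_mono:
  assumes "block_list e (xs @ vs)" "xs \<noteq> []"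
  shows "Max (supp e (last xs)) \<le> Max (supp e (last (xs @ vs)))"
  using assms(1)
proof (induction vs rule: rev_induct)
  case (snoc v vs)
  have b: "block_list e (xs @ vs)" "block e v" "precedes e (last (xs @ vs)) v"
    using snoc.prems assms(2) unfolding append_assoc[symmetric] block_list_snoc by auto
  have "finite (supp e v)" "supp e v \<noteq> {}"
    using b(2) finite_supp supp_nonempty unfolding block_iff by blast+
  then have "Min (supp e v) \<le> Max (supp e v)" by simp
  then show ?case using snoc.IH[OF b(1)] b(3) unfolding precedes_def by simp
qed simp

end

section \<open>Lower \<open>\<ell>\<^sub>1\<close>-estimates\<close>

definition l1_lower :: "real \<Rightarrow> 'a::real_normed_vector list \<Rightarrow> bool" where
  "l1_lower C xs \<longleftrightarrow> (\<forall>a :: nat \<Rightarrow> real.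
     (\<Sum>i<length xs. \<bar>a i\<bar>) \<le> C * norm (\<Sum>i<length xs. a i *\<^sub>R xs ! i))"

text \<open>For normalized vectors the triangle inequality gives the upper estimate with constant 1.
  Conversely, testing with the first vector shows that the upper constant is at least 1, so the
  lower one is at most \<open>C\<close>.\<close>

lemma l1_equivalent_iff:
  assumes norm: "\<forall>x\<in>set xs. norm x = 1" and ne: "xs \<noteq> []"
  shows "l1_equivalent C xs \<longleftrightarrow> l1_lower C xs"
proof
  assume "l1_equivalent C xs"
  then obtain A B where AB: "A > 0" "B > 0" "A * B \<le> C"
    "\<And>a :: nat \<Rightarrow> real. (\<Sum>i<length xs. \<bar>a i\<bar>) \<le> A * norm (\<Sum>i<length xs. a i *\<^sub>R xs ! i)"
    "\<And>a :: nat \<Rightarrow> real. norm (\<Sum>i<length xs. a i *\<^sub>R xs ! i) \<le> B * (\<Sum>i<length xs. \<bar>a i\<bar>)"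
    unfolding l1_equivalent_def by blast
  define a where "a i = (if i = 0 then 1 else 0 :: real)" for i :: nat
  have "(\<Sum>i<length xs. a i *\<^sub>R xs ! i) = (\<Sum>i\<in>{0}. a i *\<^sub>R xs ! i)"
    "(\<Sum>i<length xs. \<bar>a i\<bar>) = (\<Sum>i\<in>{0}. \<bar>a i\<bar>)"
    using ne by (intro sum.mono_neutral_right; auto simp: a_def)+
  then have "norm (xs ! 0) \<le> B * 1" using AB(5)[of a] by (simp add: a_def)
  then have "1 \<le> B" using norm ne by simp
  then have "A * 1 \<le> A * B" using AB(1) by (intro mult_left_mono) auto
  then have "A \<le> C" using AB(3) by linarith
  then show "l1_lower C xs"
    unfolding l1_lower_def using AB(4) by (meson mult_right_mono norm_ge_zero order.trans)
next
  assume low: "l1_lower C xs"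
  define a where "a i = (if i = 0 then 1 else 0 :: real)" for i :: nat
  have "(\<Sum>i<length xs. a i *\<^sub>R xs ! i) = (\<Sum>i\<in>{0}. a i *\<^sub>R xs ! i)"
    "(\<Sum>i<length xs. \<bar>a i\<bar>) = (\<Sum>i\<in>{0}. \<bar>a i\<bar>)"
    using ne by (intro sum.mono_neutral_right; auto simp: a_def)+
  then have "1 \<le> C" using low[unfolded l1_lower_def, rule_format, of a] norm ne by (simp add: a_def)
  moreover have "norm (\<Sum>i<length xs. a i *\<^sub>R xs ! i) \<le> 1 * (\<Sum>i<length xs. \<bar>a i\<bar>)" for a :: "nat \<Rightarrow> real"
    using norm_sum[of "\<lambda>i. a i *\<^sub>R xs ! i" "{..<length xs}"] norm by simp
  ultimately show "l1_equivalent C xs"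
    using low unfolding l1_equivalent_def l1_lower_def
    by (intro exI[of _ C] conjI exI[of _ 1] allI) auto
qed

lemma l1_lower_mono: "l1_lower C xs \<Longrightarrow> C \<le> C' \<Longrightarrow> l1_lower C' xs"
  unfolding l1_lower_def by (meson mult_right_mono norm_ge_zero order.trans)

text \<open>Coefficient lists allow induction over \<open>subseq\<close>, where missing coefficients
  are filled in by zeros.\<close>

lemma l1_lower_list:
  "l1_lower C xs \<longleftrightarrow> (\<forall>as. length as = length xs \<longrightarrow>
     sum_list (map abs as) \<le> C * norm (sum_list (map2 scaleR as xs)))"
proof -
  have conv: "sum_list (map abs as) = (\<Sum>i<length xs. \<bar>as ! i\<bar>)"
    "sum_list (map2 scaleR as xs) = (\<Sum>i<length xs. as ! i *\<^sub>R xs ! i)"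
    if "length as = length xs" for as :: "real list"
    using that by (simp_all add: sum_list_sum_nth atLeast0LessThan)
  show ?thesis
  proof
    assume "l1_lower C xs"
    then show "\<forall>as. length as = length xs \<longrightarrow>
     sum_list (map abs as) \<le> C * norm (sum_list (map2 scaleR as xs))"
      unfolding l1_lower_def using conv by simp
  next
    assume *: "\<forall>as. length as = length xs \<longrightarrow>
     sum_list (map abs as) \<le> C * norm (sum_list (map2 scaleR as xs))"
    show "l1_lower C xs"
      unfolding l1_lower_def
    proof
      fix a :: "nat \<Rightarrow> real"
      show "(\<Sum>i<length xs. \<bar>a i\<bar>) \<le> C * norm (\<Sum>i<length xs. a i *\<^sub>R xs ! i)"
        using *[rule_format, of "map a [0..<length xs]"] conv[of "map a [0..<length xs]"] by simp
    qed
  qed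
qed

lemma subseq_zero_extension:
  fixes us :: "'a::real_normed_vector list" and as :: "real list"
  assumes "subseq us xs" "length as = length us"
  shows "\<exists>bs. length bs = length xs \<and> sum_list (map abs bs) = sum_list (map abs as) \<and>
    sum_list (map2 scaleR bs xs) = sum_list (map2 scaleR as us)"
  using assms
proof (induction arbitrary: as rule: list_emb.induct)
  case (list_emb_Nil ys)
  have "sum_list (map2 scaleR (replicate (length ys) 0) ys) = (0 :: 'a)"
    by (induction ys) auto
  moreover have "sum_list (map abs (replicate n (0 :: real))) = 0" for n
    by (induction n) auto
  ultimately show ?case
    using list_emb_Nil by (intro exI[of _ "replicate (length ys) 0"]) simp
next
  case (list_emb_Cons us ys y)
  from list_emb_Cons.IH[OF list_emb_Cons.prems] obtain bs where
    "length bs = length ys" "sum_list (map abs bs) = sum_list (map abs as)"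
    "sum_list (map2 scaleR bs ys) = sum_list (map2 scaleR as us)" by blast
  then show ?case by (intro exI[of _ "0 # bs"]) simp
next
  case (list_emb_Cons2 u y us ys)
  then obtain r rs where as: "as = r # rs" "length rs = length us" by (cases as) auto
  from list_emb_Cons2.IH[OF as(2)] obtain bs where
    "length bs = length ys" "sum_list (map abs bs) = sum_list (map abs rs)"
    "sum_list (map2 scaleR bs ys) = sum_list (map2 scaleR rs us)" by blast
  then show ?case using list_emb_Cons2.hyps as(1) by (intro exI[of _ "r # bs"]) simp
qed

lemma l1_lower_subseq:
  assumes "l1_lower C xs" "subseq us xs"
  shows "l1_lower C us"
  unfolding l1_lower_list
proof (intro allI impI)
  fix as :: "real list" assume "length as = length us"
  then obtain bs where bs: "length bs = length xs" "sum_list (map abs bs) = sum_list (map abs as)"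
    "sum_list (map2 scaleR bs xs) = sum_list (map2 scaleR as us)"
    using subseq_zero_extension[OF assms(2)] by blast
  have "sum_list (map abs bs) \<le> C * norm (sum_list (map2 scaleR bs xs))"
    using assms(1) bs(1) unfolding l1_lower_list by blast
  then show "sum_list (map abs as) \<le> C * norm (sum_list (map2 scaleR as us))"
    unfolding bs .
qed

text \<open>Apply the estimate for \<open>ds\<close> to the coefficients \<open>a i * t i\<close>.
  The error is at most \<theta> times the sum of the \<open>\<bar>a i\<bar> * t i\<close>, and
  \<theta> C \<le> 1/2 absorbs it into half of the left-hand side. The factors \<open>t i\<close>
  leave room for normalization; replacing tree vectors by net vectors uses \<tau> = 1, the answers
  of \<open>V\<close> use \<tau> = 1/2.\<close>

lemma l1_lower_perturb:
  assumes low: "l1_lower C ds" and C: "C > 0" "\<theta> * C \<le> 1 / 2" and \<tau>: "\<tau> > 0"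
    and near: "list_all2 (\<lambda>x d. \<exists>t\<ge>\<tau>. norm (x - t *\<^sub>R d) \<le> \<theta> * t) xs ds"
  shows "l1_lower (2 * C / \<tau>) xs"
  unfolding l1_lower_def
proof
  fix a :: "nat \<Rightarrow> real"
  have len: "length xs = length ds" using near by (rule list_all2_lengthD)
  let ?I = "{..<length xs}"
  obtain t where t: "\<And>i. i \<in> ?I \<Longrightarrow> t i \<ge> \<tau> \<and> norm (xs ! i - t i *\<^sub>R ds ! i) \<le> \<theta> * t i"
    using near unfolding list_all2_conv_all_nth by (metis lessThan_iff)
  let ?s = "\<Sum>i\<in>?I. \<bar>a i\<bar> * t i" and ?N = "norm (\<Sum>i\<in>?I. a i *\<^sub>R xs ! i)"
  have "?s = (\<Sum>i\<in>?I. \<bar>a i * t i\<bar>)"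
    using t \<tau> by (intro sum.cong) (fastforce simp: abs_mult)+
  also have "\<dots> \<le> C * norm (\<Sum>i\<in>?I. (a i * t i) *\<^sub>R ds ! i)"
    using low[unfolded l1_lower_def, rule_format, of "\<lambda>i. a i * t i"] unfolding len .
  also have "norm (\<Sum>i\<in>?I. (a i * t i) *\<^sub>R ds ! i) \<le> ?N + \<theta> * ?s"
  proof -
    have "norm (\<Sum>i\<in>?I. a i *\<^sub>R (xs ! i - t i *\<^sub>R ds ! i)) \<le> (\<Sum>i\<in>?I. \<bar>a i\<bar> * (\<theta> * t i))"
      using t by (intro sum_norm_le) (auto intro!: mult_left_mono)
    moreover have "(\<Sum>i\<in>?I. (a i * t i) *\<^sub>R ds ! i) =
      (\<Sum>i\<in>?I. a i *\<^sub>R xs ! i) - (\<Sum>i\<in>?I. a i *\<^sub>R (xs ! i - t i *\<^sub>R ds ! i))"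
      by (simp add: scaleR_diff_right sum_subtractf)
    moreover have "(\<Sum>i\<in>?I. \<bar>a i\<bar> * (\<theta> * t i)) = \<theta> * ?s"
      by (simp add: sum_distrib_left mult_ac)
    ultimately show ?thesis
      using norm_triangle_ineq4[of "\<Sum>i\<in>?I. a i *\<^sub>R xs ! i" "\<Sum>i\<in>?I. a i *\<^sub>R (xs ! i - t i *\<^sub>R ds ! i)"]
      by simp
  qed
  finally have "?s \<le> C * (?N + \<theta> * ?s)" using C(1) by simp
  also have "\<dots> = C * ?N + (\<theta> * C) * ?s" by (simp add: algebra_simps)
  also have "\<dots> \<le> C * ?N + (1 / 2) * ?s"
  proof -
    have "0 \<le> \<bar>a i\<bar> * t i" if "i \<in> ?I" for i using t[OF that] \<tau> by simp
    then have "?s \<ge> 0" by (rule sum_nonneg)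
    then show ?thesis using C(2) by (intro add_left_mono mult_right_mono) auto
  qed
  finally have s: "?s \<le> 2 * C * ?N" by simp
  have "\<tau> * (\<Sum>i\<in>?I. \<bar>a i\<bar>) \<le> ?s"
    unfolding sum_distrib_left using t by (intro sum_mono) (simp add: mult.commute[of \<tau>] mult_left_mono)
  with s show "(\<Sum>i\<in>?I. \<bar>a i\<bar>) \<le> 2 * C / \<tau> * ?N"
    using \<tau> by (simp add: field_simps)
qed

section \<open>Good positions\<close>

text \<open>Positions are approximated by lists over a countable set \<open>D\<close>, because the diagonalizations
  below can only decide countably many of them.\<close>

inductive (in basic_sequence) good :: "'a set \<Rightarrow> nat \<Rightarrow> (nat \<Rightarrow> 'a) \<Rightarrow> ordinal \<Rightarrow> 'a list \<Rightarrow> bool"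
  for D C Y where
  goodI: "l1_lower (real C) ds \<Longrightarrow> \<forall>d\<in>set ds. norm d \<le> 3 / 2 \<Longrightarrow>
    (\<And>\<gamma> Z. \<gamma> < \<beta> \<Longrightarrow> block_sequence e Z \<Longrightarrow> almost_sub Z Y \<Longrightarrow>
       \<exists>x\<in>span (range Z). \<exists>d\<in>D. norm (x - d) < 1 / (4 * real C) \<and> good D C Y \<gamma> (ds @ [d])) \<Longrightarrow>
    good D C Y \<beta> ds"

text \<open>Bounds \<open>f\<close> on the finitely many successor ordinals met when descending by
  predecessors to a limit or to zero. With \<open>f\<close> an enumeration of the ranks, it says
  that all these ranks are already considered at stage \<open>m\<close>.\<close>

inductive rank_bound :: "(ordinal \<Rightarrow> nat) \<Rightarrow> nat \<Rightarrow> ordinal \<Rightarrow> bool" for f m where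
  rank_bound_zero: "rank_bound f m bot"
| rank_bound_limit: "is_limit \<mu> \<Longrightarrow> rank_bound f m \<mu>"
| rank_bound_succ: "rank_bound f m \<gamma> \<Longrightarrow> f (osuc \<gamma>) \<le> m \<Longrightarrow> rank_bound f m (osuc \<gamma>)"

lemma rank_bound_mono: "rank_bound f m \<beta> \<Longrightarrow> m \<le> n \<Longrightarrow> rank_bound f n \<beta>"
  by (induction rule: rank_bound.induct) (auto intro: rank_bound.intros)

lemma ex_rank_bound:
  assumes "\<beta> < omega1"
  shows "\<exists>m. rank_bound f m \<beta>"
  using assms
proof (induction \<beta> rule: countable_ordinal_induct)
  case (succ \<beta>)
  then obtain m where m: "rank_bound f m \<beta>" by blast
  have "rank_bound f (max m (f (osuc \<beta>))) (osuc \<beta>)"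
    by (intro rank_bound_succ rank_bound_mono[OF m]) simp_all
  then show ?case by blast
qed (auto intro: rank_bound.intros)

lemma rank_bound_osucD:
  assumes "rank_bound f m (osuc \<gamma>)" "\<gamma> < omega1"
  shows "rank_bound f m \<gamma>" "f (osuc \<gamma>) \<le> m"
proof -
  have less: "\<gamma> < osuc \<gamma>" using osuc_greater[OF assms(2)] .
  have "rank_bound f m \<gamma> \<and> f (osuc \<gamma>) \<le> m"
    using assms(1)
  proof cases
    case rank_bound_zero
    then show ?thesis using less by (metis leD bot_least)
  next
    case rank_bound_limit
    then show ?thesis using less is_limit_nonsucc by blast
  next
    case (rank_bound_succ \<gamma>')
    have "\<gamma>' = \<gamma>"
    \<comment> \<open>\<open>osuc\<close> is injective only below \<open>omega1\<close>, which it
      fixes.\<close>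
    proof (cases "\<gamma>' < omega1")
      case True
      then show ?thesis
        using rank_bound_succ(1) opred_osuc assms(2) by metis
    next
      case False
      then have "\<gamma>' = omega1" using less_top by blast
      then have "osuc \<gamma>' = omega1" unfolding osuc_def by (simp add: not_less_iff_gr_or_eq)
      then show ?thesis using rank_bound_succ(1) osuc_less_omega1[OF assms(2)] by simp
    qed
    then show ?thesis using rank_bound_succ by simp
  qed
  then show "rank_bound f m \<gamma>" "f (osuc \<gamma>) \<le> m" by blast+
qed

context basic_sequence
begin

lemma goodD:
  assumes "good D C Y \<beta> ds"
  shows "l1_lower (real C) ds" "\<forall>d\<in>set ds. norm d \<le> 3 / 2"
    "\<gamma> < \<beta> \<Longrightarrow> block_sequence e Z \<Longrightarrow> almost_sub Z Y \<Longrightarrow>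
       \<exists>x\<in>span (range Z). \<exists>d\<in>D. norm (x - d) < 1 / (4 * real C) \<and> good D C Y \<gamma> (ds @ [d])"
  using assms by (auto elim: good.cases)

lemma good_mono:
  assumes "good D C Y \<beta> ds" "\<gamma> \<le> \<beta>"
  shows "good D C Y \<gamma> ds"
  using goodD[OF assms(1)] assms(2) by (intro goodI) (blast intro: order.strict_trans2)+

lemma good_almost_sub:
  assumes "good D C Y \<beta> ds" and Y: "block_sequence e Y" "block_sequence e Y'" "almost_sub Y' Y"
  shows "good D C Y' \<beta> ds"
  using assms(1)
proof (induction rule: good.induct)
  case (goodI ds \<beta>)
  show ?case
  proof (rule good.goodI)
    fix \<gamma> Z assume Z: "\<gamma> < \<beta>" "block_sequence e Z" "almost_sub Z Y'"
    have "almost_sub Z Y" using almost_sub_trans[OF Y(2) Z(2,3) Y(3)] .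
    then show "\<exists>x\<in>span (range Z). \<exists>d\<in>D. norm (x - d) < 1 / (4 * real C) \<and> good D C Y' \<gamma> (ds @ [d])"
      using goodI(3)[OF Z(1,2)] by blast
  qed (rule goodI)+
qed

section \<open>Deciding all positions by diagonalization\<close>

definition stable :: "'a set \<Rightarrow> (nat \<Rightarrow> 'a) \<Rightarrow> nat \<Rightarrow> ordinal \<Rightarrow> 'a list \<Rightarrow> bool" where
  "stable D Y C \<beta> ds \<longleftrightarrow> good D C Y \<beta> ds \<or>
    (\<forall>Z. block_sequence e Z \<longrightarrow> almost_sub Z Y \<longrightarrow> \<not> good D C Z \<beta> ds)"

text \<open>The threshold \<open>N\<close> makes the property survive passage to almost contained
  sequences, as \<open>fusion\<close> requires.\<close>

definition refuted ::
  "'a set \<Rightarrow> (nat \<Rightarrow> 'a) \<Rightarrow> (nat \<Rightarrow> 'a) \<Rightarrow> nat \<Rightarrow> ordinal \<Rightarrow> 'a list \<Rightarrow> nat \<Rightarrow> bool" where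
  "refuted D Y Y' C \<beta> ds N \<longleftrightarrow> (\<exists>\<gamma><\<beta>. \<forall>x\<in>span (Y' ` {N..}). \<forall>d\<in>D.
    norm (x - d) < 1 / (4 * real C) \<longrightarrow> \<not> good D C Y \<gamma> (ds @ [d]))"

lemma countable_positions:
  assumes "countable D" "\<beta>0 < omega1"
  shows "countable ((UNIV :: nat set) \<times> {..\<beta>0 :: ordinal} \<times> lists D)"
  using assms countable_atMost_ordinal by (intro countable_SIGMA) auto

text \<open>Either some almost contained sequence makes the position good, and goodness is
  inherited, or the given sequence already excludes this forever; both outcomes can be
  fused.\<close>

lemma stabilize:
  assumes D: "countable D" and \<beta>0: "\<beta>0 < omega1"
  shows "\<exists>Y. block_sequence e Y \<and> (\<forall>C. \<forall>\<beta>\<le>\<beta>0. \<forall>ds\<in>lists D. stable D Y C \<beta> ds)"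
proof -
  have "\<exists>Y. block_sequence e Y \<and> almost_sub Y e \<and>
    (\<forall>t\<in>UNIV \<times> {..\<beta>0} \<times> lists D. case t of (C, \<beta>, ds) \<Rightarrow> stable D Y C \<beta> ds)"
  proof (rule fusion[OF countable_positions[OF D \<beta>0] block_sequence_basis])
    fix t :: "nat \<times> ordinal \<times> 'a list" and z assume z: "block_sequence e z"
    obtain C \<beta> ds where t: "t = (C, \<beta>, ds)" by (cases t)
    show "\<exists>w. block_sequence e w \<and> almost_sub w z \<and> (case t of (C, \<beta>, ds) \<Rightarrow> stable D w C \<beta> ds)"
      unfolding t prod.case stable_def using z almost_sub_refl by blast
  next
    fix t :: "nat \<times> ordinal \<times> 'a list" and z w
    assume z: "block_sequence e z" "case t of (C, \<beta>, ds) \<Rightarrow> stable D z C \<beta> ds"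
      and w: "block_sequence e w" "almost_sub w z"
    obtain C \<beta> ds where t: "t = (C, \<beta>, ds)" by (cases t)
    show "case t of (C, \<beta>, ds) \<Rightarrow> stable D w C \<beta> ds"
      using z(2) good_almost_sub[OF _ z(1) w] almost_sub_trans[OF w(1) _ _ w(2)]
      unfolding t prod.case stable_def by blast
  qed
  then obtain Y where "block_sequence e Y"
    "\<forall>t\<in>UNIV \<times> {..\<beta>0} \<times> lists D. case t of (C, \<beta>, ds) \<Rightarrow> stable D Y C \<beta> ds" by blast
  then show ?thesis by (intro exI[of _ Y]) auto
qed

text \<open>By stability a position that is not good for \<open>Y\<close> is not good for any
  \<open>z\<close> almost contained in \<open>Y\<close>. Unfolding this failure yields a smaller
  rank \<gamma> and a sequence \<open>Z\<close> without continuations good for \<open>z\<close>.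
  There are none good for \<open>Y\<close> either, because goodness passes from \<open>Y\<close> to
  \<open>z\<close>.\<close>

lemma ex_refuting_subspace:
  assumes D: "countable D" and \<beta>0: "\<beta>0 < omega1" and Y: "block_sequence e Y"
    and stable: "\<forall>C. \<forall>\<beta>\<le>\<beta>0. \<forall>ds\<in>lists D. stable D Y C \<beta> ds"
  shows "\<exists>Y'. block_sequence e Y' \<and> (\<forall>C. \<forall>\<beta>\<le>\<beta>0. \<forall>ds\<in>lists D.
    l1_lower (real C) ds \<longrightarrow> (\<forall>d\<in>set ds. norm d \<le> 3 / 2) \<longrightarrow> \<not> good D C Y \<beta> ds \<longrightarrow>
    (\<exists>N. refuted D Y Y' C \<beta> ds N))"
proof -
  define P where "P t Y' \<longleftrightarrow> (case t of (C, \<beta>, ds) \<Rightarrow>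
    l1_lower (real C) ds \<longrightarrow> (\<forall>d\<in>set ds. norm d \<le> 3 / 2) \<longrightarrow> \<not> good D C Y \<beta> ds \<longrightarrow>
    (\<exists>N. refuted D Y Y' C \<beta> ds N))" for t Y'
  have "\<exists>Y'. block_sequence e Y' \<and> almost_sub Y' Y \<and> (\<forall>t\<in>UNIV \<times> {..\<beta>0} \<times> lists D. P t Y')"
  proof (rule fusion[OF countable_positions[OF D \<beta>0] Y])
    fix t :: "nat \<times> ordinal \<times> 'a list" and z
    assume tI: "t \<in> UNIV \<times> {..\<beta>0} \<times> lists D" and z: "block_sequence e z" "almost_sub z Y"
    obtain C \<beta> ds where t: "t = (C, \<beta>, ds)" by (cases t)
    have \<beta>: "\<beta> \<le> \<beta>0" "ds \<in> lists D" using tI unfolding t by auto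
    show "\<exists>w. block_sequence e w \<and> almost_sub w z \<and> P t w"
    proof (cases "l1_lower (real C) ds \<and> (\<forall>d\<in>set ds. norm d \<le> 3 / 2) \<and> \<not> good D C Y \<beta> ds")
      case True
      then have "\<not> good D C z \<beta> ds" using stable \<beta> z unfolding stable_def by blast
      then obtain \<gamma> Z where Z: "\<gamma> < \<beta>" "block_sequence e Z" "almost_sub Z z"
        "\<And>x d. x \<in> span (range Z) \<Longrightarrow> d \<in> D \<Longrightarrow> norm (x - d) < 1 / (4 * real C) \<Longrightarrow>
          \<not> good D C z \<gamma> (ds @ [d])"
        using True goodI[where C=C and ds=ds and \<beta>=\<beta> and D=D and Y=z] by blast
      have "refuted D Y Z C \<beta> ds 0"
        unfolding refuted_def using Z(1,4) good_almost_sub[OF _ Y z] by (simp only: atLeast_0) blast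
      then show ?thesis using Z(2,3) unfolding P_def t prod.case by blast
    next
      case False
      then show ?thesis using z almost_sub_refl unfolding P_def t prod.case by blast
    qed
  next
    fix t z w assume z: "block_sequence e z" "P t z" and w: "block_sequence e w" "almost_sub w z"
    obtain C \<beta> ds where t: "t = (C, \<beta>, ds)" by (cases t)
    have "\<exists>N'. refuted D Y w C \<beta> ds N'" if N: "refuted D Y z C \<beta> ds N" for N
    proof -
      obtain N' where "\<forall>n\<ge>N'. w n \<in> span (z ` {N..})"
        using almost_sub_tail[OF z(1) w] by blast
      then have "w ` {N'..} \<subseteq> span (z ` {N..})" by auto
      then have "span (w ` {N'..}) \<subseteq> span (z ` {N..})"
        by (rule span_minimal) (rule subspace_span)
      then show ?thesis using N unfolding refuted_def by blast
    qed
    then show "P t w"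
      using z(2) unfolding P_def t prod.case by blast
  qed
  then obtain Y' where "block_sequence e Y'" "\<forall>t\<in>UNIV \<times> {..\<beta>0} \<times> lists D. P t Y'" by blast
  then show ?thesis
    unfolding P_def by (intro exI[of _ Y']) auto
qed

end

section \<open>From trees to good positions\<close>

context basic_sequence
begin

text \<open>The subspace \<open>W\<close> is so sparse that, for the finitely many positions over the finite nets of
  \<open>span {W 0, \<dots>, W (J - 1)}\<close> that matter at stage \<open>J\<close>, all vectors of \<open>span {W J, \<dots>}\<close> lie beyond the
  thresholds of \<open>ex_refuting_subspace\<close>.  If \<open>xs\<close> is in the \<open>\<beta>\<close>-th derivative of an \<open>\<ell>\<^sub>1\<close>-tree on \<open>W\<close>, then
  positions close to subsequences of \<open>xs\<close> are \<open>\<beta>\<close>-good: at a limit \<open>\<beta>\<close> the next vector can be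
  taken arbitrarily far out by skipping vectors, and far enough for the finitely many successor
  steps down to the next limit.\<close>

lemma tree_imp_good:
  assumes \<beta>0: "\<beta>0 < omega1" "is_limit \<beta>0"
    and trees: "\<And>y. block_sequence e y \<Longrightarrow> \<exists>C\<ge>1. \<exists>T. l1_tree C (closed_span y) T \<and>
      (\<forall>xs\<in>T. block_list y xs) \<and> deriv_iter \<beta>0 T \<noteq> {}"
  shows "\<exists>D C Y. C \<ge> 1 \<and> block_sequence e Y \<and> good D C Y \<beta>0 []"
proof -
  obtain D where D: "countable D" "\<forall>x\<in>span (range e). \<forall>\<epsilon>>0. \<exists>d\<in>D. norm (x - d) < \<epsilon>"
    using countable_dense_span by blast
  obtain Y where Y: "block_sequence e Y" and stable: "\<forall>C. \<forall>\<beta>\<le>\<beta>0. \<forall>ds\<in>lists D. stable D Y C \<beta> ds"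
    using stabilize[OF D(1) \<beta>0(1)] by blast
  obtain V where V: "block_sequence e V" and wit0: "\<forall>C. \<forall>\<beta>\<le>\<beta>0. \<forall>ds\<in>lists D.
    l1_lower (real C) ds \<longrightarrow> (\<forall>d\<in>set ds. norm d \<le> 3 / 2) \<longrightarrow> \<not> good D C Y \<beta> ds \<longrightarrow>
    (\<exists>N. refuted D Y V C \<beta> ds N)"
    using ex_refuting_subspace[OF D(1) \<beta>0(1) Y stable] by blast
  define N where "N C \<beta> ds = (SOME N. refuted D Y V C \<beta> ds N)" for C \<beta> ds
  have wit: "refuted D Y V C \<beta> ds (N C \<beta> ds)" if "\<beta> \<le> \<beta>0" "ds \<in> lists D"
    "l1_lower (real C) ds" "\<forall>d\<in>set ds. norm d \<le> 3 / 2" "\<not> good D C Y \<beta> ds" for C \<beta> ds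
    unfolding N_def using wit0 that by (intro someI_ex[of "refuted D Y V C \<beta> ds"]) blast
  interpret V: basic_sequence V K by (rule basic_sequence_block[OF V])
  have DV: "\<forall>x\<in>span (range V). \<forall>\<epsilon>>0. \<exists>d\<in>D. norm (x - d) < \<epsilon>"
    using D(2) block_sequence_span[OF V] by blast
  have "\<forall>m. \<exists>E. finite E \<and> E \<subseteq> D \<and>
    (\<forall>x\<in>span (V ` {..<m}). norm x \<le> 1 \<longrightarrow> (\<exists>d\<in>E. norm (x - d) < 1 / (4 * real (Suc m))))"
    using V.finite_net[OF DV] by simp
  then obtain E0 where E0: "\<And>m. finite (E0 m)" "\<And>m. E0 m \<subseteq> D"
    "\<And>m x. x \<in> span (V ` {..<m}) \<Longrightarrow> norm x \<le> 1 \<Longrightarrow> \<exists>d\<in>E0 m. norm (x - d) < 1 / (4 * real (Suc m))"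
    by metis
  define E where "E m = (\<Union>i\<le>m. E0 i)" for m
  have E: "finite (E m)" "E m \<subseteq> D" "E0 m \<subseteq> E m" for m
    unfolding E_def using E0(1,2) by auto
  have E_mono: "E m \<subseteq> E n" if "m \<le> n" for m n
    unfolding E_def using that by fastforce
  define idx where "idx = to_nat_on {..\<beta>0}"
  have idx: "inj_on idx {..\<beta>0}"
    unfolding idx_def by (rule inj_on_to_nat_on[OF countable_atMost_ordinal[OF \<beta>0(1)]])
  \<comment> \<open>The positions considered at stage m: constant, index of the rank and length are
    at most m, and the entries come from the finite net \<open>E m\<close>.\<close>
  define Fin where "Fin m = {..m} \<times> (idx -` {..m} \<inter> {..\<beta>0}) \<times> {ds. set ds \<subseteq> E m \<and> length ds \<le> m}" for m
  have Fin: "finite (Fin m)" for m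
    unfolding Fin_def using E(1) idx by (intro finite_SigmaI finite_vimage_IntI finite_lists_length_le) auto
  define h where "h m = Max (insert m ((\<lambda>(C, \<beta>, ds). N C \<beta> ds) ` Fin m))" for m
  have h: "m \<le> h m" "(C, \<beta>, ds) \<in> Fin m \<Longrightarrow> N C \<beta> ds \<le> h m" for m C \<beta> ds
  proof -
    show "m \<le> h m" unfolding h_def using Fin by (intro Max_ge) auto
    assume "(C, \<beta>, ds) \<in> Fin m"
    then have "N C \<beta> ds \<in> (\<lambda>(C, \<beta>, ds). N C \<beta> ds) ` Fin m" by (rule rev_image_eqI) simp
    then show "N C \<beta> ds \<le> h m" unfolding h_def using Fin by (intro Max_ge) auto
  qed
  define \<kappa> where "\<kappa> = rec_nat (h 0) (\<lambda>_ k. h (Suc k))"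
  define mJ where "mJ J = (case J of 0 \<Rightarrow> 0 | Suc i \<Rightarrow> Suc (\<kappa> i))" for J
  have \<kappa>: "\<kappa> J = h (mJ J)" for J
    unfolding \<kappa>_def mJ_def by (cases J) simp_all
  have "\<kappa> j < \<kappa> (Suc j)" for j
    using h(1)[of "Suc (\<kappa> j)"] unfolding \<kappa>[of "Suc j"] mJ_def by simp
  then have \<kappa>_mono: "strict_mono \<kappa>" by (simp add: strict_mono_Suc_iff)
  have \<kappa>_ge: "j \<le> \<kappa> j" for j using strict_mono_imp_increasing[OF \<kappa>_mono] .
  have mJ_ge: "J \<le> mJ J" for J
    unfolding mJ_def using \<kappa>_ge by (cases J) auto
  have mJ_mono: "mJ I \<le> mJ J" if "I \<le> J" for I J
    using that strict_mono_less_eq[OF \<kappa>_mono] unfolding mJ_def by (cases I; cases J) auto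
  define W where "W j = V (\<kappa> j)" for j
  have W: "block_sequence e W" unfolding W_def by (rule block_sequence_subseq[OF V \<kappa>_mono])
  interpret W: basic_sequence W K by (rule basic_sequence_block[OF W])
  have W_low: "span (W ` {..<J}) \<subseteq> span (V ` {..<mJ J})" for J
  proof (rule span_mono, rule image_subsetI)
    fix j assume "j \<in> {..<J}"
    then obtain i where "J = Suc i" "j \<le> i" by (cases J) auto
    then have "\<kappa> j < mJ J" using strict_mono_less_eq[OF \<kappa>_mono] unfolding mJ_def by (simp add: less_Suc_eq_le)
    then show "W j \<in> V ` {..<mJ J}" unfolding W_def by blast
  qed
  have W_high: "span (W ` {J..}) \<subseteq> span (V ` {n..})" if "n \<le> \<kappa> J" for J n
  proof (rule span_mono, rule image_subsetI)
    fix j assume "j \<in> {J..}"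
    then have "n \<le> \<kappa> j" using that strict_mono_less_eq[OF \<kappa>_mono, of J j] by simp
    then show "W j \<in> V ` {n..}" unfolding W_def by blast
  qed
  obtain CT T where CT: "CT \<ge> 1" and T: "l1_tree CT (closed_span W) T"
    "\<And>xs. xs \<in> T \<Longrightarrow> block_list W xs" "deriv_iter \<beta>0 T \<noteq> {}"
    using trees[OF W] by blast
  have tree: "is_tree (closed_span W) T" using T(1) unfolding l1_tree_def by blast
  have T_ne: "xs \<noteq> []" if "xs \<in> T" for xs using tree that unfolding is_tree_def by blast
  have T_l1: "norm x = 1" "l1_lower CT xs" if "xs \<in> T" "x \<in> set xs" for xs x
  proof -
    have "\<forall>x\<in>set xs. norm x = 1" "l1_equivalent CT xs"
      using T(1) that(1) unfolding l1_tree_def by blast+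
    then show "norm x = 1" "l1_lower CT xs"
      using l1_equivalent_iff T_ne that by blast+
  qed
  \<comment> \<open>The factor 2 pays for replacing tree vectors by net vectors.\<close>
  obtain C :: nat where C: "2 * CT \<le> real C" using real_arch_simple by blast
  have C1: "C \<ge> 1" using C CT by (cases C) auto
  define J where "J xs = Max (supp W (last xs))" for xs
  have J_len: "length xs \<le> J xs" and J_span: "x \<in> set xs \<Longrightarrow> x \<in> span (W ` {..<J xs})"
    if "xs \<in> T" for xs x
    using W.block_list_bounds[OF T(2)[OF that] T_ne[OF that]] unfolding J_def by blast+
  have J_next: "x \<in> span (W ` {J xs..})" if "xs @ [x] \<in> T" "xs \<in> T" for xs x
  proof -
    have "block W x" "precedes W (last xs) x"
      using T(2)[OF that(1)] T_ne[OF that(2)] unfolding W.block_list_snoc by blast+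
    moreover have "block W (last xs)"
      using T(2)[OF that(2)] T_ne[OF that(2)] unfolding block_list_def by simp
    ultimately show ?thesis unfolding J_def by (intro W.precedes_span)
  qed
  have J_mono: "J xs \<le> J (xs @ vs)" if "xs @ vs \<in> T" "xs \<noteq> []" for xs vs
    unfolding J_def using W.block_list_Max_mono[OF T(2)[OF that(1)] that(2)] .
  have T_of_deriv: "xs \<in> T" if "xs \<in> deriv_iter \<gamma> T" "\<gamma> \<le> \<beta>0" for xs \<gamma>
  proof -
    have "\<gamma> < omega1" using that(2) \<beta>0(1) by (rule order.strict_trans1)
    then show ?thesis using that(1) deriv_iter_iff[OF tree] by blast
  qed
  let ?near = "\<lambda>xs u d. d \<in> E (mJ (J xs)) \<and> norm (u - d) < 1 / (4 * real C)"
  \<comment> \<open>\<open>us\<close> omits the skipped vectors of \<open>xs\<close>. At a limit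
    rank the current stage may still be smaller than \<open>C\<close>, because vectors can be
    skipped there; at other ranks the stage must already be large.\<close>
  have claim: "good D C Y \<beta> ds"
    if "\<beta> \<le> \<beta>0" "xs \<in> deriv_iter \<beta> T" "subseq us xs" "list_all2 (?near xs) us ds"
      "is_limit \<beta> \<or> C \<le> mJ (J xs)" "rank_bound idx (mJ (J xs)) \<beta>" for \<beta> xs us ds
    using that
  proof (induction \<beta> arbitrary: xs us ds rule: less_induct)
    case (less \<beta>)
    have \<beta>: "\<beta> < omega1" using less.prems(1) \<beta>0(1) by (rule order.strict_trans1)
    have xsT: "xs \<in> T" using T_of_deriv less.prems(1,2) by blast
    have len: "length ds \<le> mJ (J xs)"
    proof -
      have "length ds = length us" using less.prems(4) by (simp add: list_all2_lengthD)
      also have "\<dots> \<le> length xs" using less.prems(3) by (rule list_emb_length)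
      also have "\<dots> \<le> J xs" using J_len[OF xsT] .
      also have "\<dots> \<le> mJ (J xs)" by (rule mJ_ge)
      finally show ?thesis .
    qed
    have dsE: "set ds \<subseteq> E (mJ (J xs))"
      using less.prems(4) unfolding list_all2_conv_all_nth set_conv_nth by auto
    then have dsD: "ds \<in> lists D" using E(2) by blast
    have us1: "norm u = 1" if u: "u \<in> set us" for u
    proof -
      obtain v where "v \<in> set xs" "u = v" using list_emb_set[OF less.prems(3) u] by blast
      then show ?thesis using T_l1(1)[OF xsT] by blast
    qed
    have ds_norm: "\<forall>d\<in>set ds. norm d \<le> 3 / 2"
    proof
      fix d assume "d \<in> set ds"
      then obtain i where i: "i < length ds" "d = ds ! i" by (auto simp: in_set_conv_nth)
      define u where "u = us ! i"
      have u: "u \<in> set us" "norm (u - d) < 1 / (4 * real C)"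
        using less.prems(4) i unfolding list_all2_conv_all_nth u_def by auto
      have "norm d \<le> norm u + norm (u - d)" using norm_triangle_ineq4[of u "u - d"] by simp
      moreover have "1 / (4 * real C) \<le> 1 / 4" using C1 by (simp add: field_simps)
      ultimately show "norm d \<le> 3 / 2" using us1[OF u(1)] u(2) by linarith
    qed
    have ds_l1: "l1_lower (real C) ds"
    proof -
      have "l1_lower CT us"
        using l1_lower_subseq[OF _ less.prems(3)] T_l1(2)[OF xsT] T_ne[OF xsT] by (metis last_in_set)
      moreover have "list_all2 (\<lambda>d u. \<exists>t\<ge>1. norm (d - t *\<^sub>R u) \<le> (1 / (4 * real C)) * t) ds us"
        using less.prems(4) unfolding list_all2_conv_all_nth
        by (auto intro!: exI[of _ 1] simp: norm_minus_commute less_imp_le)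
      moreover have "1 / (4 * real C) * CT \<le> 1 / 2"
        using C C1 by (simp add: field_simps)
      ultimately have "l1_lower (2 * CT / 1) ds"
        using CT by (intro l1_lower_perturb[of CT us "1 / (4 * real C)"]) auto
      then show ?thesis using C by (auto intro: l1_lower_mono)
    qed
    show ?case
    proof (rule ccontr)
      assume bad: "\<not> good D C Y \<beta> ds"
      then obtain \<gamma> where \<gamma>: "\<gamma> < \<beta>" and
        \<gamma>bad: "\<And>x d. x \<in> span (V ` {N C \<beta> ds..}) \<Longrightarrow> d \<in> D \<Longrightarrow> norm (x - d) < 1 / (4 * real C) \<Longrightarrow>
          \<not> good D C Y \<gamma> (ds @ [d])"
        using wit[OF less.prems(1) dsD ds_l1 ds_norm] unfolding refuted_def by blast
      \<comment> \<open>A tree vector \<open>x\<close> beyond the threshold of the refutation, found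
        after skipping \<open>vs\<close>. Its rank may exceed the refuted \<gamma>, since goodness
        passes to smaller ranks.\<close>
      have "\<exists>\<gamma>' vs x. \<gamma> \<le> \<gamma>' \<and> \<gamma>' < \<beta> \<and> (xs @ vs) @ [x] \<in> deriv_iter \<gamma>' T \<and>
        x \<in> span (V ` {N C \<beta> ds..}) \<and> C \<le> mJ (J ((xs @ vs) @ [x])) \<and>
        rank_bound idx (mJ (J ((xs @ vs) @ [x]))) \<gamma>'"
      proof -
        consider "\<beta> = bot" | \<gamma>' where "\<gamma>' < \<beta>" "\<beta> = osuc \<gamma>'" | "is_limit \<beta>"
          using zero_succ_or_limit by blast
        then show ?thesis
        proof cases
          case 1
          then show ?thesis using \<gamma> by (metis leD bot_least)
        next
          case 2
          have \<gamma>': "\<gamma>' < omega1" using 2(1) \<beta> by (rule order.strict_trans)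
          have le: "\<gamma> \<le> \<gamma>'" using \<gamma> unfolding 2(2) less_osuc_iff[OF \<gamma>'] .
          obtain x where x: "xs @ [x] \<in> deriv_iter \<gamma>' T"
            using deriv_iter_iff[OF tree \<beta>] less.prems(2) 2(1) by blast
          have xT: "xs @ [x] \<in> T"
            using T_of_deriv[OF x] 2(1) less.prems(1) by (meson less_imp_le order.trans)
          have mle: "mJ (J xs) \<le> mJ (J (xs @ [x]))"
            by (rule mJ_mono, rule J_mono[OF xT T_ne[OF xsT]])
          have nlim: "\<not> is_limit \<beta>" using 2 is_limit_nonsucc by blast
          then have CJ: "C \<le> mJ (J xs)" using less.prems(5) by blast
          note rb = rank_bound_osucD[OF less.prems(6)[unfolded 2(2)] \<gamma>', folded 2(2)]
          \<comment> \<open>No vector is skipped here, but \<open>ds\<close> is among the positions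
            of the current stage; hence every continuation in the tree lies beyond its
            threshold.\<close>
          have "(C, \<beta>, ds) \<in> Fin (mJ (J xs))"
            unfolding Fin_def using CJ rb(2) less.prems(1) dsE len by auto
          then have "N C \<beta> ds \<le> \<kappa> (J xs)" unfolding \<kappa> by (rule h(2))
          then have "x \<in> span (V ` {N C \<beta> ds..})"
            using J_next[OF xT xsT] W_high by blast
          moreover have "rank_bound idx (mJ (J (xs @ [x]))) \<gamma>'"
            using rank_bound_mono[OF rb(1) mle] .
          ultimately show ?thesis
            using le 2(1) x CJ mle by (intro exI[of _ \<gamma>'] exI[of _ "[]"] exI[of _ x]) auto
        next
          case 3
          have \<gamma>1: "\<gamma> < omega1" using \<gamma> \<beta> by (rule order.strict_trans)
          obtain p where p: "rank_bound idx p \<gamma>" using ex_rank_bound[OF \<gamma>1] by blast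
          \<comment> \<open>Skipping M vectors brings the branch past the threshold and makes the
            stage large enough for \<open>C\<close> and for the successor steps below \<gamma>. One
            more reserved step provides \<open>x\<close>, whence the \<open>Suc M\<close>.\<close>
          define M where "M = max p (max C (N C \<beta> ds))"
          have "(osuc ^^ Suc M) \<gamma> < \<beta>" using is_limit_funpow[OF 3 \<gamma>] .
          then have "xs \<in> deriv_iter ((osuc ^^ Suc M) \<gamma>) T"
            using deriv_iter_antimono[OF tree \<beta>] less.prems(2) by (meson less_imp_le subsetD)
          then obtain ws where ws: "length ws = Suc M" "xs @ ws \<in> deriv_iter \<gamma> T"
            using deriv_iter_funpow_osuc[OF tree \<gamma>1] by blast
          then obtain vs x where vs: "ws = vs @ [x]" "length vs = M"
            by (metis length_Suc_conv_rev)
          have x: "(xs @ vs) @ [x] \<in> deriv_iter \<gamma> T" using ws(2) vs(1) by simp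
          have vsne: "xs @ vs \<noteq> []" using T_ne[OF xsT] by simp
          have \<gamma>0: "\<gamma> \<le> \<beta>0" using \<gamma> less.prems(1) by (meson less_imp_le order.trans)
          have T2: "(xs @ vs) @ [x] \<in> T" "xs @ vs \<in> T"
            using T_of_deriv[OF x \<gamma>0] T_of_deriv[OF deriv_iter_butlast[OF tree \<gamma>1 x vsne] \<gamma>0] by blast+
          have "M \<le> J (xs @ vs)" using J_len[OF T2(2)] vs(2) by simp
          moreover have "J (xs @ vs) \<le> J ((xs @ vs) @ [x])" by (rule J_mono[OF T2(1) vsne])
          ultimately have MJ: "M \<le> \<kappa> (J (xs @ vs))" "M \<le> mJ (J ((xs @ vs) @ [x]))"
            using \<kappa>_ge[of "J (xs @ vs)"] mJ_ge[of "J ((xs @ vs) @ [x])"] by linarith+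
          have "N C \<beta> ds \<le> \<kappa> (J (xs @ vs))" using MJ(1) unfolding M_def by linarith
          then have "x \<in> span (V ` {N C \<beta> ds..})"
            using J_next[OF T2] W_high by blast
          moreover have "rank_bound idx (mJ (J ((xs @ vs) @ [x]))) \<gamma>"
            by (rule rank_bound_mono[OF p]) (use MJ(2) M_def in linarith)
          moreover have "C \<le> mJ (J ((xs @ vs) @ [x]))" using MJ(2) unfolding M_def by linarith
          ultimately show ?thesis using \<gamma> x by blast
        qed
      qed
      then obtain \<gamma>' vs x where \<gamma>': "\<gamma> \<le> \<gamma>'" "\<gamma>' < \<beta>" "(xs @ vs) @ [x] \<in> deriv_iter \<gamma>' T"
        "x \<in> span (V ` {N C \<beta> ds..})" "C \<le> mJ (J ((xs @ vs) @ [x]))"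
        "rank_bound idx (mJ (J ((xs @ vs) @ [x]))) \<gamma>'" by blast
      let ?ys = "(xs @ vs) @ [x]"
      have \<gamma>'0: "\<gamma>' \<le> \<beta>0" using \<gamma>'(2) less.prems(1) by (meson less_imp_le order.trans)
      have ysT: "?ys \<in> T" using T_of_deriv[OF \<gamma>'(3) \<gamma>'0] .
      have mle: "mJ (J xs) \<le> mJ (J ?ys)"
        using J_mono[of xs "vs @ [x]"] ysT T_ne[OF xsT] by (intro mJ_mono) simp
      have "x \<in> span (V ` {..<mJ (J ?ys)})"
        using J_span[OF ysT, of x] W_low by auto
      moreover have "norm x = 1" using T_l1(1)[OF ysT] by simp
      ultimately obtain d where d: "d \<in> E0 (mJ (J ?ys))" "norm (x - d) < 1 / (4 * real (Suc (mJ (J ?ys))))"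
        using E0(3)[of x "mJ (J ?ys)"] by auto
      have "1 / (4 * real (Suc (mJ (J ?ys)))) \<le> 1 / (4 * real C)"
        using \<gamma>'(5) C1 by (intro divide_left_mono) auto
      then have dC: "norm (x - d) < 1 / (4 * real C)" using d(2) by linarith
      have dE: "d \<in> E (mJ (J ?ys))" using d(1) E(3) by blast
      have "list_all2 (?near ?ys) (us @ [x]) (ds @ [d])"
      proof (rule list_all2_appendI)
        show "list_all2 (?near ?ys) us ds"
          using less.prems(4) by (rule list_all2_mono) (use E_mono[OF mle] in blast)
        show "list_all2 (?near ?ys) [x] [d]" using dE dC by simp
      qed
      moreover have "subseq (us @ [x]) ?ys"
        by (rule list_emb_append_mono[OF list_emb_prefix[OF less.prems(3)]]) simp
      ultimately have "good D C Y \<gamma>' (ds @ [d])"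
        using less.IH[OF \<gamma>'(2) \<gamma>'0 \<gamma>'(3)] \<gamma>'(5,6) by blast
      then have "good D C Y \<gamma> (ds @ [d])" using good_mono \<gamma>'(1) by blast
      moreover have "d \<in> D" using dE E(2) by blast
      ultimately show False using \<gamma>bad[OF \<gamma>'(4)] dC by blast
    qed
  qed
  obtain xs where "xs \<in> deriv_iter \<beta>0 T" using T(3) by blast
  then have "good D C Y \<beta>0 []"
    by (rule claim[OF order.refl _ list_emb_Nil]) (use \<beta>0(2) rank_bound_limit in auto)
  then show ?thesis using C1 Y by blast
qed

text \<open>The trivial case \<open>\<xi> = 0\<close>, which is not covered above because \<open>\<omega>\<^sup>0\<close> is no limit.\<close>

lemma good_one: "\<exists>D C. C \<ge> 1 \<and> good D C e (osuc bot) []"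
proof -
  obtain D where D: "\<forall>x\<in>span (range e). \<forall>\<epsilon>>0. \<exists>d\<in>D. norm (x - d) < \<epsilon>"
    using countable_dense_span by blast
  \<comment> \<open>With constant 4 the mesh is 1/16, so a vector near a normalized one has norm at
    least 1/2, enough for a one-term estimate.\<close>
  have "good D 4 e (osuc bot) []"
  proof (rule goodI)
    fix \<gamma> Z assume \<gamma>: "\<gamma> < osuc bot" and Z: "block_sequence e Z"
    have "\<gamma> = bot" using \<gamma> unfolding less_osuc_iff[OF bot_less_omega1] by (rule le_bot)
    define x where "x = (1 / norm (Z 0)) *\<^sub>R Z 0"
    have x: "x \<in> span (range Z)" unfolding x_def by (intro span_scale span_base) simp
    have x1: "norm x = 1" unfolding x_def using block_sequenceD(2)[OF Z, of 0] by simp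
    have "x \<in> span (range e)" using x block_sequence_span[OF Z] by blast
    then obtain d where d: "d \<in> D" "norm (x - d) < 1 / (4 * real 4)"
      using D by (metis divide_pos_pos zero_less_numeral of_nat_numeral mult_pos_pos zero_less_one)
    have dn: "norm d \<le> 3 / 2" "1 / 2 \<le> norm d"
      using norm_triangle_ineq4[of x "x - d"] norm_triangle_ineq2[of x d] x1 d(2) by simp_all
    have "good D 4 e \<gamma> ([] @ [d])"
    proof (rule goodI)
      have "\<bar>r\<bar> \<le> real 4 * norm (r *\<^sub>R d)" for r
      proof -
        have "\<bar>r\<bar> * (1 / 2) \<le> \<bar>r\<bar> * norm d" using dn(2) by (intro mult_left_mono) auto
        then show ?thesis by simp
      qed
      then show "l1_lower (real 4) ([] @ [d])"
        unfolding l1_lower_def by (simp add: lessThan_Suc)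
    next
      fix \<gamma>' assume "\<gamma>' < \<gamma>"
      then show "\<exists>x\<in>span (range Z). \<exists>d'\<in>D. norm (x - d') < 1 / (4 * real 4) \<and>
        good D 4 e \<gamma>' (([] @ [d]) @ [d'])" for Z
        unfolding \<open>\<gamma> = bot\<close> by (meson leD bot_least)
    qed (use dn in simp)
    then show "\<exists>x\<in>span (range Z). \<exists>d\<in>D. norm (x - d) < 1 / (4 * real 4) \<and> good D 4 e \<gamma> ([] @ [d])"
      using x d by blast
  qed (simp_all add: l1_lower_def)
  then show ?thesis by (intro exI[of _ D] exI[of _ 4]) simp
qed

end

section \<open>From strategies to trees\<close>

text \<open>The partial sum at 1 recovers the multiple of \<open>w\<close> with norm at most
  \<open>K\<close> times that of the whole, so the remainder costs at most 1 + K; adding the two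
  contributions gives the constant.\<close>

lemma (in basic_sequence) l1_lower_Cons:
  assumes C: "C \<ge> 0" and low: "l1_lower C xs" and xs: "set xs \<subseteq> span (e ` {1..})"
    and w: "w = r *\<^sub>R e 0" "norm w = 1"
  shows "l1_lower (K + C * (1 + K)) (w # xs)"
  unfolding l1_lower_def
proof
  fix a :: "nat \<Rightarrow> real"
  define v where "v = (\<Sum>i<length xs. a (Suc i) *\<^sub>R xs ! i)"
  define u where "u = a 0 *\<^sub>R w + v"
  have v: "v \<in> span (e ` {1..})"
    unfolding v_def using xs by (intro span_sum span_scale) (auto dest: nth_mem)
  have vs: "v \<in> span (range e)" and v0: "coords e v 0 = 0"
    using span_image_iff[THEN iffD1, OF v] by force+
  have ws: "a 0 *\<^sub>R w \<in> span (range e)" unfolding w(1) by (intro span_scale span_base) simp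
  have us: "u \<in> span (range e)" unfolding u_def using ws vs by (rule span_add)
  have "coords e u 0 = a 0 * r"
    unfolding u_def w(1) scaleR_scaleR
    using vs v0 by (simp add: coords_add coords_scaleR coords_basis span_scale span_base)
  then have "(\<Sum>i<1. coords e u i *\<^sub>R e i) = a 0 *\<^sub>R w" unfolding w(1) by simp
  then have "norm (a 0 *\<^sub>R w) \<le> K * norm u"
    using sums_partial_bound[OF span_coords(2)[OF us], of 1] by simp
  then have a0: "\<bar>a 0\<bar> \<le> K * norm u" using w(2) by simp
  have "v = u - a 0 *\<^sub>R w" unfolding u_def by simp
  then have "norm v \<le> norm u + \<bar>a 0\<bar>" using norm_triangle_ineq4[of u "a 0 *\<^sub>R w"] w(2) by simp
  then have "norm v \<le> (1 + K) * norm u" using a0 by (simp add: algebra_simps)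
  then have "C * norm v \<le> C * ((1 + K) * norm u)" using C by (rule mult_left_mono)
  moreover have "(\<Sum>i<length xs. \<bar>a (Suc i)\<bar>) \<le> C * norm v"
    using low[unfolded l1_lower_def, rule_format, of "\<lambda>i. a (Suc i)"] unfolding v_def .
  ultimately have "\<bar>a 0\<bar> + (\<Sum>i<length xs. \<bar>a (Suc i)\<bar>) \<le> (K + C * (1 + K)) * norm u"
    using a0 by (simp add: algebra_simps)
  then show "(\<Sum>i<length (w # xs). \<bar>a i\<bar>) \<le>
      (K + C * (1 + K)) * norm (\<Sum>i<length (w # xs). a i *\<^sub>R (w # xs) ! i)"
    unfolding u_def v_def by (simp add: sum.lessThan_Suc_shift del: sum.lessThan_Suc)
qed

context basic_sequence
begin

text \<open>Numbers \<kappa> i code the tails that \<open>S\<close> plays. A large \<kappa> n drives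
  the minimum of the n-th answer to where the rank function still has a prescribed value; hence the
  rank of the set of minima is a lower bound for the number of derivations that a play, prefixed by
  \<open>w\<close>, survives.\<close>

lemma V_wins_imp_less_I_b:
  assumes \<phi>: "fundamental_sequences \<phi>" and \<zeta>: "\<zeta> < omega1" and C: "C \<ge> 1"
    and win: "V_wins \<phi> e \<zeta> C" and y: "block_sequence e y"
  shows "opow omega \<zeta> < I_b y"
proof -
  interpret Y: basic_sequence y K by (rule basic_sequence_block[OF y])
  define S where "S = schreier \<phi> \<zeta>"
  obtain rk where S: "hereditary S" "rank_function S rk (opow omega \<zeta>)"
    using schreier_properties[OF \<phi> \<zeta>] unfolding S_def by blast
  have \<omega>: "opow omega \<zeta> < omega1" by (rule opow_omega_less_omega1[OF \<zeta>])
  \<comment> \<open>The shift by one keeps \<open>y 0\<close> free for the additional vector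
    \<open>w\<close>.\<close>
  define Z where "Z k = closed_span (\<lambda>i. y (Suc k + i))" for k
  have tail: "block_sequence e (\<lambda>i. y (Suc k + i))" for k by (rule block_sequence_shift[OF y])
  have Zsub: "block_subspace e (Z k)" for k
    unfolding block_subspace_def Z_def using tail by blast
  have Zblock: "x \<in> span (y ` {Suc k..})" "k < p"
    if xZ: "x \<in> Z k" "block e x" and p: "p \<in> supp e x" for x k p
  proof -
    have x: "x \<in> span (range (\<lambda>i. y (Suc k + i)))"
      using closed_span_block_span[OF tail] xZ unfolding Z_def block_iff by blast
    then show "x \<in> span (y ` {Suc k..})"
      by (rule subsetD[OF span_mono, rotated]) auto
    obtain i where "p \<in> supp e (y (Suc k + i))"
      using p unfolding supp_block_combination[OF tail x] by blast
    then show "k < p" using block_sequenceD(6)[OF y] by fastforce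
  qed
  obtain \<sigma> where \<sigma>: "\<And>Z. (\<forall>i. block_subspace e (Z i)) \<Longrightarrow>
    (let x = (\<lambda>i. \<sigma> (map Z [0..<Suc i])) in
       \<exists>k. (\<forall>i<k. x i \<in> Z i \<and> block e (x i) \<and> norm (x i) = 1) \<and>
         l1_equivalent C (map x [0..<k]) \<and> maximal_admissible \<phi> e \<zeta> (map x [0..<k]))"
    using win unfolding V_wins_def by blast
  define x where "x \<kappa> i = \<sigma> (map (\<lambda>j. Z (\<kappa> j)) [0..<Suc i])" for \<kappa> i
  define mins where "mins \<kappa> n = (\<lambda>i. Min (supp e (x \<kappa> i))) ` {..<n}" for \<kappa> n
  have mins_set: "(\<lambda>v. Min (supp e v)) ` set (map (x \<kappa>) [0..<n]) = mins \<kappa> n" for \<kappa> n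
    unfolding mins_def by (simp add: image_image atLeast0LessThan)
  \<comment> \<open>The part of the winning condition that initial segments of a play inherit;
    maximality holds only at the end.\<close>
  define legit where "legit \<kappa> n \<longleftrightarrow> (\<forall>i<n. x \<kappa> i \<in> Z (\<kappa> i) \<and> norm (x \<kappa> i) = 1) \<and>
    block_list e (map (x \<kappa>) [0..<n]) \<and> l1_lower C (map (x \<kappa>) [0..<n]) \<and> mins \<kappa> n \<in> S" for \<kappa> n
  have wins: "\<exists>k. legit \<kappa> k \<and> (\<forall>G\<in>S. \<not> mins \<kappa> k \<subset> G)" for \<kappa>
  proof -
    obtain k where k: "\<forall>i<k. x \<kappa> i \<in> Z (\<kappa> i) \<and> block e (x \<kappa> i) \<and> norm (x \<kappa> i) = 1"
      "l1_equivalent C (map (x \<kappa>) [0..<k])" "maximal_admissible \<phi> e \<zeta> (map (x \<kappa>) [0..<k])"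
      using \<sigma>[of "\<lambda>j. Z (\<kappa> j)"] Zsub unfolding Let_def x_def by blast
    have "l1_lower C (map (x \<kappa>) [0..<k])"
    proof (cases "k = 0")
      case True
      then show ?thesis by (simp add: l1_lower_def)
    next
      case False
      then show ?thesis using k(1,2) l1_equivalent_iff[of "map (x \<kappa>) [0..<k]" C] by auto
    qed
    then show ?thesis
      using k(1,3) unfolding legit_def maximal_admissible_def schreier_maximal_def mins_set S_def
      by blast
  qed
  define w where "w = (1 / norm (y 0)) *\<^sub>R y 0"
  have w1: "norm w = 1" unfolding w_def using block_sequenceD(2)[OF y, of 0] by simp
  have wb: "block y w"
    unfolding Y.block_iff w_def using block_sequenceD(2)[OF y, of 0] by (simp add: span_scale span_base)
  define C' where "C' = K + C * (1 + K)"
  have C': "C' \<ge> 1" unfolding C'_def using K_ge_1 C by (simp add: add_increasing2)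
  define T where "T = {xs. xs \<noteq> [] \<and> block_list y xs \<and> (\<forall>v\<in>set xs. norm v = 1) \<and> l1_lower C' xs}"
  have T_sub: "set xs \<subseteq> closed_span y" if "xs \<in> T" for xs
    using that unfolding T_def block_list_def block_def by blast
  have tree: "is_tree (closed_span y) T"
    unfolding is_tree_def
  proof (intro conjI allI impI)
    show "T \<subseteq> {xs. xs \<noteq> [] \<and> set xs \<subseteq> closed_span y}" using T_sub unfolding T_def by blast
    fix xs v assume *: "xs \<noteq> [] \<and> xs @ [v] \<in> T"
    then have "l1_lower C' (xs @ [v])" unfolding T_def by blast
    then have "l1_lower C' xs" by (rule l1_lower_subseq) auto
    then show "xs \<in> T" using * unfolding T_def by (auto simp: Y.block_list_snoc)
  qed
  have "l1_tree C' (closed_span y) T"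
    unfolding l1_tree_def using tree l1_equivalent_iff unfolding T_def by blast
  then have T_le: "tree_order T \<le> I_b y"
    unfolding I_b_def using C' by (intro Sup_upper) (auto simp: T_def)
  have inT: "w # map (x \<kappa>) [0..<n] \<in> T" if legit: "legit \<kappa> n" for \<kappa> n
  proof -
    let ?xs = "map (x \<kappa>) [0..<n]"
    have bl: "block_list e ?xs" and low: "l1_lower C ?xs" and norm1: "\<forall>v\<in>set ?xs. norm v = 1"
      using legit unfolding legit_def by auto
    have sp: "v \<in> span (y ` {1..})" and yb: "block y v" if v: "v \<in> set ?xs" for v
    proof -
      obtain i where i: "i < n" "v = x \<kappa> i" using v by auto
      have b: "block e v" using bl v unfolding block_list_def by blast
      then obtain p where "p \<in> supp e v" using supp_nonempty unfolding block_iff by blast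
      then have "v \<in> span (y ` {Suc (\<kappa> i)..})"
        using Zblock(1) b legit i unfolding legit_def by blast
      then show s: "v \<in> span (y ` {1..})" by (rule subsetD[OF span_mono, rotated]) auto
      show "block y v"
        using b span_mono[of "y ` {1..}" "range y"] s unfolding Y.block_iff block_iff by blast
    qed
    have "successively (precedes y) ?xs"
    proof (rule successively_mono)
      show "successively (precedes e) ?xs" using bl unfolding block_list_def by blast
      show "precedes y u v" if "u \<in> set ?xs" "v \<in> set ?xs" "precedes e u v" for u v
        using precedes_block_iff[OF y yb yb] that by blast
    qed
    moreover have "precedes y w v" if "v \<in> set ?xs" for v
    proof -
      have "p < q" if p: "p \<in> supp y w" and q: "q \<in> supp y v" for p q
      proof -
        have "supp y w = supp y (y 0)"
          unfolding w_def using block_sequenceD(2)[OF y, of 0] by (intro Y.supp_scaleR span_base) auto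
        then have "p = 1" using p unfolding supp_def by (auto simp: Y.coords_basis)
        obtain j where j: "q = Suc j" "coords y v j \<noteq> 0" using q unfolding supp_def by blast
        then have "j \<in> {1..}"
          using Y.span_image_iff[THEN iffD1, OF sp[OF \<open>v \<in> set ?xs\<close>]] by blast
        then show ?thesis using \<open>p = 1\<close> j(1) by simp
      qed
      then show ?thesis using Y.precedes_iff[OF wb yb[OF that]] by blast
    qed
    ultimately have "successively (precedes y) (w # ?xs)"
      unfolding successively_Cons by (metis hd_in_set)
    then have "block_list y (w # ?xs)"
      unfolding block_list_def using wb yb by auto
    moreover have "l1_lower C' (w # ?xs)"
      unfolding C'_def using C low sp w1 by (intro Y.l1_lower_Cons[OF _ _ _ w_def]) auto
    ultimately show ?thesis unfolding T_def using w1 norm1 by simp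
  qed
  \<comment> \<open>\<kappa> varies in the induction, because each step changes the move of
    \<open>S\<close> at n; the earlier answers do not depend on that move.\<close>
  have claim: "w # map (x \<kappa>) [0..<n] \<in> deriv_iter \<beta> T"
    if "legit \<kappa> n" "\<beta> \<le> rk (mins \<kappa> n)" "\<beta> < omega1" for \<beta> \<kappa> n
    using that
  proof (induction \<beta> arbitrary: \<kappa> n rule: less_induct)
    case (less \<beta>)
    have "\<exists>v. (w # map (x \<kappa>) [0..<n]) @ [v] \<in> deriv_iter \<gamma> T" if \<gamma>: "\<gamma> < \<beta>" for \<gamma>
    proof -
      have FS: "mins \<kappa> n \<in> S" using less.prems(1) unfolding legit_def by blast
      have "\<gamma> < rk (mins \<kappa> n)" using \<gamma> less.prems(2) by (rule order.strict_trans2)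
      then obtain n0 where n0: "\<And>k. k \<ge> n0 \<Longrightarrow> insert k (mins \<kappa> n) \<in> S \<and> \<gamma> \<le> rk (insert k (mins \<kappa> n))"
        using rank_functionD(3)[OF S(2) FS] by blast
      have "finite (mins \<kappa> n)" unfolding mins_def by simp
      then obtain b where b: "\<forall>k\<in>mins \<kappa> n. k < b" unfolding finite_nat_set_iff_bounded ..
      define \<kappa>' where "\<kappa>' = \<kappa>(n := max n0 b)"
      have same: "x \<kappa>' i = x \<kappa> i" if "i < n" for i
        unfolding x_def \<kappa>'_def using that by (intro arg_cong[of _ _ \<sigma>] map_cong) auto
      have mins': "mins \<kappa>' n = mins \<kappa> n" unfolding mins_def using same by auto
      obtain k where k: "legit \<kappa>' k" "\<forall>G\<in>S. \<not> mins \<kappa>' k \<subset> G" using wins by blast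
      \<comment> \<open>The play cannot have stopped by move n: \<open>max n0 b\<close> could still
        be added to the minima, contrary to maximality.\<close>
      have "n < k"
      proof (rule ccontr)
        assume "\<not> n < k"
        then have sub: "mins \<kappa>' k \<subseteq> mins \<kappa> n"
          unfolding mins'[symmetric] unfolding mins_def by (intro image_mono) auto
        have "insert (max n0 b) (mins \<kappa> n) \<in> S" using n0[of "max n0 b"] by simp
        moreover have "max n0 b \<notin> mins \<kappa> n" using b by fastforce
        ultimately show False using k(2) sub by blast
      qed
      have split: "[0..<k] = [0..<Suc n] @ [Suc n..<k]"
        using \<open>n < k\<close> upt_add_eq_append[of 0 "Suc n" "k - Suc n"] by simp
      have bl: "block_list e (map (x \<kappa>') [0..<k])" using k(1) unfolding legit_def by blast
      have legit': "legit \<kappa>' (Suc n)"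
        unfolding legit_def
      proof (intro conjI)
        show "\<forall>i<Suc n. x \<kappa>' i \<in> Z (\<kappa>' i) \<and> norm (x \<kappa>' i) = 1"
          using k(1) \<open>n < k\<close> unfolding legit_def by auto
        show "block_list e (map (x \<kappa>') [0..<Suc n])"
          using bl unfolding split map_append block_list_def successively_append_iff set_append by blast
        have "l1_lower C (map (x \<kappa>') [0..<k])" using k(1) unfolding legit_def by blast
        then show "l1_lower C (map (x \<kappa>') [0..<Suc n])"
          by (rule l1_lower_subseq) (unfold split map_append, rule list_emb_prefix, simp)
        have "mins \<kappa>' (Suc n) \<subseteq> mins \<kappa>' k" unfolding mins_def using \<open>n < k\<close> by (intro image_mono) auto
        then show "mins \<kappa>' (Suc n) \<in> S"
          using k(1) hereditaryD(3)[OF S(1)] unfolding legit_def by blast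
      qed
      define q where "q = Min (supp e (x \<kappa>' n))"
      have "block e (x \<kappa>' n)" using bl \<open>n < k\<close> unfolding block_list_def by simp
      then have q: "q \<in> supp e (x \<kappa>' n)"
        unfolding q_def using finite_supp supp_nonempty unfolding block_iff by (intro Min_in) blast+
      have "x \<kappa>' n \<in> Z (\<kappa>' n)" using legit' unfolding legit_def by blast
      then have "\<kappa>' n < q" using Zblock(2) \<open>block e (x \<kappa>' n)\<close> q by blast
      then have "max n0 b < q" unfolding \<kappa>'_def by simp
      then have "n0 \<le> q" by simp
      moreover have "mins \<kappa>' (Suc n) = insert q (mins \<kappa> n)"
        unfolding mins'[symmetric] unfolding mins_def q_def by (simp add: lessThan_Suc)
      ultimately have "\<gamma> \<le> rk (mins \<kappa>' (Suc n))" using n0 by simp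
      moreover have "\<gamma> < omega1" using \<gamma> less.prems(3) by (rule order.strict_trans)
      ultimately have "w # map (x \<kappa>') [0..<Suc n] \<in> deriv_iter \<gamma> T"
        using less.IH[OF \<gamma> legit'] by blast
      moreover have "map (x \<kappa>') [0..<n] = map (x \<kappa>) [0..<n]" using same by simp
      ultimately show ?thesis by (intro exI[of _ "x \<kappa>' n"]) simp
    qed
    then show ?case
      using deriv_iter_iff[OF tree less.prems(3)] inT[OF less.prems(1)] by blast
  qed
  have "legit (\<lambda>_. 0) 0"
    unfolding legit_def mins_def using hereditaryD(1)[OF S(1)]
    by (simp add: block_list_def l1_lower_def)
  moreover have "opow omega \<zeta> \<le> rk (mins (\<lambda>_. 0) 0)"
    unfolding mins_def using rank_functionD(1)[OF S(2)] by simp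
  ultimately have "deriv_iter (opow omega \<zeta>) T \<noteq> {}"
    using claim[OF _ _ \<omega>, of "\<lambda>_. 0" 0] by blast
  then have "opow omega \<zeta> < tree_order T"
    using less_tree_order_iff[OF tree \<omega>] by blast
  then show ?thesis using T_le by (rule order.strict_trans2)
qed

section \<open>From good positions to strategies\<close>

text \<open>By the invariant \<open>inv\<close>, the answers stay near multiples of the entries of a
  position that is good at the rank of their minima. This rank drops at each move, so the play ends;
  and it can end only at a maximal set, because a nonmaximal one admits all large n.\<close>

lemma good_imp_V_wins:
  assumes \<phi>: "fundamental_sequences \<phi>" and \<zeta>: "\<zeta> < omega1"
    and y: "block_sequence e y" and C: "C \<ge> 1" and good: "good D C y (opow omega \<zeta>) []"
  shows "V_wins \<phi> y \<zeta> (4 * real C)"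
proof -
  interpret Y: basic_sequence y K by (rule basic_sequence_block[OF y])
  define S where "S = schreier \<phi> \<zeta>"
  obtain rk where S: "hereditary S" "spreading S" "rank_function S rk (opow omega \<zeta>)"
    using schreier_properties[OF \<phi> \<zeta>] unfolding S_def by blast
  define mins where "mins xs = (\<lambda>x. Min (supp y x)) ` set xs" for xs
  define \<delta> where "\<delta> = 1 / (4 * real C)"
  have \<delta>: "0 < \<delta>" "\<delta> \<le> 1 / 4" unfolding \<delta>_def using C by (simp_all add: field_simps)
  define near where "near x d \<longleftrightarrow> (\<exists>t\<ge>1/2. norm (x - t *\<^sub>R d) \<le> (2 * \<delta>) * t)" for x d :: 'a
  define inv where "inv xs ds \<longleftrightarrow> block_list y xs \<and> (\<forall>x\<in>set xs. norm x = 1) \<and> mins xs \<in> S \<and>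
    good D C y (rk (mins xs)) ds \<and> list_all2 near xs ds" for xs ds
  have step: "\<exists>x d. x \<in> Zs \<and> inv (xs @ [x]) (ds @ [d]) \<and> rk (mins (xs @ [x])) < rk (mins xs)"
    if inv: "inv xs ds" and nonmax: "\<not> schreier_maximal \<phi> \<zeta> (mins xs)" and Zs: "block_subspace y Zs"
    for xs ds Zs
  proof -
    obtain z where z: "block_sequence y z" "Zs = closed_span z"
      using Zs unfolding block_subspace_def by blast
    have ze: "block_sequence e z" by (rule block_sequence_trans[OF y z(1)])
    have F: "mins xs \<in> S" and bl: "block_list y xs" using inv unfolding inv_def by blast+
    obtain G where "G \<in> S" "mins xs \<subset> G"
      using nonmax F unfolding schreier_maximal_def S_def by blast
    then obtain n0 where n0: "\<And>n. n \<ge> n0 \<Longrightarrow> insert n (mins xs) \<in> S"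
      using nonmaximal_insert[OF S(1,2)] by blast
    define b where "b = (if xs = [] then 0 else Max (supp y (last xs)))"
    have F_le: "q \<le> b" if q: "q \<in> mins xs" for q
    proof -
      obtain v where v: "v \<in> set xs" "q = Min (supp y v)" using q unfolding mins_def by blast
      then have ne: "xs \<noteq> []" by auto
      have vb: "block y v" using bl v(1) unfolding block_list_def by blast
      then have "q \<in> supp y v"
        unfolding v(2) using Y.finite_supp Y.supp_nonempty unfolding Y.block_iff by (intro Min_in) blast+
      then obtain j where j: "q = Suc j" "coords y v j \<noteq> 0" unfolding supp_def by blast
      have "v \<in> span (y ` {..<b})"
        using Y.block_list_bounds[OF bl ne] v(1) ne unfolding b_def by simp
      then have "j < b" using Y.span_image_iff[THEN iffD1, of v "{..<b}"] j(2) by blast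
      then show ?thesis using j(1) by simp
    qed
    \<comment> \<open>\<open>z k\<close> lies beyond position k, so its first position may be
      inserted into the minima and follows all of \<open>xs\<close>.\<close>
    define k where "k = max n0 b"
    define n where "n = Min (supp y (z k))"
    have zk: "z k \<in> span (range y)" "z k \<noteq> 0" using Y.block_sequenceD(1,2)[OF z(1)] by blast+
    have n_in: "n \<in> supp y (z k)"
      unfolding n_def using Y.finite_supp Y.supp_nonempty zk by (intro Min_in) blast+
    have n_le: "n \<le> p" if "p \<in> supp y (z k)" for p
      unfolding n_def using Y.finite_supp[OF zk(1)] that by (rule Min_le)
    have "k < n" using Y.block_sequenceD(6)[OF z(1) n_in] .
    then have nn0: "n0 \<le> n" and nb: "b < n" unfolding k_def by auto
    have nF: "\<forall>q\<in>mins xs. q < n" using F_le nb by fastforce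
    have Fn: "insert n (mins xs) \<in> S" using n0 nn0 by blast
    have rk_less: "rk (insert n (mins xs)) < rk (mins xs)"
      using rank_functionD(2)[OF S(3) Fn nF] .
    \<comment> \<open>Searching beyond \<open>z k\<close> ensures that the continuation cannot
      cancel the coordinate at n.\<close>
    define z' where "z' i = z (Suc k + i)" for i
    have z': "block_sequence y z'" unfolding z'_def by (rule Y.block_sequence_shift[OF z(1)])
    have zy: "range z' \<subseteq> span (range y)" using Y.block_sequenceD(1)[OF z'] by blast
    have "\<exists>x\<in>span (range z'). \<exists>d\<in>D. norm (x - d) < 1 / (4 * real C) \<and>
        good D C y (rk (insert n (mins xs))) (ds @ [d])"
      using goodD(3)[OF _ rk_less block_sequence_trans[OF y z'] almost_subI[OF zy]] inv
      unfolding inv_def by blast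
    then obtain x' d where x': "x' \<in> span (range z')" and d: "d \<in> D" "norm (x' - d) < \<delta>"
      and gd: "good D C y (rk (insert n (mins xs))) (ds @ [d])" unfolding \<delta>_def by blast
    \<comment> \<open>The correction has norm \<delta>, as large as the approximation error. The
      total 2\<delta> is what \<open>l1_lower_perturb\<close> tolerates.\<close>
    define \<epsilon> where "\<epsilon> = \<delta> / norm (z k)"
    have \<epsilon>: "\<epsilon> > 0" "norm (\<epsilon> *\<^sub>R z k) = \<delta>" unfolding \<epsilon>_def using \<delta>(1) zk(2) by auto
    define v where "v = x' + \<epsilon> *\<^sub>R z k"
    have x'y: "x' \<in> span (range y)"
      using x' span_minimal[OF zy subspace_span] by blast
    have vy: "v \<in> span (range y)" unfolding v_def using x'y zk(1) by (intro span_add span_scale)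
    have v_co: "coords y v j = coords y x' j + \<epsilon> * coords y (z k) j" for j
      unfolding v_def using x'y zk(1) by (simp add: Y.coords_add Y.coords_scaleR span_scale)
    have x'_gt: "n < q" if q: "q \<in> supp y x'" for q
    proof -
      obtain i where "q \<in> supp y (z (Suc k + i))"
        using q unfolding Y.supp_block_combination[OF z' x'] z'_def by blast
      then show ?thesis using Y.block_sequenceD(5)[OF z(1) _ n_in, of "Suc k + i"] by simp
    qed
    have n_supp: "n \<in> supp y v"
    proof -
      obtain j where j: "n = Suc j" "coords y (z k) j \<noteq> 0" using n_in unfolding supp_def by blast
      have "coords y x' j = 0"
      proof (rule ccontr)
        assume "coords y x' j \<noteq> 0"
        then have "n \<in> supp y x'" unfolding supp_def j(1) by blast
        then show False using x'_gt by blast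
      qed
      then show ?thesis unfolding supp_def using v_co j \<epsilon>(1) by simp
    qed
    have supp_ge: "n \<le> q" if q: "q \<in> supp y v" for q
    proof -
      obtain j where j: "q = Suc j" "coords y v j \<noteq> 0" using q unfolding supp_def by blast
      then have "coords y x' j \<noteq> 0 \<or> coords y (z k) j \<noteq> 0" unfolding v_co by auto
      then have "q \<in> supp y x' \<or> q \<in> supp y (z k)" unfolding supp_def j(1) by blast
      then show ?thesis using x'_gt n_le by (meson less_imp_le)
    qed
    have v0: "v \<noteq> 0" using n_supp unfolding supp_def by (auto simp: Y.coords_zero)
    define t where "t = 1 / norm v"
    define x where "x = t *\<^sub>R v"
    have x1: "norm x = 1" unfolding x_def t_def using v0 by simp
    have supp_x: "supp y x = supp y v" unfolding x_def t_def using v0 by (intro Y.supp_scaleR[OF vy]) simp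
    have xb: "block y x"
      unfolding Y.block_iff using vy x1 by (auto simp: x_def span_scale)
    have min_x: "Min (supp y x) = n"
      unfolding supp_x using Y.finite_supp[OF vy] n_supp supp_ge by (intro Min_eqI) auto
    have "xs = [] \<or> precedes y (last xs) x"
      using nb unfolding precedes_def min_x b_def by (auto split: if_splits)
    then have bl': "block_list y (xs @ [x])"
      unfolding Y.block_list_snoc using bl xb by blast
    have mins': "mins (xs @ [x]) = insert n (mins xs)" unfolding mins_def using min_x by simp
    have nx: "near x d"
      unfolding near_def
    proof (intro exI conjI)
      have vd: "norm (v - d) \<le> 2 * \<delta>"
        using norm_triangle_ineq[of "x' - d" "\<epsilon> *\<^sub>R z k"] d(2) \<epsilon>(2) unfolding v_def by (simp add: algebra_simps)
      have "norm d \<le> 3 / 2" using goodD(2)[OF gd] by simp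
      then have "norm v \<le> 2" using norm_triangle_ineq[of d "v - d"] vd \<delta>(2) by simp
      then show "1 / 2 \<le> t" unfolding t_def using v0 by (simp add: field_simps)
      have "norm (x - t *\<^sub>R d) = t * norm (v - d)"
        unfolding x_def by (simp add: t_def flip: scaleR_diff_right)
      also have "\<dots> \<le> t * (2 * \<delta>)" using vd by (intro mult_left_mono) (simp_all add: t_def)
      finally show "norm (x - t *\<^sub>R d) \<le> (2 * \<delta>) * t" by (simp add: mult.commute)
    qed
    have "inv (xs @ [x]) (ds @ [d])"
      using inv bl' x1 Fn gd nx unfolding inv_def mins' by (auto intro: list_all2_appendI)
    moreover have "x \<in> Zs"
    proof -
      have "range z' \<subseteq> range z" unfolding z'_def by auto
      then have "x' \<in> span (range z)" using x' span_mono by blast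
      then have "x \<in> span (range z)"
        unfolding x_def v_def using span_base[OF rangeI, of z k] by (intro span_scale span_add)
      then show ?thesis unfolding z(2) closed_span_def using closure_subset by blast
    qed
    ultimately show ?thesis using rk_less mins' by auto
  qed
  \<comment> \<open>The approximating position is a memory of the strategy; \<open>foldl\<close>
    reconstructs it from the moves of \<open>S\<close>.\<close>
  define pick where "pick s Zs = (SOME (x, d). x \<in> Zs \<and> inv (fst s @ [x]) (snd s @ [d]) \<and>
    rk (mins (fst s @ [x])) < rk (mins (fst s)))" for s :: "'a list \<times> 'a list" and Zs
  define move where "move s Zs = (fst s @ [fst (pick s Zs)], snd s @ [snd (pick s Zs)])" for s Zs
  define \<sigma> where "\<sigma> Zs = last (fst (foldl move ([], []) Zs))" for Zs
  have "\<exists>k. (\<forall>i<k. \<sigma> (map Z [0..<Suc i]) \<in> Z i \<and> block y (\<sigma> (map Z [0..<Suc i])) \<and>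
      norm (\<sigma> (map Z [0..<Suc i])) = 1) \<and>
    l1_equivalent (4 * real C) (map (\<lambda>i. \<sigma> (map Z [0..<Suc i])) [0..<k]) \<and>
    maximal_admissible \<phi> y \<zeta> (map (\<lambda>i. \<sigma> (map Z [0..<Suc i])) [0..<k])"
    if Z: "\<forall>i. block_subspace y (Z i)" for Z
  proof -
    define X where "X k = foldl move ([], []) (map Z [0..<k])" for k
    have X: "X 0 = ([], [])" "X (Suc k) = move (X k) (Z k)" for k
      unfolding X_def by simp_all
    define x where "x i = \<sigma> (map Z [0..<Suc i])" for i
    have x: "x i = fst (pick (X i) (Z i))" for i
      unfolding x_def \<sigma>_def X_def[symmetric] X(2) move_def by simp
    have fst_X: "fst (X k) = map x [0..<k]" for k
      by (induction k) (simp_all add: X move_def x)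
    define stop where "stop k \<longleftrightarrow> schreier_maximal \<phi> \<zeta> (mins (fst (X k)))" for k
    have pick: "x k \<in> Z k \<and> inv (fst (X (Suc k))) (snd (X (Suc k))) \<and>
      rk (mins (fst (X (Suc k)))) < rk (mins (fst (X k)))"
      if "inv (fst (X k)) (snd (X k))" "\<not> stop k" for k
    proof -
      have "\<exists>xd. case xd of (x, d) \<Rightarrow> x \<in> Z k \<and> inv (fst (X k) @ [x]) (snd (X k) @ [d]) \<and>
        rk (mins (fst (X k) @ [x])) < rk (mins (fst (X k)))"
        using step[OF that(1) that(2)[unfolded stop_def]] Z by auto
      from someI_ex[OF this] show ?thesis
        unfolding x X(2) move_def pick_def[symmetric] by (simp add: case_prod_beta)
    qed
    have inv0: "inv (fst (X 0)) (snd (X 0))"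
      unfolding inv_def X(1) mins_def
      using hereditaryD(1)[OF S(1)] rank_functionD(1)[OF S(3)] good by (simp add: block_list_def)
    have invk: "inv (fst (X k)) (snd (X k))" if "\<forall>i<k. \<not> stop i" for k
      using that
    proof (induction k)
      case (Suc k)
      then show ?case using pick[of k] by simp
    qed (rule inv0)
    have "\<exists>k. stop k"
    proof (rule ccontr)
      assume never: "\<nexists>k. stop k"
      then have "\<forall>k. (rk (mins (fst (X (Suc k)))), rk (mins (fst (X k)))) \<in> {(\<alpha>, \<beta>). \<alpha> < \<beta>}"
        using pick invk by blast
      then have "\<exists>f. \<forall>k. (f (Suc k), f k) \<in> {(\<alpha>::ordinal, \<beta>). \<alpha> < \<beta>}"
        by (rule exI[of _ "\<lambda>k. rk (mins (fst (X k)))"])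
      then show False
        using wf[where 'a=ordinal] unfolding wf_iff_no_infinite_down_chain by blast
    qed
    then obtain k where k: "stop k" "\<And>i. i < k \<Longrightarrow> \<not> stop i"
      using exists_least_iff[of stop] by blast
    have inv: "inv (fst (X i)) (snd (X i))" if "i \<le> k" for i
      using invk[of i] k(2) that by simp
    have xZ: "x i \<in> Z i" if "i < k" for i
      using pick[OF inv k(2)] that by simp
    \<comment> \<open>The empty set has positive rank, hence is not maximal; so the play contains a
      vector, as \<open>l1_equivalent_iff\<close> requires.\<close>
    have "fst (X k) \<noteq> []"
    proof
      assume "fst (X k) = []"
      then have max: "schreier_maximal \<phi> \<zeta> {}" using k(1) unfolding stop_def mins_def by simp
      have "bot < rk {}" using rank_functionD(1)[OF S(3)] opow_omega_pos[OF \<zeta>] by (simp only:)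
      then obtain n where "insert n {} \<in> S"
        using rank_functionD(3)[OF S(3) hereditaryD(1)[OF S(1)]] by blast
      then show False using max unfolding schreier_maximal_def S_def by blast
    qed
    moreover have "l1_lower (4 * real C) (fst (X k))"
    proof -
      have "list_all2 (\<lambda>x d. \<exists>t\<ge>1/2. norm (x - t *\<^sub>R d) \<le> (2 * \<delta>) * t) (fst (X k)) (snd (X k))"
        using inv[of k] unfolding inv_def near_def by blast
      moreover have "l1_lower (real C) (snd (X k))"
        using inv[of k] goodD(1) unfolding inv_def by blast
      moreover have "(2 * \<delta>) * real C \<le> 1 / 2" unfolding \<delta>_def using C by simp
      ultimately have "l1_lower (2 * real C / (1 / 2)) (fst (X k))"
        using C by (intro l1_lower_perturb) auto
      then show ?thesis by simp
    qed
    ultimately have "l1_equivalent (4 * real C) (map x [0..<k])"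
      using inv[of k] l1_equivalent_iff unfolding inv_def fst_X by blast
    moreover have "maximal_admissible \<phi> y \<zeta> (map x [0..<k])"
      using inv[of k] k(1) unfolding maximal_admissible_def inv_def stop_def mins_def fst_X by blast
    moreover have "block y (x i) \<and> norm (x i) = 1" if "i < k" for i
      using inv[of k] that unfolding inv_def block_list_def fst_X by simp
    ultimately show ?thesis using xZ unfolding x_def by blast
  qed
  then show ?thesis
    unfolding V_wins_def Let_def by (intro exI[of _ \<sigma>]) blast
qed

end

theorem proposition3p4:
  fixes e :: "nat \<Rightarrow> 'a::banach"
    and \<phi> :: "ordinal \<Rightarrow> nat \<Rightarrow> ordinal"
    and \<xi> :: ordinal
  assumes "schauder_basis e"
    and "fundamental_sequences \<phi>"
    and "\<xi> < omega1"
  shows "(I_hs \<phi> e > \<xi> \<longrightarrow> I_hb e > opow omega \<xi>) \<and>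
         (I_hb e > opow omega \<xi> \<longrightarrow> (\<exists>y. block_sequence e y \<and> I_hs \<phi> y > \<xi>))"
proof -
  obtain K where "basic_sequence e K"
    using schauder_basis_imp_basic_sequence[OF assms(1)] by blast
  then interpret basic_sequence e K .
  have \<omega>: "opow omega \<xi> < omega1" by (rule opow_omega_less_omega1[OF assms(3)])
  show ?thesis
  proof (intro conjI impI)
    assume "I_hs \<phi> e > \<xi>"
    then obtain \<eta> where \<eta>: "\<xi> < \<eta>" "\<forall>\<zeta><\<eta>. \<exists>C\<ge>1. V_wins \<phi> e \<zeta> C"
      unfolding I_hs_def less_Sup_iff by blast
    then obtain C where C: "C \<ge> 1" "V_wins \<phi> e \<xi> C" by blast
    have "{I_b y | y. block_sequence e y} \<noteq> {}" using block_sequence_basis by blast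
    then have "I_hb e \<in> {I_b y | y. block_sequence e y}"
      unfolding I_hb_def by (rule Inf_ordinal_mem)
    then obtain y where "block_sequence e y" "I_hb e = I_b y" by blast
    then show "I_hb e > opow omega \<xi>"
      using V_wins_imp_less_I_b[OF assms(2,3) C] by simp
  next
    assume hb: "I_hb e > opow omega \<xi>"
    have trees: "\<exists>C\<ge>1. \<exists>T. l1_tree C (closed_span y) T \<and> (\<forall>xs\<in>T. block_list y xs) \<and>
      deriv_iter (opow omega \<xi>) T \<noteq> {}" if y: "block_sequence e y" for y
    proof -
      have "I_hb e \<le> I_b y" unfolding I_hb_def using y by (intro Inf_lower) blast
      with hb have "opow omega \<xi> < I_b y" by (rule order.strict_trans2)
      then obtain T C where T: "C \<ge> 1" "l1_tree C (closed_span y) T" "\<forall>xs\<in>T. block_list y xs"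
        "opow omega \<xi> < tree_order T"
        unfolding I_b_def less_Sup_iff by blast
      have "is_tree (closed_span y) T" using T(2) unfolding l1_tree_def by blast
      then have "deriv_iter (opow omega \<xi>) T \<noteq> {}"
        using less_tree_order_iff[OF _ \<omega>] T(4) by blast
      then show ?thesis using T(1-3) by blast
    qed
    have "\<exists>D C Y. C \<ge> 1 \<and> block_sequence e Y \<and> good D C Y (opow omega \<xi>) []"
    proof (cases "\<xi> = bot")
      case True
      then show ?thesis using good_one block_sequence_basis by (auto simp: opow_rec(1))
    next
      case False
      show ?thesis by (rule tree_imp_good[OF \<omega> is_limit_opow_omega[OF assms(3) False] trees])
    qed
    then obtain D C Y where Y: "C \<ge> 1" "block_sequence e Y" "good D C Y (opow omega \<xi>) []" by blast
    \<comment> \<open>Including \<zeta> = \<xi> makes \<open>osuc \<xi>\<close> a member of the set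
      whose supremum is \<open>I_hs\<close>, which gives the strict inequality.\<close>
    have "\<exists>C'\<ge>1. V_wins \<phi> Y \<zeta> C'" if "\<zeta> < osuc \<xi>" for \<zeta>
    proof -
      have le: "\<zeta> \<le> \<xi>" using that unfolding less_osuc_iff[OF assms(3)] .
      then have \<zeta>: "\<zeta> < omega1" using assms(3) by (rule order.strict_trans1)
      have "good D C Y (opow omega \<zeta>) []"
        using good_mono[OF Y(3)] opow_omega_mono[OF assms(3) le] by blast
      then have "V_wins \<phi> Y \<zeta> (4 * real C)"
        by (rule good_imp_V_wins[OF assms(2) \<zeta> Y(2,1)])
      moreover have "4 * real C \<ge> 1" using Y(1) by simp
      ultimately show ?thesis by blast
    qed
    then have "osuc \<xi> \<le> I_hs \<phi> Y"
      unfolding I_hs_def using osuc_less_omega1[OF assms(3)] by (intro Sup_upper) blast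
    then have "I_hs \<phi> Y > \<xi>"
      using osuc_greater[OF assms(3)] by (rule order.strict_trans2[rotated])
    then show "\<exists>y. block_sequence e y \<and> I_hs \<phi> y > \<xi>" using Y(2) by blast
  qed
qed

end
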